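(* For every $k\in\{0,1,\ldots,14,16,20\}$ there is an extremal odd unimodular lattice $L$ in dimension $40$ with theta series $\theta_{40,L,4k}$ (equivalently, whose shadow contains exactly $4k$ vectors of norm $2$).
   Context: A lattice $L\subset\mathbb{R}^n$ is unimodular if $L=L^*$, where $L^*$ is the dual lattice; the norm of $x$ is $(x,x)$. A unimodular lattice is even if all norms are even and odd otherwise. A unimodular lattice in dimension $40$ is extremal if its minimum norm is $4$. For an odd unimodular lattice $L$, let $L_0$ be its sublattice of vectors of even norm (of index $2$); the shadow of $L$ is $S=L_0^*\setminus L$. The theta series of a set $X$ is $\sum_{x\in X}q^{(x,x)}$. For an extremal odd unimodular lattice $L$ in dimension $40$ with shadow $S$, the theta series of $L$ and $S$ are of the form $$\theta_{40,L,\alpha}=1+(19120+256\alpha)q^4+(1376256-4096\alpha)q^5+\cdots,$$ $$\theta_{40,S,\alpha}=\alpha q^2+(40960-56\alpha)q^4+(87818240+1500\alpha)q^6+\cdots,$$ where $\alpha$ is an integer, equal to the number of vectors of norm $2$ in $S$, which determines both series. Explicitly, $\theta_{40,L,\alpha}=\sum_{j=0}^{4}a_j\theta_3(q)^{40-8j}\Delta_8(q)^j$ with $a_0=1$, $a_1=-80$, $a_2=1360$, $a_3=-2560$, $a_4=2^8\alpha$, where $\theta_3(q)=\sum_{m\in\mathbb{Z}}q^{m^2}$ and $\Delta_8(q)=q\prod_{m\ge1}(1-q^{2m-1})^8(1-q^{4m})^8$. *)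

theory Defs
  imports "HOL-Analysis.Analysis"
begin

section \<open>Lattices in Euclidean space\<close>

text \<open>The \<^emph>\<open>norm\<close> of a vector \<open>x\<close> is always the inner product \<open>x \<bullet> x\<close>, not its square root.\<close>

definition int_span :: "'a::euclidean_space set \<Rightarrow> 'a set" where
  "int_span B = {\<Sum>b\<in>B. of_int (c b) *\<^sub>R b | c :: 'a \<Rightarrow> int. True}"

definition euclidean_lattice :: "'a::euclidean_space set \<Rightarrow> bool" where
  "euclidean_lattice L \<longleftrightarrow> (\<exists>B. independent B \<and> span B = UNIV \<and> L = int_span B)"

definition dual_lattice :: "'a::euclidean_space set \<Rightarrow> 'a set" where
  "dual_lattice L = {y. \<forall>x\<in>L. x \<bullet> y \<in> \<int>}"

definition unimodular_lattice :: "'a::euclidean_space set \<Rightarrow> bool" where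
  "unimodular_lattice L \<longleftrightarrow> euclidean_lattice L \<and> L = dual_lattice L"

definition even_norm :: "'a::euclidean_space \<Rightarrow> bool" where
  "even_norm x \<longleftrightarrow> (\<exists>m::int. x \<bullet> x = 2 * of_int m)"

definition even_unimodular :: "'a::euclidean_space set \<Rightarrow> bool" where
  "even_unimodular L \<longleftrightarrow> unimodular_lattice L \<and> (\<forall>x\<in>L. even_norm x)"

definition odd_unimodular :: "'a::euclidean_space set \<Rightarrow> bool" where
  "odd_unimodular L \<longleftrightarrow> unimodular_lattice L \<and> \<not> even_unimodular L"

definition min_norm :: "'a::euclidean_space set \<Rightarrow> real" where
  "min_norm L = Inf {x \<bullet> x | x. x \<in> L \<and> x \<noteq> 0}"

definition extremal40 :: "(real ^ 40) set \<Rightarrow> bool" where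
  "extremal40 L \<longleftrightarrow> unimodular_lattice L \<and> min_norm L = 4"

definition even_sublattice :: "'a::euclidean_space set \<Rightarrow> 'a set" where
  "even_sublattice L = {x \<in> L. even_norm x}"

definition shadow :: "'a::euclidean_space set \<Rightarrow> 'a set" where
  "shadow L = dual_lattice (even_sublattice L) - L"


section \<open>Theta series\<close>

text \<open>
  The formal power series \<open>\<Sum>x\<in>X. q^(x \<bullet> x)\<close>, for sets \<open>X\<close> with nonnegative integral norms
  and finitely many vectors of each norm.  Both hold for unimodular lattices; see
  \<open>finite_norm_eq\<close> below for finiteness.
\<close>

definition theta_series :: "'a::euclidean_space set \<Rightarrow> int fps" where
  "theta_series X = Abs_fps (\<lambda>n. int (card {x \<in> X. x \<bullet> x = real n}))"

definition theta3 :: "int fps" where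
  "theta3 = Abs_fps (\<lambda>n. int (card {m::int. m\<^sup>2 = int n}))"

text \<open>
  The infinite product is taken in the metric of formal power series and converges
  (\<open>delta8_factor_convergent\<close>); the factor with index \<open>m\<close> below is the one usually indexed
  by \<open>m + 1\<close>.
\<close>

definition delta8_factor :: "nat \<Rightarrow> int fps" where
  "delta8_factor m = (1 - fps_X ^ (2 * m + 1)) ^ 8 * (1 - fps_X ^ (4 * (m + 1))) ^ 8"

definition Delta8 :: "int fps" where
  "Delta8 = fps_X * prodinf delta8_factor"

definition theta40_coeff :: "int \<Rightarrow> nat \<Rightarrow> int" where
  "theta40_coeff \<alpha> j = [1, -80, 1360, -2560, 2 ^ 8 * \<alpha>] ! j"

definition theta40 :: "int \<Rightarrow> int fps" where
  "theta40 \<alpha> = (\<Sum>j=0..4. fps_const (theta40_coeff \<alpha> j) * theta3 ^ (40 - 8 * j) * Delta8 ^ j)"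


section \<open>Well-definedness\<close>

lemma dvd_power_diff_one: "(d::int fps) dvd a - 1 \<Longrightarrow> d dvd a ^ n - 1"
proof (induction n)
  case (Suc n)
  have "a ^ Suc n - 1 = a * (a ^ n - 1) + (a - 1)" by (simp add: algebra_simps)
  then show ?case using Suc by (metis dvd_add dvd_mult)
qed simp

lemma delta8_factor_dvd: "fps_X ^ (m + 1) dvd delta8_factor m - 1"
proof -
  let ?d = "fps_X ^ (m + 1) :: int fps"
  let ?a = "1 - fps_X ^ (2 * m + 1) :: int fps" and ?b = "1 - fps_X ^ (4 * (m + 1)) :: int fps"
  have "?d dvd fps_X ^ (2 * m + 1)" "?d dvd fps_X ^ (4 * (m + 1))"
    by (rule le_imp_power_dvd; simp)+
  then have "?d dvd ?a - 1" "?d dvd ?b - 1" by simp_all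
  then have "?d dvd ?a ^ 8 - 1" "?d dvd ?b ^ 8 - 1" by (blast intro: dvd_power_diff_one)+
  moreover have "x * y - 1 = y * (x - 1) + (y - 1)" for x y :: "int fps"
    by (simp add: algebra_simps)
  then have "delta8_factor m - 1 = ?b ^ 8 * (?a ^ 8 - 1) + (?b ^ 8 - 1)"
    unfolding delta8_factor_def .
  ultimately show ?thesis by (metis dvd_add dvd_mult)
qed

lemma delta8_factor_convergent: "convergent_prod delta8_factor"
proof -
  define P where "P n = (\<Prod>i<n. delta8_factor i)" for n
  define Q where "Q = Abs_fps (\<lambda>n. fps_nth (P n) n)"
  have step: "fps_nth (P (Suc N)) n = fps_nth (P N) n" if "n \<le> N" for n N
  proof -
    have "P (Suc N) - P N = P N * (delta8_factor N - 1)" by (simp add: P_def algebra_simps)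
    then have "fps_X ^ (N + 1) dvd P (Suc N) - P N" using delta8_factor_dvd[of N] by simp
    then obtain R where "P (Suc N) - P N = fps_X ^ (N + 1) * R" by (elim dvdE)
    then have "fps_nth (P (Suc N) - P N) n = 0" using that by (simp add: fps_X_power_mult_nth del: power_Suc)
    then show ?thesis by simp
  qed
  have stable: "fps_nth (P N) n = fps_nth (P n) n" if "n \<le> N" for n N
    using that by (induction N rule: dec_induct) (simp_all add: step)
  have "(\<lambda>N. P (Suc N)) \<longlonglongrightarrow> Q"
  proof (rule tendsto_fpsI)
    fix n
    show "\<forall>\<^sub>F N in sequentially. fps_nth (P (Suc N)) n = fps_nth Q n"
      using eventually_ge_at_top[of n] by eventually_elim (metis Q_def fps_nth_Abs_fps le_SucI stable)
  qed
  then have "(\<lambda>N. \<Prod>i\<le>N. delta8_factor i) \<longlonglongrightarrow> Q"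
    by (simp add: P_def lessThan_Suc_atMost)
  moreover have "fps_nth Q 0 = 1" by (simp add: Q_def P_def)
  then have "Q \<noteq> 0" by auto
  ultimately show ?thesis unfolding convergent_prod_def raw_has_prod_def by (intro exI[of _ 0] exI[of _ Q]) simp
qed

lemma finite_norm_le:
  assumes "unimodular_lattice L"
  shows "finite {x \<in> L. x \<bullet> x \<le> r}"
proof -
  obtain B where B: "independent B" "span B = UNIV" "L = int_span B"
    using assms by (auto simp: unimodular_lattice_def euclidean_lattice_def)
  have fin: "finite B" using B(1) by (rule independent_imp_finite)
  have BL: "b \<in> L" if "b \<in> B" for b
  proof -
    have "b = (\<Sum>a\<in>B. of_int (if a = b then 1 else 0) *\<^sub>R a)"
      using that fin by (simp add: if_distrib[of "\<lambda>c. c *\<^sub>R _"] if_distrib[of of_int] cong: if_cong)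
    then show ?thesis unfolding B(3) int_span_def mem_Collect_eq
      by (intro exI[of _ "\<lambda>a. if a = b then 1 else 0"]) simp
  qed
  have int: "x \<bullet> b \<in> \<int>" if "x \<in> L" "b \<in> B" for x b
    using assms BL[OF that(2)] that(1)
    by (auto simp: unimodular_lattice_def dual_lattice_def)
  let ?f = "\<lambda>x. restrict (\<lambda>b. x \<bullet> b) B"
  let ?T = "PiE B (\<lambda>b. {k \<in> \<int>. \<bar>k\<bar> \<le> sqrt r * norm b})"
  have "inj_on ?f {x \<in> L. x \<bullet> x \<le> r}"
  proof (rule inj_onI)
    fix x y assume "?f x = ?f y"
    then have "(x - y) \<bullet> b = 0" if "b \<in> B" for b
      using that by (metis inner_diff_left restrict_apply' right_minus_eq)
    then have "orthogonal (x - y) (x - y)"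
      using orthogonal_to_span[of "x - y" B "x - y"] B(2) by (simp add: orthogonal_def)
    then show "x = y" by (simp add: orthogonal_def)
  qed
  moreover have "?f ` {x \<in> L. x \<bullet> x \<le> r} \<subseteq> ?T"
  proof (clarsimp simp: int)
    fix x b assume "x \<bullet> x \<le> r"
    then have "norm x \<le> sqrt r" by (simp add: norm_eq_sqrt_inner)
    then show "\<bar>x \<bullet> b\<bar> \<le> sqrt r * norm b"
      using Cauchy_Schwarz_ineq2[of x b] by (meson mult_right_mono norm_ge_zero order_trans)
  qed
  moreover have "finite ?T" using fin by (intro finite_PiE finite_abs_int_segment)
  ultimately show ?thesis by (meson finite_imageD finite_subset)
qed

lemma finite_norm_eq:
  assumes "unimodular_lattice L"
  shows "finite {x \<in> L. x \<bullet> x = r}"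
  by (rule finite_subset[OF _ finite_norm_le[OF assms, of r]]) auto

lemma finite_shadow_norm_eq:
  assumes "unimodular_lattice L"
  shows "finite {x \<in> shadow L. x \<bullet> x = r}"
proof -
  have "2 *\<^sub>R x \<in> L" if "x \<in> shadow L" for x
  proof -
    have "y \<bullet> (2 *\<^sub>R x) \<in> \<int>" if "y \<in> L" for y
    proof -
      have "z \<bullet> (2 *\<^sub>R y) \<in> \<int>" if "z \<in> L" for z
      proof -
        have "z \<bullet> y \<in> \<int>" using assms that \<open>y \<in> L\<close> by (auto simp: unimodular_lattice_def dual_lattice_def)
        then show ?thesis by (simp add: Ints_mult)
      qed
      then have "2 *\<^sub>R y \<in> L" using assms by (auto simp: unimodular_lattice_def dual_lattice_def)
      moreover have "y \<bullet> y \<in> \<int>" using assms that by (auto simp: unimodular_lattice_def dual_lattice_def)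
      then obtain m :: int where "y \<bullet> y = of_int m" by (auto elim: Ints_cases)
      then have "even_norm (2 *\<^sub>R y)" unfolding even_norm_def by (intro exI[of _ "2 * m"]) simp
      ultimately have "(2 *\<^sub>R y) \<bullet> x \<in> \<int>"
        using \<open>x \<in> shadow L\<close> by (auto simp: shadow_def dual_lattice_def even_sublattice_def)
      then show ?thesis by simp
    qed
    then show ?thesis using assms by (auto simp: unimodular_lattice_def dual_lattice_def)
  qed
  then have "(\<lambda>x. 2 *\<^sub>R x) ` {x \<in> shadow L. x \<bullet> x = r} \<subseteq> {x \<in> L. x \<bullet> x = 4 * r}"
    by auto
  then have "finite ((\<lambda>x. 2 *\<^sub>R x) ` {x \<in> shadow L. x \<bullet> x = r})"
    using finite_norm_eq[OF assms] finite_subset by blast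
  then show ?thesis by (rule finite_imageD) (simp add: inj_on_def)
qed

end

theory Submission
  imports Defs "HOL-Computational_Algebra.Formal_Laurent_Series"
begin

text \<open>
  The lattices are \<open>L = {u / 2 | u \<in> U}\<close> for subsets \<open>U\<close> of \<open>\<int>^40\<close> that contain \<open>4 \<int>^40\<close> and are
  self-dual modulo 4 (Construction A applied to a self-dual code over the integers modulo 4).  Two
  things have to be seen: such a lattice has the predicted theta series, and there are enough codes.

  \<^bold>\<open>The theta series.\<close>  No modular forms are used.  Put \<open>q = t^4\<close> and let \<open>x, y, z\<close> be
  the sums of \<open>t^(m^2)\<close> over even \<open>m\<close>, of \<open>(-1)^(m/2) t^(m^2)\<close> over even \<open>m\<close>, and of \<open>t^(m^2)\<close> over
  odd \<open>m\<close>; thus \<open>x = \<theta>\<^sub>3(q)\<close>, and \<open>y, z\<close> are its two companions.  The set \<open>R\<close> of supports of odd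
  coordinates of elements of \<open>U\<close> is a binary code, and \<open>U\<close> consists of the vectors congruent modulo 2
  to a word of \<open>R\<close> that satisfy one parity condition for each word of \<open>R\<close>.  Detecting these
  conditions with characters turns the theta series into
  \<open>|R|\<inverse> \<Sum> \<epsilon>(r, a) x^(n - |r| - |a|) y^|a| z^|r|\<close>, a sum over the disjoint pairs of words; overlapping
  pairs cancel.  The sign \<open>\<epsilon>\<close> is symmetric because \<open>U\<close> is self-dual, so the sum is a symmetric form in
  \<open>y^4, z^4\<close>; since \<open>x^4 = y^4 + z^4\<close> (\<open>Jacobi_quartic\<close>) and \<open>y^4 z^4 = 16 \<Delta>\<^sub>8(q)\<close>
  (\<open>theta_product_eq_Delta8\<close>), it is a combination of the series \<open>\<theta>\<^sub>3^(40-8j) \<Delta>\<^sub>8^j\<close>, \<open>j \<le> 5\<close>.  The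
  theta series of the shadow is the same form evaluated at \<open>-y^4, x^4\<close>
  (\<open>theta_shadow_eq_weight_form\<close>).  Hence the four coefficients up to \<open>q^3\<close> of the lattice and the
  numbers of shadow vectors of norm 0 and 2 determine all six unknowns (\<open>theta_determined\<close>).

  \<^bold>\<open>The codes.\<close>  Take 40 distinct points in the affine space of odd vectors of \<open>GF(2)^m\<close>, identified with
  the 40 coordinates, such that every nonzero linear functional is 1 on 16, 20, 24 or 40 of
  them.  The functionals then form a doubly even binary code of minimum weight at least 16.  It lifts to
  a self-dual code modulo 4, and the lift can be chosen so that the norm of \<open>u / 2\<close> modulo 2 is the
  value at any prescribed nonzero \<open>\<sigma> \<in> GF(2)^m\<close> of even weight of the functional to which \<open>u\<close> reduces
  (\<open>ex_selforthogonal_lift\<close>).  If \<open>u \<in> U\<close> has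
  odd coordinates, it has at least 16 of them, so the norm of \<open>u / 2\<close> is at least 4; all other vectors of \<open>L\<close>
  are integral, and a nonzero one of norm below 4 would force two points to coincide.  The shadow vectors of norm 2 are the \<open>\<plusminus>e\<^sub>a \<plusminus> e\<^sub>b\<close>
  with \<open>p\<^sub>a + p\<^sub>b = \<sigma>\<close>, so there are four for each pair of points differing by \<open>\<sigma>\<close>
  (\<open>card_shadow_norm_8\<close>).  Four point sets have translations \<open>\<sigma>\<close> realising all the required numbers
  \<open>k\<close> of pairs, which is checked by computation.
\<close>

section \<open>Weighted generating functions\<close>

text \<open>
  The series \<open>\<Sum>a\<in>S. w a t^(N a)\<close>.  All theta series below have this shape.  Weights with signs
  are what makes character sums available, and the identities are reindexings of such sums; the
  fibres of \<open>N\<close> on \<open>S\<close> must be finite for products and restrictions to make sense.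
\<close>

definition weighted_series :: "'a set \<Rightarrow> ('a \<Rightarrow> nat) \<Rightarrow> ('a \<Rightarrow> int) \<Rightarrow> int fps" where
  "weighted_series S N w = Abs_fps (\<lambda>n. \<Sum>a | a \<in> S \<and> N a = n. w a)"

definition finite_fibres :: "'a set \<Rightarrow> ('a \<Rightarrow> nat) \<Rightarrow> bool" where
  "finite_fibres S N \<longleftrightarrow> (\<forall>n. finite {a \<in> S. N a = n})"

lemma finite_fibresD: "finite_fibres S N \<Longrightarrow> finite {a \<in> S. N a = n}"
  by (simp add: finite_fibres_def)

lemma weighted_series_nth: "fps_nth (weighted_series S N w) n = (\<Sum>a | a \<in> S \<and> N a = n. w a)"
  by (simp add: weighted_series_def)

lemma weighted_series_cong: "(\<And>a. a \<in> S \<Longrightarrow> w a = w' a) \<Longrightarrow> weighted_series S N w = weighted_series S N w'"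
  by (auto simp: weighted_series_def intro!: sum.cong arg_cong[where f = Abs_fps])

lemma weighted_series_add: "weighted_series S N (\<lambda>a. w a + w' a) = weighted_series S N w + weighted_series S N w'"
  by (rule fps_ext) (simp add: weighted_series_nth sum.distrib)

lemma weighted_series_cmult: "weighted_series S N (\<lambda>a. c * w a) = fps_const c * weighted_series S N w"
  by (rule fps_ext) (simp add: weighted_series_nth sum_distrib_left)

lemma weighted_series_sum: "weighted_series S N (\<lambda>a. \<Sum>i\<in>I. w i a) = (\<Sum>i\<in>I. weighted_series S N (w i))"
  by (rule fps_ext) (simp add: weighted_series_nth fps_sum_nth, subst sum.swap, rule refl)

lemma weighted_series_restrict:
  assumes "finite_fibres S N" "T \<subseteq> S" "\<And>a. a \<in> S \<Longrightarrow> a \<notin> T \<Longrightarrow> w a = 0"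
  shows "weighted_series S N w = weighted_series T N w"
proof (rule fps_ext)
  fix n
  show "fps_nth (weighted_series S N w) n = fps_nth (weighted_series T N w) n"
    unfolding weighted_series_nth using assms by (intro sum.mono_neutral_right finite_fibresD) auto
qed

lemma weighted_series_reindex:
  assumes "bij_betw h S T" "\<And>a. a \<in> S \<Longrightarrow> M (h a) = N a" "\<And>a. a \<in> S \<Longrightarrow> v (h a) = w a"
  shows "weighted_series S N w = weighted_series T M v"
proof (rule fps_ext)
  fix n
  have "bij_betw h {a. a \<in> S \<and> N a = n} {a. a \<in> T \<and> M a = n}"
    using assms(1,2) by (auto simp: bij_betw_def inj_on_def)
  then show "fps_nth (weighted_series S N w) n = fps_nth (weighted_series T M v) n"
    unfolding weighted_series_nth using assms(3) by (subst sum.reindex_bij_betw[symmetric]) auto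
qed

lemma finite_fibres_prod:
  assumes "finite_fibres S N" "finite_fibres T M"
  shows "finite_fibres (S \<times> T) (\<lambda>(a, b). N a + M b)"
  unfolding finite_fibres_def
proof
  fix n
  have "{p \<in> S \<times> T. (\<lambda>(a, b). N a + M b) p = n}
      = (\<Union>i\<in>{..n}. {a \<in> S. N a = i} \<times> {b \<in> T. M b = n - i})" by auto
  then show "finite {p \<in> S \<times> T. (\<lambda>(a, b). N a + M b) p = n}"
    using assms by (simp add: finite_fibresD)
qed

lemma weighted_series_mult:
  assumes "finite_fibres S N" "finite_fibres T M"
  shows "weighted_series S N w * weighted_series T M v = weighted_series (S \<times> T) (\<lambda>(a, b). N a + M b) (\<lambda>(a, b). w a * v b)"
proof (rule fps_ext)
  fix n
  let ?A = "\<lambda>i. {a. a \<in> S \<and> N a = i} \<times> {b. b \<in> T \<and> M b = n - i}"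
  have fin: "finite {a. a \<in> S \<and> N a = i}" "finite {b. b \<in> T \<and> M b = i}" for i
    using assms by (simp_all add: finite_fibres_def)
  have *: "{p. p \<in> S \<times> T \<and> (\<lambda>(a, b). N a + M b) p = n} = (\<Union>i\<in>{0..n}. ?A i)" by auto
  have "fps_nth (weighted_series S N w * weighted_series T M v) n
      = (\<Sum>i=0..n. (\<Sum>a | a \<in> S \<and> N a = i. w a) * (\<Sum>b | b \<in> T \<and> M b = n - i. v b))"
    by (simp add: fps_mult_nth weighted_series_nth)
  also have "\<dots> = (\<Sum>i=0..n. \<Sum>p\<in>?A i. case p of (a, b) \<Rightarrow> w a * v b)"
    by (intro sum.cong refl) (simp only: sum_product sum.cartesian_product)
  also have "\<dots> = (\<Sum>p\<in>(\<Union>i\<in>{0..n}. ?A i). case p of (a, b) \<Rightarrow> w a * v b)"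
    by (rule sum.UNION_disjoint[symmetric]) (use fin in auto)
  finally show "fps_nth (weighted_series S N w * weighted_series T M v) n
      = fps_nth (weighted_series (S \<times> T) (\<lambda>(a, b). N a + M b) (\<lambda>(a, b). w a * v b)) n"
    by (simp only: weighted_series_nth *)
qed

lemma compose_X_power_inject:
  assumes "0 < c" "(F :: int fps) oo fps_X ^ c = G oo fps_X ^ c"
  shows "F = G"
proof (rule fps_ext)
  fix n
  have "fps_nth (F oo fps_X ^ c) (c * n) = fps_nth (G oo fps_X ^ c) (c * n)" using assms(2) by simp
  then show "fps_nth F n = fps_nth G n" using assms(1) by (simp add: fps_nth_compose_X_power)
qed

lemma compose_X_power_mult:
  "0 < c \<Longrightarrow> ((F :: int fps) * G) oo fps_X ^ c = (F oo fps_X ^ c) * (G oo fps_X ^ c)"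
  by (rule fps_compose_mult_distrib) simp

lemma compose_X_power_power:
  "0 < c \<Longrightarrow> ((F :: int fps) ^ k) oo fps_X ^ c = (F oo fps_X ^ c) ^ k"
  by (induction k) (simp_all add: compose_X_power_mult)

lemma compose_X_power_compose:
  "0 < c \<Longrightarrow> 0 < d \<Longrightarrow> ((F :: int fps) oo fps_X ^ c) oo fps_X ^ d = F oo fps_X ^ (c * d)"
proof (rule fps_ext)
  fix n
  assume *: "0 < c" "0 < d"
  then have "d dvd n \<and> c dvd n div d \<longleftrightarrow> c * d dvd n"
    by (metis dvd_div_iff_mult dvd_mult_right mult.commute neq0_conv)
  then show "fps_nth ((F oo fps_X ^ c) oo fps_X ^ d) n = fps_nth (F oo fps_X ^ (c * d)) n"
    by (auto simp: fps_nth_compose_X_power div_mult2_eq mult.commute[of c d])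
qed

lemma weighted_series_scaled:
  assumes "0 < c"
  shows "weighted_series S (\<lambda>a. c * N a) w = weighted_series S N w oo fps_X ^ c"
proof (rule fps_ext)
  fix n
  show "fps_nth (weighted_series S (\<lambda>a. c * N a) w) n = fps_nth (weighted_series S N w oo fps_X ^ c) n"
    using assms by (cases "c dvd n") (auto simp: weighted_series_nth fps_nth_compose_X_power intro!: sum.neutral)
qed

section \<open>Theta series in one variable\<close>

definition alt :: "int \<Rightarrow> int" where
  "alt k = (if even k then 1 else - 1)"

lemma alt_add: "alt (a + b) = alt a * alt b"
  by (simp add: alt_def)

lemma alt_mult_self [simp]: "alt a * alt a = 1"
  by (simp add: alt_def)

lemma odd_square_mod_8:
  assumes "odd x"
  shows "8 dvd x\<^sup>2 - (1 :: int)"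
proof -
  obtain d where d: "x = 2 * d + 1" using assms by (elim oddE)
  obtain e where "d * (d + 1) = 2 * e" by (rule evenE[of "d * (d + 1)"]) simp_all
  moreover have "x\<^sup>2 - 1 = 4 * (d * (d + 1))" unfolding d by (simp add: power2_eq_square algebra_simps)
  ultimately show ?thesis by simp
qed

definition sq :: "int \<Rightarrow> nat" where
  "sq m = nat (m\<^sup>2)"

lemma finite_fibres_sq: "finite_fibres UNIV sq"
  unfolding finite_fibres_def
proof
  fix n
  have "{a \<in> UNIV. sq a = n} \<subseteq> {- int n..int n}"
  proof
    fix a assume "a \<in> {a \<in> UNIV. sq a = n}"
    then have "a\<^sup>2 = int n" by (auto simp: sq_def)
    moreover have "\<bar>a\<bar> * 1 \<le> \<bar>a\<bar> * \<bar>a\<bar>"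
      by (cases "a = 0") (simp, intro mult_left_mono, auto)
    then have "\<bar>a\<bar> \<le> a\<^sup>2" by (simp add: power2_eq_square)
    ultimately show "a \<in> {- int n..int n}" by auto
  qed
  then show "finite {a \<in> UNIV. sq a = n}" by (rule finite_subset) simp
qed

definition weighted_theta :: "(int \<Rightarrow> int) \<Rightarrow> int fps" where
  "weighted_theta w = weighted_series UNIV sq w"

definition weighted_theta2 :: "(int \<Rightarrow> int \<Rightarrow> int) \<Rightarrow> int fps" where
  "weighted_theta2 w = weighted_series UNIV (\<lambda>(a, b). sq a + sq b) (\<lambda>(a, b). w a b)"

lemma weighted_theta_mult: "weighted_theta w * weighted_theta v = weighted_theta2 (\<lambda>a b. w a * v b)"
  unfolding weighted_theta_def weighted_theta2_def by (subst weighted_series_mult) (simp_all add: finite_fibres_sq)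

lemma weighted_theta2_add: "weighted_theta2 (\<lambda>a b. w a b + v a b) = weighted_theta2 w + weighted_theta2 v"
  unfolding weighted_theta2_def by (subst weighted_series_add[symmetric]) (simp add: case_prod_unfold)

lemma weighted_theta2_cmult: "weighted_theta2 (\<lambda>a b. c * w a b) = fps_const c * weighted_theta2 w"
  unfolding weighted_theta2_def by (subst weighted_series_cmult[symmetric]) (simp add: case_prod_unfold)

lemma sq_add: "sq a + sq b = nat (a\<^sup>2 + b\<^sup>2)"
  by (simp add: sq_def nat_add_distrib)

text \<open>
  Source of every quadratic relation: \<open>(a, b) \<mapsto> (a + b, a - b)\<close> doubles \<open>a^2 + b^2\<close> and maps \<open>\<int>^2\<close>
  onto the pairs of equal parity.
\<close>

lemma weighted_theta2_rotate:
  assumes "\<And>a b. odd (a + b) \<Longrightarrow> w a b = 0"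
  shows "weighted_theta2 w = weighted_theta2 (\<lambda>a b. w (a + b) (a - b)) oo fps_X ^ 2"
proof -
  let ?N = "\<lambda>(a, b). sq a + sq b"
  have "finite_fibres (UNIV :: (int \<times> int) set) ?N"
    using finite_fibres_prod[OF finite_fibres_sq finite_fibres_sq] by simp
  then have "weighted_theta2 w = weighted_series {(a, b). even (a + b)} ?N (\<lambda>(a, b). w a b)"
    unfolding weighted_theta2_def using assms by (intro weighted_series_restrict) auto
  also have "\<dots> = weighted_series UNIV (\<lambda>p. 2 * ?N p) (\<lambda>(a, b). w (a + b) (a - b))"
  proof (rule weighted_series_reindex[symmetric, where h = "\<lambda>(a, b). (a + b, a - b)"])
    show "bij_betw (\<lambda>(a, b). (a + b, a - b)) UNIV {(a :: int, b). even (a + b)}"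
    proof (rule bij_betw_byWitness[where f' = "\<lambda>(a, b). ((a + b) div 2, (a - b) div 2)"])
      have "(a + b) div 2 + (a - b) div 2 = a" "(a + b) div 2 - (a - b) div 2 = b"
        if "even (a + b)" for a b :: int using that by presburger+
      then show "\<forall>p\<in>{(a :: int, b). even (a + b)}. (\<lambda>(a, b). (a + b, a - b))
          ((\<lambda>(a, b). ((a + b) div 2, (a - b) div 2)) p) = p" by auto
    qed auto
  qed (auto simp: sq_add power2_eq_square algebra_simps simp flip: nat_mult_distrib)
  also have "\<dots> = weighted_theta2 (\<lambda>a b. w (a + b) (a - b)) oo fps_X ^ 2"
    unfolding weighted_theta2_def by (rule weighted_series_scaled) simp
  finally show ?thesis .
qed


text \<open>
  In terms of \<open>q = t^4\<close> these three are Jacobi's \<open>\<theta>\<^sub>3\<close>, \<open>\<theta>\<^sub>4\<close> and \<open>\<theta>\<^sub>2\<close>.  The variable \<open>t\<close> keeps the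
  exponents of \<open>\<theta>\<^sub>2\<close> integral.
\<close>

definition theta_even :: "int fps" where
  "theta_even = weighted_theta (\<lambda>m. of_bool (even m))"

definition theta_alt :: "int fps" where
  "theta_alt = weighted_theta (\<lambda>m. of_bool (even m) * alt (m div 2))"

definition theta_odd :: "int fps" where
  "theta_odd = weighted_theta (\<lambda>m. of_bool (odd m))"

lemma theta_odd_squared: "theta_odd\<^sup>2 = 2 * ((theta_even * theta_odd) oo fps_X ^ 2)"
proof -
  have "theta_odd\<^sup>2 = weighted_theta2 (\<lambda>a b. of_bool (odd a) * of_bool (odd b))"
    by (simp add: theta_odd_def power2_eq_square weighted_theta_mult)
  also have "\<dots> = weighted_theta2 (\<lambda>a b. of_bool (odd (a + b)) * of_bool (odd (a - b))) oo fps_X ^ 2"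
    by (rule weighted_theta2_rotate) auto
  also have "(\<lambda>a b :: int. of_bool (odd (a + b)) * of_bool (odd (a - b)) :: int)
      = (\<lambda>a b. of_bool (even a) * of_bool (odd b) + of_bool (odd a) * of_bool (even b))"
    by (intro ext) auto
  also have "weighted_theta2 \<dots> = 2 * (theta_even * theta_odd)"
    unfolding weighted_theta2_add weighted_theta_mult[symmetric] by (simp add: theta_even_def theta_odd_def mult.commute)
  finally show ?thesis by (simp add: compose_X_power_mult)
qed

lemma theta_even_alt_squares:
  shows "theta_even\<^sup>2 + theta_alt\<^sup>2 = 2 * (theta_even\<^sup>2 oo fps_X ^ 2)" (is ?plus)
    and "theta_even\<^sup>2 - theta_alt\<^sup>2 = 2 * (theta_odd\<^sup>2 oo fps_X ^ 2)" (is ?minus)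
proof -
  have ee: "theta_even\<^sup>2 = weighted_theta2 (\<lambda>a b. of_bool (even a) * of_bool (even b))"
    by (simp add: theta_even_def power2_eq_square weighted_theta_mult)
  have oo: "theta_odd\<^sup>2 = weighted_theta2 (\<lambda>a b. of_bool (odd a) * of_bool (odd b))"
    by (simp add: theta_odd_def power2_eq_square weighted_theta_mult)
  have aa: "theta_alt\<^sup>2 = weighted_theta2 (\<lambda>a b. of_bool (even a) * alt (a div 2) * (of_bool (even b) * alt (b div 2)))"
    by (simp add: theta_alt_def power2_eq_square weighted_theta_mult)
  have *: "theta_even\<^sup>2 + fps_const c * theta_alt\<^sup>2
      = weighted_theta2 (\<lambda>a b. of_bool (even (a + b)) * of_bool (even (a - b)) + c * (of_bool (even (a + b)) * alt ((a + b) div 2) * (of_bool (even (a - b)) * alt ((a - b) div 2)))) oo fps_X ^ 2" for c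
    unfolding ee aa weighted_theta2_cmult[symmetric] weighted_theta2_add[symmetric]
    by (rule weighted_theta2_rotate) auto
  have alt': "alt ((a + b) div 2) * alt ((a - b) div 2) = alt a" if "even (a + b)" for a b
  proof -
    have "(a + b) div 2 + (a - b) div 2 = a" using that by presburger
    then show ?thesis by (metis alt_add)
  qed
  have "of_bool (even (a + b)) * of_bool (even (a - b)) + c * (of_bool (even (a + b)) * alt ((a + b) div 2) * (of_bool (even (a - b)) * alt ((a - b) div 2)))
      = (1 + c) * (of_bool (even a) * of_bool (even b)) + (1 - c) * (of_bool (odd a) * of_bool (odd b))" for a b c
    using alt'[of a b] by (cases "even a"; cases "even b") (auto simp: alt_def)
  then have **: "theta_even\<^sup>2 + fps_const c * theta_alt\<^sup>2
      = (fps_const (1 + c) * theta_even\<^sup>2 + fps_const (1 - c) * theta_odd\<^sup>2) oo fps_X ^ 2" for c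
    unfolding * by (simp add: weighted_theta2_add weighted_theta2_cmult ee oo)
  show ?plus using **[of 1] by (simp add: compose_X_power_mult flip: numeral_fps_const)
  show ?minus using **[of "-1"] by (simp add: compose_X_power_mult flip: numeral_fps_const fps_const_neg)
qed

text \<open>
  Difference of squares: the two factors are \<open>2 x(t^2)^2\<close> and \<open>2 z(t^2)^2\<close>, and \<open>z^2 = 2 x(t^2) z(t^2)\<close>.
\<close>

theorem Jacobi_quartic: "theta_even ^ 4 = theta_alt ^ 4 + theta_odd ^ 4"
proof -
  have "theta_even ^ 4 - theta_alt ^ 4 = (theta_even\<^sup>2 + theta_alt\<^sup>2) * (theta_even\<^sup>2 - theta_alt\<^sup>2)"
    by (simp add: algebra_simps power2_eq_square power4_eq_xxxx)
  also have "\<dots> = (2 * ((theta_even * theta_odd) oo fps_X ^ 2))\<^sup>2"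
    unfolding theta_even_alt_squares
    by (simp add: compose_X_power_mult compose_X_power_power power_mult_distrib)
  also have "\<dots> = theta_odd ^ 4"
    unfolding theta_odd_squared[symmetric] by simp
  finally show ?thesis by (simp add: algebra_simps)
qed

section \<open>Gauss's product for the triangular series and the product formula for Delta8\<close>

definition triangular :: "nat \<Rightarrow> nat" where
  "triangular k = k * (k + 1) div 2"

lemma triangular_double: "2 * triangular k = k * (k + 1)"
  by (simp add: triangular_def)

lemma le_triangular: "k \<le> triangular k"
proof (cases k)
  case (Suc j)
  then have "2 * k \<le> k * (k + 1)" by simp
  then show ?thesis using triangular_double[of k] by linarith
qed simp

lemma finite_triangular_fibres: "finite_fibres UNIV triangular"
  unfolding finite_fibres_def
proof
  fix n
  have "{a \<in> UNIV. triangular a = n} \<subseteq> {..n}" using le_triangular by auto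
  then show "finite {a \<in> UNIV. triangular a = n}" by (rule finite_subset) simp
qed

definition triangular_series :: "(nat \<Rightarrow> int) \<Rightarrow> int fps" where
  "triangular_series w = weighted_series UNIV triangular w"

text \<open>
  The odd numbers are \<open>\<plusminus>(2 k + 1)\<close>, and \<open>(2 k + 1)^2\<close> is 8 times a triangular number plus 1.
\<close>

lemma weighted_theta_odd_eq_triangular_series:
  assumes "\<And>m. even m \<Longrightarrow> w m = 0" "\<And>k. w (2 * int k + 1) = v k" "\<And>k. w (- (2 * int k + 1)) = v k"
  shows "weighted_theta w = 2 * fps_X * (triangular_series v oo fps_X ^ 8)"
proof -
  have fin: "finite_fibres UNIV (\<lambda>k. 8 * triangular k)"
    unfolding finite_fibres_def
  proof
    show "finite {a \<in> UNIV. 8 * triangular a = n}" for n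
      by (rule finite_subset[OF _ finite_fibresD[OF finite_triangular_fibres, of "n div 8"]]) auto
  qed
  have one: "weighted_series (UNIV :: bool set) (\<lambda>_. 1) (\<lambda>_. 1) = 2 * fps_X"
    by (rule fps_ext) (auto simp: weighted_series_nth fps_X_def fps_numeral_fps_const UNIV_bool)
  have "weighted_theta w = weighted_series {m. odd m} sq w"
    unfolding weighted_theta_def using assms(1) by (intro weighted_series_restrict finite_fibres_sq) auto
  also have "\<dots> = weighted_series (UNIV \<times> UNIV) (\<lambda>(k, s). 8 * triangular k + 1) (\<lambda>(k, s :: bool). v k * 1)"
  proof (rule weighted_series_reindex[symmetric, where h = "\<lambda>(k, s). if s then 2 * int k + 1 else - (2 * int k + 1)"])
    show "bij_betw (\<lambda>(k, s). if s then 2 * int k + 1 else - (2 * int k + 1)) (UNIV \<times> UNIV) {m. odd m}"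
      by (rule bij_betw_byWitness[where f' = "\<lambda>m. (nat ((\<bar>m\<bar> - 1) div 2), 0 < m)"])
         (auto split: if_splits)
    have "(2 * int k + 1)\<^sup>2 = int (8 * triangular k + 1)" for k
    proof -
      have "(2 * int k + 1)\<^sup>2 = 4 * int (k * (k + 1)) + 1" by (simp add: power2_eq_square algebra_simps)
      then show ?thesis unfolding triangular_double[symmetric] by simp
    qed
    moreover have "(- (2 * int k + 1))\<^sup>2 = (2 * int k + 1)\<^sup>2" for k by (rule power2_minus)
    ultimately have "sq (if s then 2 * int k + 1 else - (2 * int k + 1)) = 8 * triangular k + 1" for k s
      by (simp only: sq_def if_distrib[of "\<lambda>m. m\<^sup>2"] if_cancel nat_int)
    then show "sq (case p of (k, s) \<Rightarrow> if s then 2 * int k + 1 else - (2 * int k + 1))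
        = (case p of (k, s) \<Rightarrow> 8 * triangular k + 1)" for p
      by (simp only: split: prod.split) simp
  qed (use assms in auto)
  also have "\<dots> = weighted_series UNIV (\<lambda>k. 8 * triangular k) v * weighted_series (UNIV :: bool set) (\<lambda>_. 1) (\<lambda>_. 1)"
    by (subst weighted_series_mult) (use fin in \<open>auto simp: finite_fibres_def\<close>)
  also have "\<dots> = (triangular_series v oo fps_X ^ 8) * (2 * fps_X)"
    by (simp only: one weighted_series_scaled[of 8 UNIV triangular v, simplified] triangular_series_def)
  finally show ?thesis by (simp only: mult.commute)
qed


text \<open>
  Rotate the square of the odd series in which \<open>m\<close> carries the sign of the triangular number
  \<open>(m^2 - 1) / 8\<close>.  After the rotation exactly one of the two variables is even, and the sign becomes the
  parity of half that variable, which is the sign in the series of \<open>\<theta>\<^sub>4\<close>.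
\<close>

lemma alt_theta_relation:
  "theta_alt * theta_odd = 2 * fps_X * (triangular_series (\<lambda>k. alt (int (triangular k))) oo fps_X ^ 4)\<^sup>2"
proof -
  let ?Psi = "triangular_series (\<lambda>k. alt (int (triangular k)))"
  \<comment> \<open>The sign of \<open>m = \<plusminus>(2 k + 1)\<close> is that of the \<open>k\<close>-th triangular number.\<close>
  define w where "w = (\<lambda>m :: int. of_bool (odd m) * alt ((m\<^sup>2 - 1) div 8))"
  have odd_square: "((2 * int k + 1)\<^sup>2 - 1) div 8 = int (triangular k)" for k
  proof -
    have "(2 * int k + 1)\<^sup>2 - 1 = 4 * int (k * (k + 1))" by (simp add: power2_eq_square algebra_simps)
    also have "\<dots> = 8 * int (triangular k)" unfolding triangular_double[symmetric] by simp
    finally show ?thesis by simp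
  qed
  have "weighted_theta w = 2 * fps_X * (?Psi oo fps_X ^ 8)"
  proof (rule weighted_theta_odd_eq_triangular_series)
    show "w (- (2 * int k + 1)) = alt (int (triangular k))" for k
      unfolding w_def power2_minus odd_square by simp
  qed (simp_all add: w_def odd_square)
  then have w_sq: "(weighted_theta w)\<^sup>2 = 4 * fps_X ^ 2 * (?Psi oo fps_X ^ 8)\<^sup>2"
    by (simp add: power_mult_distrib)
  have exponent: "((a + b)\<^sup>2 - 1) div 8 + ((a - b)\<^sup>2 - 1) div 8 = (a\<^sup>2 + b\<^sup>2 - 1) div 4"
    if "odd (a + b)" for a b :: int
  proof -
    have "odd (a - b)" using that by simp
    from odd_square_mod_8[OF that] odd_square_mod_8[OF this] obtain u v where uv: "(a + b)\<^sup>2 - 1 = 8 * u" "(a - b)\<^sup>2 - 1 = 8 * v"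
      unfolding dvd_def by blast
    then have "2 * (a\<^sup>2 + b\<^sup>2 - 1) = 2 * (4 * (u + v))"
      by (simp add: power2_eq_square algebra_simps)
    then have "a\<^sup>2 + b\<^sup>2 - 1 = 4 * (u + v)" by simp
    then show ?thesis using uv by simp
  qed
  have half: "alt ((a\<^sup>2 + b\<^sup>2 - 1) div 4) = alt (a div 2)" if "even a" "odd b" for a b :: int
  proof -
    obtain c d where cd: "a = 2 * c" "b = 2 * d + 1" using \<open>even a\<close> \<open>odd b\<close> by (elim evenE oddE)
    have "a\<^sup>2 + b\<^sup>2 - 1 = 4 * (c * c + d * (d + 1))" unfolding cd by (simp add: power2_eq_square algebra_simps)
    then show ?thesis using cd by (simp add: alt_def)
  qed
  have w_rot: "w (a + b) * w (a - b)
      = of_bool (even a) * alt (a div 2) * of_bool (odd b) + of_bool (odd a) * (of_bool (even b) * alt (b div 2))" for a b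
    using exponent[of a b] half[of a b] half[of b a]
    by (cases "even a"; cases "even b") (simp_all add: w_def add.commute flip: alt_add)
  have "(weighted_theta w)\<^sup>2 = weighted_theta2 (\<lambda>a b. w (a + b) * w (a - b)) oo fps_X ^ 2"
  proof -
    have "(weighted_theta w)\<^sup>2 = weighted_theta2 (\<lambda>a b. w a * w b)" by (simp only: power2_eq_square weighted_theta_mult)
    also have "\<dots> = weighted_theta2 (\<lambda>a b. w (a + b) * w (a - b)) oo fps_X ^ 2"
      by (rule weighted_theta2_rotate) (auto simp: w_def)
    finally show ?thesis .
  qed
  also have "weighted_theta2 (\<lambda>a b. w (a + b) * w (a - b)) = 2 * (theta_alt * theta_odd)"
    unfolding w_rot weighted_theta2_add weighted_theta_mult[symmetric] by (simp add: theta_alt_def theta_odd_def mult.commute)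
  finally have "4 * fps_X ^ 2 * (?Psi oo fps_X ^ 8)\<^sup>2 = (2 * (theta_alt * theta_odd)) oo fps_X ^ 2"
    unfolding w_sq .
  then have "(2 * (2 * fps_X * (?Psi oo fps_X ^ 4)\<^sup>2)) oo fps_X ^ 2 = (2 * (theta_alt * theta_odd)) oo fps_X ^ 2"
    by (simp add: compose_X_power_mult compose_X_power_power compose_X_power_compose mult.assoc)
  then have "2 * (2 * fps_X * (?Psi oo fps_X ^ 4)\<^sup>2) = 2 * (theta_alt * theta_odd)"
    by (rule compose_X_power_inject[rotated]) simp
  then have "2 * fps_X * (?Psi oo fps_X ^ 4)\<^sup>2 = theta_alt * theta_odd"
    by (subst (asm) mult_cancel_left) simp
  then show ?thesis ..
qed

text \<open>
  Finite form, due to Shanks, of Gauss's evaluation of the series with triangular exponents,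
  multiplied out so that it holds in every commutative ring.  Modulo \<open>x^(2 n + 1)\<close> only the term \<open>s = 0\<close>
  on the left survives, which is what exhibits the product.
\<close>

lemma Shanks_triangular_identity:
  fixes x :: "'a::comm_ring_1"
  defines "Q \<equiv> \<lambda>n s. (\<Prod>i\<in>{s..<n}. 1 - x ^ (2 * i + 2)) * (\<Prod>i<s. 1 - x ^ (2 * i + 1))"
  shows "(\<Sum>s<n. Q n s * x ^ (s * (2 * n + 1))) = (\<Prod>i<n. 1 - x ^ (2 * i + 1)) * (\<Sum>k<2 * n. x ^ triangular k)"
proof (induction n)
  case (Suc n)
  define c where "c = x ^ (2 * n + 1)"
  let ?B = "\<Prod>i<n. 1 - x ^ (2 * i + 1)"
  \<comment> \<open>The step from \<open>n\<close> to \<open>n + 1\<close> telescopes: each of the first \<open>n\<close> terms changes by a difference of \<open>V\<close>.\<close>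
  define V where "V s = Q n s * (1 - x ^ (2 * s)) * c ^ s" for s
  have Q_Suc: "Q (Suc n) s = (1 - x * c) * Q n s" if "s \<le> n" for s
    using that by (simp add: Q_def c_def)
  have Q_shift: "Q n (Suc s) * (1 - x ^ (2 * s + 2)) = Q n s * (1 - x ^ (2 * s + 1))" if "s < n" for s
    using that by (simp add: Q_def prod.atLeast_Suc_lessThan[of s n] algebra_simps)
  have c_pow: "x ^ (s * (2 * n + 1)) = c ^ s" for s
    by (simp only: c_def power_mult[symmetric] mult.commute)
  have c_pow': "x ^ (s * (2 * Suc n + 1)) = x ^ (2 * s) * c ^ s" for s
    unfolding c_pow[symmetric] power_add[symmetric] by (simp add: algebra_simps)
  have step: "Q (Suc n) s * x ^ (s * (2 * Suc n + 1)) - (1 - c) * (Q n s * x ^ (s * (2 * n + 1))) = V (Suc s) - V s"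
    if "s < n" for s
  proof -
    have "V (Suc s) = Q n (Suc s) * (1 - x ^ (2 * s + 2)) * c * c ^ s" by (simp add: V_def algebra_simps)
    then have "V (Suc s) = Q n s * (1 - x ^ (2 * s + 1)) * c * c ^ s" using Q_shift[OF that] by simp
    then show ?thesis using that unfolding c_pow c_pow'
      by (simp add: Q_Suc V_def algebra_simps)
  qed
  have "(\<Sum>s<n. Q (Suc n) s * x ^ (s * (2 * Suc n + 1))) - (1 - c) * (\<Sum>s<n. Q n s * x ^ (s * (2 * n + 1)))
      = (\<Sum>s<n. V (Suc s) - V s)"
    unfolding sum_distrib_left sum_subtractf[symmetric] using step by (intro sum.cong) auto
  also have "\<dots> = V n - V 0" by (rule sum_lessThan_telescope)
  also have "\<dots> = ?B * (1 - x ^ (2 * n)) * c ^ n" by (simp add: V_def Q_def)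
  finally have "(\<Sum>s<Suc n. Q (Suc n) s * x ^ (s * (2 * Suc n + 1)))
      = (1 - c) * (?B * (\<Sum>k<2 * n. x ^ triangular k)) + ?B * (1 - x ^ (2 * n)) * c ^ n + (1 - x * c) * ?B * (x ^ (2 * n) * c ^ n)"
    unfolding sum.lessThan_Suc Suc.IH c_pow' by (simp add: Q_Suc) (simp add: Q_def algebra_simps)
  also have "\<dots> = (1 - c) * ?B * ((\<Sum>k<2 * n. x ^ triangular k) + c ^ n + c ^ Suc n)"
    by (simp add: c_def algebra_simps)
  also have "c ^ n = x ^ triangular (2 * n)"
    by (simp only: c_def flip: power_mult) (simp add: triangular_def algebra_simps)
  also have "c ^ Suc n = x ^ triangular (Suc (2 * n))"
    by (simp only: c_def flip: power_mult) (simp add: triangular_def algebra_simps)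
  finally show ?case by (simp add: c_def algebra_simps)
qed simp

lemma X_power_dvd_iff: "fps_X ^ n dvd (F :: int fps) \<longleftrightarrow> (\<forall>k<n. fps_nth F k = 0)"
proof
  assume "fps_X ^ n dvd F"
  then show "\<forall>k<n. fps_nth F k = 0" by (auto elim!: dvdE simp: fps_X_power_mult_nth)
next
  assume *: "\<forall>k<n. fps_nth F k = 0"
  have "F = fps_X ^ n * fps_shift n F"
    by (rule fps_ext) (use * in \<open>simp add: fps_X_power_mult_nth\<close>)
  then show "fps_X ^ n dvd F" by (metis dvd_triv_left)
qed

lemma X_power_dvd_cancel:
  assumes "fps_nth U 0 = 1" "fps_X ^ n dvd U * (F :: int fps)"
  shows "fps_X ^ n dvd F"
proof (cases "F = 0")
  case False
  have "U \<noteq> 0" "subdegree U = 0" using assms(1) by auto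
  then have "subdegree (U * F) = subdegree F" using False by simp
  moreover have "n \<le> subdegree (U * F)"
    using assms(2) \<open>U \<noteq> 0\<close> False unfolding X_power_dvd_iff by (intro subdegree_geI) auto
  ultimately show ?thesis by (auto simp: X_power_dvd_iff intro: nth_less_subdegree_zero)
qed simp

lemma X_power_dvd_prod_minus_1:
  "(\<And>i. i \<in> I \<Longrightarrow> d dvd f i - 1) \<Longrightarrow> (d :: int fps) dvd prod f I - 1"
proof (induction I rule: infinite_finite_induct)
  case (insert i I)
  have "prod f (insert i I) - 1 = f i * (prod f I - 1) + (f i - 1)"
    using insert.hyps by (simp add: algebra_simps)
  then show ?case using insert by (simp only:) (intro dvd_add dvd_mult, auto)
qed simp_all

text \<open>
  Shanks's identity at \<open>-t\<close> gives the quotient of \<open>\<Prod>(1 - t^(2i))\<close> by \<open>\<Prod>(1 + t^(2i-1))\<close>.  Multiplying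
  numerator and denominator by \<open>\<Prod>(1 - t^(2i-1))\<close> turns the denominator into the part \<open>\<Prod>(1 - t^(4i-2))\<close>
  of the numerator, which can be cancelled because its constant term is 1.
\<close>

theorem Gauss_triangular_product:
  "fps_X ^ (2 * n) dvd triangular_series (\<lambda>k. alt (int (triangular k)))
     - (\<Prod>i<n. (1 - fps_X ^ (2 * i + 1)) * (1 - fps_X ^ (4 * (i + 1))))"
proof -
  let ?Psi = "triangular_series (\<lambda>k. alt (int (triangular k)))" and ?X = "fps_X :: int fps"
  define A where "A m = (\<Prod>i<m. 1 - ?X ^ (2 * i + 2))" for m
  define B where "B = (\<Prod>i<n. 1 + ?X ^ (2 * i + 1))"
  define E where "E = (\<Prod>i<n. 1 - ?X ^ (2 * i + 1))"
  define O' where "O' = (\<Prod>i<n. 1 - ?X ^ (4 * i + 2))"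
  define F where "F = (\<Prod>i<n. 1 - ?X ^ (4 * (i + 1)))"
  define S where "S = (\<Sum>k<2 * n. (- ?X) ^ triangular k)"
  let ?d = "?X ^ (2 * n)"
  have minus_even: "(- ?X) ^ (2 * i + 2) = ?X ^ (2 * i + 2)"
    and minus_odd: "(- ?X) ^ (2 * i + 1) = - (?X ^ (2 * i + 1))" for i
    by (simp_all add: power_minus_even power_minus_odd)
  let ?Q = "\<lambda>s. (\<Prod>i\<in>{s..<n}. 1 - ?X ^ (2 * i + 2)) * (\<Prod>i<s. 1 + ?X ^ (2 * i + 1))"
  have BS: "B * S = (\<Sum>s<n. ?Q s * (- ?X) ^ (s * (2 * n + 1)))"
    using Shanks_triangular_identity[of "- ?X" n] unfolding minus_even minus_odd by (simp add: B_def S_def)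
  have first: "?d dvd B * S - A n"
  proof (cases n)
    case (Suc m)
    have "?d dvd ?Q (Suc s) * (- ?X) ^ (Suc s * (2 * n + 1))" for s
      by (rule dvd_mult, rule dvd_trans[OF _ le_imp_power_dvd[of "2 * n"]])
         (auto simp: power_minus_even)
    moreover have "B * S - A n = (\<Sum>s<m. ?Q (Suc s) * (- ?X) ^ (Suc s * (2 * n + 1)))"
      unfolding BS unfolding Suc sum.lessThan_Suc_shift by (simp add: A_def lessThan_atLeast0)
    ultimately show ?thesis by (metis (no_types, lifting) dvd_sum)
  qed simp
  have tail: "?d dvd ?Psi - S"
    unfolding X_power_dvd_iff
  proof (intro allI impI)
    fix j assume j: "j < 2 * n"
    have small: "k < 2 * n" if "triangular k = j" for k
    proof -
      show ?thesis using le_triangular[of k] that j by simp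
    qed
    have "fps_nth S j = (\<Sum>k<2 * n. if triangular k = j then alt (int (triangular k)) else 0)"
      unfolding S_def fps_sum_nth
      by (intro sum.cong refl) (auto simp: alt_def power_minus[of fps_X] minus_one_power_iff)
    also have "\<dots> = (\<Sum>k | k < 2 * n \<and> triangular k = j. alt (int (triangular k)))"
      by (simp add: sum.If_cases Collect_conj_eq lessThan_def)
    also have "\<dots> = fps_nth ?Psi j"
      unfolding triangular_series_def weighted_series_nth using small
      by (intro sum.cong) auto
    finally show "fps_nth (?Psi - S) j = 0" by simp
  qed
  have BE: "B * E = O'"
    unfolding B_def E_def O'_def prod.distrib[symmetric]
    by (intro prod.cong refl) (simp add: algebra_simps flip: power_add mult_2)
  have OF: "A (2 * n) = O' * F"
  proof -
    have "A (2 * m) = (\<Prod>i<m. (1 - ?X ^ (4 * i + 2)) * (1 - ?X ^ (4 * (i + 1))))" for m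
    proof (induction m)
      case (Suc m)
      have "2 * Suc m = Suc (Suc (2 * m))" "2 * (2 * m) + 2 = 4 * m + 2" "2 * Suc (2 * m) + 2 = 4 * (m + 1)"
        by simp_all
      then show ?case using Suc.IH unfolding A_def by (simp only: prod.lessThan_Suc mult.assoc)
    qed (simp add: A_def)
    then show ?thesis by (simp only: O'_def F_def prod.distrib)
  qed
  have A_tail: "?d dvd A (2 * n) - A n"
  proof -
    have "A (2 * n) = A n * (\<Prod>i\<in>{n..<2 * n}. 1 - ?X ^ (2 * i + 2))"
      unfolding A_def lessThan_atLeast0 by (rule prod.atLeastLessThan_concat[symmetric]) simp_all
    moreover have "?d dvd (\<Prod>i\<in>{n..<2 * n}. 1 - ?X ^ (2 * i + 2)) - 1"
      by (rule X_power_dvd_prod_minus_1) (auto intro: le_imp_power_dvd simp del: power_Suc power_Suc2)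
    moreover have "A n * P - A n = A n * (P - 1)" for P by (simp add: algebra_simps)
    ultimately show ?thesis by simp
  qed
  have "O' * (?Psi - E * F) = E * (B * (?Psi - S) + (B * S - A n) - (A (2 * n) - A n))"
    unfolding BE[symmetric] OF by (simp add: algebra_simps)
  then have "?d dvd O' * (?Psi - E * F)"
    by (simp only:) (intro dvd_mult dvd_add dvd_diff first tail A_tail)
  moreover have "fps_nth O' 0 = 1"
  proof -
    have "fps_X ^ 1 dvd O' - 1"
      unfolding O'_def by (rule X_power_dvd_prod_minus_1) (auto intro: le_imp_power_dvd)
    then show ?thesis unfolding X_power_dvd_iff by simp
  qed
  ultimately have "?d dvd ?Psi - E * F" by (rule X_power_dvd_cancel[rotated])
  then show ?thesis by (simp add: E_def F_def prod.distrib)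
qed

theorem Delta8_eq: "Delta8 = fps_X * triangular_series (\<lambda>k. alt (int (triangular k))) ^ 8"
proof -
  let ?Psi = "triangular_series (\<lambda>k. alt (int (triangular k)))"
  have power_dvd: "d dvd a ^ m - b ^ m" if "d dvd a - b" for d a b :: "int fps" and m
    using that by (metis dvd_trans dvd_triv_left power_diff_sumr2)
  have partial: "fps_X ^ (2 * n) dvd ?Psi ^ 8 - (\<Prod>i<n. delta8_factor i)" for n
    using power_dvd[OF Gauss_triangular_product[of n], of 8]
    by (simp add: delta8_factor_def prod.distrib prod_power_distrib power_mult_distrib)
  have "(\<lambda>n. \<Prod>i\<le>n. delta8_factor i) \<longlonglongrightarrow> ?Psi ^ 8"
  proof (rule tendsto_fpsI)
    fix j
    show "\<forall>\<^sub>F n in sequentially. fps_nth (\<Prod>i\<le>n. delta8_factor i) j = fps_nth (?Psi ^ 8) j"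
      using eventually_ge_at_top[of j]
    proof eventually_elim
      case (elim n)
      have "fps_nth (?Psi ^ 8 - (\<Prod>i<Suc n. delta8_factor i)) j = 0"
        using partial[of "Suc n"] elim unfolding X_power_dvd_iff by (auto simp del: prod.lessThan_Suc)
      then show ?case by (simp add: lessThan_Suc_atMost del: prod.lessThan_Suc)
    qed
  qed
  moreover have "fps_nth ?Psi 0 = 1"
  proof -
    have "fps_X ^ (2 * 1) dvd ?Psi - (\<Prod>i<1. (1 - fps_X ^ (2 * i + 1)) * (1 - fps_X ^ (4 * (i + 1))))"
      by (rule Gauss_triangular_product)
    then have "fps_nth (?Psi - (\<Prod>i<1. (1 - fps_X ^ (2 * i + 1)) * (1 - fps_X ^ (4 * (i + 1))))) 0 = 0"
      unfolding X_power_dvd_iff by simp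
    then show ?thesis by simp
  qed
  then have "?Psi ^ 8 \<noteq> 0" by auto
  ultimately have "raw_has_prod delta8_factor 0 (?Psi ^ 8)" by (simp add: raw_has_prod_def)
  then have "delta8_factor has_prod (?Psi ^ 8)" by (simp add: has_prod_def)
  then have "?Psi ^ 8 = prodinf delta8_factor" by (rule has_prod_unique)
  then show ?thesis by (simp add: Delta8_def)
qed

theorem theta_product_eq_Delta8:
  "theta_alt ^ 4 * theta_odd ^ 4 = 16 * (Delta8 oo fps_X ^ 4)"
proof -
  have "theta_alt ^ 4 * theta_odd ^ 4 = (theta_alt * theta_odd) ^ 4" by (simp add: power_mult_distrib)
  also have "\<dots> = 16 * fps_X ^ 4 * (triangular_series (\<lambda>k. alt (int (triangular k))) oo fps_X ^ 4) ^ 8"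
    unfolding alt_theta_relation by (simp add: power_mult_distrib flip: power_mult)
  finally show ?thesis
    by (simp add: Delta8_eq compose_X_power_mult compose_X_power_power)
qed

lemma theta_even_eq_theta3: "theta_even = theta3 oo fps_X ^ 4"
proof -
  have "theta_even = weighted_series {m. even m} sq (\<lambda>m. of_bool (even m))"
    unfolding theta_even_def weighted_theta_def by (intro weighted_series_restrict finite_fibres_sq) auto
  also have "\<dots> = weighted_series UNIV (\<lambda>m. 4 * sq m) (\<lambda>_. 1)"
  proof (rule weighted_series_reindex[symmetric, where h = "\<lambda>m. 2 * m"])
    show "bij_betw (\<lambda>m. 2 * m) UNIV {m :: int. even m}"
      by (rule bij_betw_byWitness[where f' = "\<lambda>m. m div 2"]) auto
  qed (auto simp: sq_def power_mult_distrib nat_mult_distrib)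
  also have "\<dots> = weighted_series UNIV sq (\<lambda>_. 1) oo fps_X ^ 4" by (rule weighted_series_scaled) simp
  also have "weighted_series UNIV sq (\<lambda>_. 1) = theta3"
  proof (rule fps_ext)
    fix n
    have "{m. sq m = n} = {m. m\<^sup>2 = int n}" by (auto simp: sq_def)
    then show "fps_nth (weighted_series UNIV sq (\<lambda>_. 1)) n = fps_nth theta3 n"
      by (simp add: weighted_series_nth theta3_def)
  qed
  finally show ?thesis .
qed

text \<open>
  This gives the order and the leading coefficient of each term in the theta series of a shadow.
\<close>

lemma theta_odd_leading: "\<exists>G. theta_odd = fps_X * G \<and> fps_nth G 0 = 2"
proof -
  have *: "theta_odd = 2 * fps_X * (triangular_series (\<lambda>_. 1) oo fps_X ^ 8)"
    unfolding theta_odd_def by (rule weighted_theta_odd_eq_triangular_series) auto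
  have "k = 0" if "triangular k = 0" for k using le_triangular[of k] that by simp
  moreover have "triangular 0 = 0" by (simp add: triangular_def)
  ultimately have "{k. triangular k = 0} = {0}" by blast
  then have "fps_nth (2 * (triangular_series (\<lambda>_. 1) oo fps_X ^ 8)) 0 = 2"
    by (simp add: triangular_series_def weighted_series_nth)
  then show ?thesis using * by (intro exI[of _ "2 * (triangular_series (\<lambda>_. 1) oo fps_X ^ 8)"]) (simp add: mult_ac)
qed

section \<open>Integer vectors\<close>

definition dot :: "('n::finite \<Rightarrow> int) \<Rightarrow> ('n \<Rightarrow> int) \<Rightarrow> int" where
  "dot u v = (\<Sum>i\<in>UNIV. u i * v i)"

definition vnorm :: "('n::finite \<Rightarrow> int) \<Rightarrow> nat" where
  "vnorm v = (\<Sum>i\<in>UNIV. sq (v i))"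

lemma int_vnorm: "int (vnorm v) = dot v v"
  by (simp add: vnorm_def dot_def sq_def power2_eq_square)

lemma dot_commute: "dot u v = dot v u"
  by (simp add: dot_def mult.commute)

lemma dot_add_left: "dot (\<lambda>i. u i + v i) w = dot u w + dot v w"
  by (simp add: dot_def distrib_right sum.distrib)

lemma dot_diff_left: "dot (\<lambda>i. u i - v i) w = dot u w - dot v w"
  by (simp add: dot_def left_diff_distrib sum_subtractf)

lemma dot_scale_left: "dot (\<lambda>i. c * u i) w = c * dot u w"
  by (simp add: dot_def sum_distrib_left mult.assoc)

lemma dot_sum_left: "dot (\<lambda>i. \<Sum>j\<in>J. u j i) w = (\<Sum>j\<in>J. dot (u j) w)"
  by (simp add: dot_def sum_distrib_right) (rule sum.swap)

lemma dot_indicator: "dot (\<lambda>i. if i = k then c else 0) w = c * w k"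
proof -
  have "dot (\<lambda>i. if i = k then c else 0) w = (\<Sum>i\<in>UNIV. if i = k then c * w k else 0)"
    unfolding dot_def by (intro sum.cong) auto
  then show ?thesis by simp
qed

text \<open>
  The reduction modulo 2 of an integral vector, as a set of coordinates.
\<close>

definition osupp :: "('n \<Rightarrow> int) \<Rightarrow> 'n set" where
  "osupp u = {i. odd (u i)}"

lemma even_dot_iff: "even (dot t v) \<longleftrightarrow> even (\<Sum>i\<in>osupp v. t i)"
proof -
  have "dot t v - (\<Sum>i\<in>osupp v. t i) = (\<Sum>i\<in>UNIV. t i * v i - (if i \<in> osupp v then t i else 0))"
    by (simp add: dot_def sum_subtractf sum.If_cases)
  also have "even \<dots>" by (rule dvd_sum) (auto simp: osupp_def)
  finally show ?thesis by presburger
qed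

lemma finite_fibres_bij:
  assumes "bij_betw h S T" "\<And>a. a \<in> S \<Longrightarrow> M (h a) = N a" "finite_fibres S N"
  shows "finite_fibres T M"
  unfolding finite_fibres_def
proof
  fix n
  have "{b \<in> T. M b = n} = h ` {a \<in> S. N a = n}"
    using assms(1,2) by (auto simp: bij_betw_def)
  then show "finite {b \<in> T. M b = n}" using assms(3) by (simp add: finite_fibresD)
qed

text \<open>
  Theta series of \<open>\<int>^n\<close> with product weights factor; the index set is kept general for the induction.
\<close>

lemma weighted_series_PiE_prod:
  fixes w :: "'i \<Rightarrow> int \<Rightarrow> int"
  assumes "finite I"
  shows "finite_fibres (I \<rightarrow>\<^sub>E UNIV) (\<lambda>v. \<Sum>i\<in>I. sq (v i))
    \<and> weighted_series (I \<rightarrow>\<^sub>E UNIV) (\<lambda>v. \<Sum>i\<in>I. sq (v i)) (\<lambda>v. \<Prod>i\<in>I. w i (v i)) = (\<Prod>i\<in>I. weighted_theta (w i))"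
  using assms
proof induction
  case empty
  then show ?case by (auto simp: finite_fibres_def weighted_series_def fps_eq_iff)
next
  case (insert i I)
  let ?h = "\<lambda>(m, v). v(i := m)"
  let ?S = "UNIV \<times> (I \<rightarrow>\<^sub>E UNIV)" and ?N = "\<lambda>(m, v). sq m + (\<Sum>i\<in>I. sq (v i))"
  have bij: "bij_betw ?h ?S (insert i I \<rightarrow>\<^sub>E UNIV)"
    by (rule bij_betw_byWitness[where f' = "\<lambda>v. (v i, v(i := undefined))"])
       (use insert.hyps in \<open>auto simp: PiE_def extensional_def fun_eq_iff\<close>)
  have norm: "(\<Sum>j\<in>insert i I. sq (?h p j)) = ?N p" for p
    using insert.hyps by (cases p) (auto intro!: sum.cong)
  have weight: "(\<Prod>j\<in>insert i I. w j (?h p j)) = (case p of (m, v) \<Rightarrow> w i m * (\<Prod>i\<in>I. w i (v i)))" for p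
    using insert.hyps by (cases p) (auto intro!: prod.cong)
  have fin: "finite_fibres ?S ?N"
    using insert.IH by (intro finite_fibres_prod finite_fibres_sq) blast
  have "weighted_series (insert i I \<rightarrow>\<^sub>E UNIV) (\<lambda>v. \<Sum>i\<in>insert i I. sq (v i)) (\<lambda>v. \<Prod>i\<in>insert i I. w i (v i))
      = weighted_series ?S ?N (\<lambda>(m, v). w i m * (\<Prod>i\<in>I. w i (v i)))"
    by (rule weighted_series_reindex[OF bij, symmetric]) (rule norm, rule weight)
  also have "\<dots> = weighted_theta (w i) * (\<Prod>i\<in>I. weighted_theta (w i))"
    using insert.IH unfolding weighted_theta_def by (subst weighted_series_mult[symmetric]) (simp_all add: finite_fibres_sq)
  finally show ?case
    using finite_fibres_bij[OF bij _ fin, of "\<lambda>v. \<Sum>i\<in>insert i I. sq (v i)"] norm insert.hyps by simp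
qed

lemma finite_fibres_vnorm: "finite_fibres (UNIV :: ('n::finite \<Rightarrow> int) set) vnorm"
  using weighted_series_PiE_prod[of "UNIV :: 'n set"] unfolding vnorm_def[abs_def] by simp

lemma weighted_series_vnorm_prod:
  "weighted_series (UNIV :: ('n::finite \<Rightarrow> int) set) vnorm (\<lambda>v. \<Prod>i\<in>UNIV. w i (v i)) = (\<Prod>i\<in>UNIV. weighted_theta (w i))"
  using weighted_series_PiE_prod[of "UNIV :: 'n set" w] unfolding vnorm_def[abs_def] by simp

section \<open>Symmetric binary forms\<close>

text \<open>
  The symmetric forms of degree \<open>n\<close>, written as polynomials in the elementary symmetric functions.
  The coefficients do not depend on the arguments: below the same form is evaluated at two
  different pairs of power series.
\<close>

definition symmetric_form :: "nat \<Rightarrow> (int fps \<Rightarrow> int fps \<Rightarrow> int fps) \<Rightarrow> bool" where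
  "symmetric_form n F \<longleftrightarrow> (\<exists>c :: nat \<Rightarrow> int. \<forall>Y Z.
     F Y Z = (\<Sum>j\<le>n div 2. fps_const (c j) * (Y + Z) ^ (n - 2 * j) * (Y * Z) ^ j))"

lemma symmetric_form_add:
  "symmetric_form n F \<Longrightarrow> symmetric_form n G \<Longrightarrow> symmetric_form n (\<lambda>Y Z. F Y Z + G Y Z)"
  unfolding symmetric_form_def
proof (elim exE)
  fix c d assume "\<forall>Y Z. F Y Z = (\<Sum>j\<le>n div 2. fps_const (c j) * (Y + Z) ^ (n - 2 * j) * (Y * Z) ^ j)"
    "\<forall>Y Z. G Y Z = (\<Sum>j\<le>n div 2. fps_const (d j) * (Y + Z) ^ (n - 2 * j) * (Y * Z) ^ j)"
  then show "\<exists>c. \<forall>Y Z. F Y Z + G Y Z = (\<Sum>j\<le>n div 2. fps_const (c j) * (Y + Z) ^ (n - 2 * j) * (Y * Z) ^ j)"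
    by (intro exI[of _ "\<lambda>j. c j + d j"]) (simp add: sum.distrib distrib_right flip: fps_const_add)
qed

lemma symmetric_form_cmult:
  "symmetric_form n F \<Longrightarrow> symmetric_form n (\<lambda>Y Z. fps_const a * F Y Z)"
  unfolding symmetric_form_def
proof (elim exE)
  fix c assume "\<forall>Y Z. F Y Z = (\<Sum>j\<le>n div 2. fps_const (c j) * (Y + Z) ^ (n - 2 * j) * (Y * Z) ^ j)"
  then show "\<exists>c. \<forall>Y Z. fps_const a * F Y Z = (\<Sum>j\<le>n div 2. fps_const (c j) * (Y + Z) ^ (n - 2 * j) * (Y * Z) ^ j)"
    by (intro exI[of _ "\<lambda>j. a * c j"]) (simp add: sum_distrib_left mult.assoc flip: fps_const_mult)
qed

lemma symmetric_form_0: "symmetric_form n (\<lambda>Y Z. 0)"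
  unfolding symmetric_form_def by (intro exI[of _ "\<lambda>_. 0"]) simp

lemma symmetric_form_sum:
  "(\<And>i. i \<in> I \<Longrightarrow> symmetric_form n (F i)) \<Longrightarrow> symmetric_form n (\<lambda>Y Z. \<Sum>i\<in>I. F i Y Z)"
  by (induction I rule: infinite_finite_induct) (simp_all add: symmetric_form_0 symmetric_form_add)

lemma symmetric_form_mult_sum:
  assumes "symmetric_form n F"
  shows "symmetric_form (Suc n) (\<lambda>Y Z. (Y + Z) * F Y Z)"
proof -
  obtain c where c: "F Y Z = (\<Sum>j\<le>n div 2. fps_const (c j) * (Y + Z) ^ (n - 2 * j) * (Y * Z) ^ j)" for Y Z
    using assms unfolding symmetric_form_def by blast
  have "(Y + Z) * F Y Z = (\<Sum>j\<le>Suc n div 2. fps_const (if j \<le> n div 2 then c j else 0)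
      * (Y + Z) ^ (Suc n - 2 * j) * (Y * Z) ^ j)" for Y Z
  proof -
    have "(Y + Z) * F Y Z = (\<Sum>j\<le>n div 2. fps_const (c j) * (Y + Z) ^ (Suc n - 2 * j) * (Y * Z) ^ j)"
      unfolding c sum_distrib_left
    proof (intro sum.cong refl)
      fix j assume "j \<in> {..n div 2}"
      then have "Suc n - 2 * j = Suc (n - 2 * j)" by auto
      then show "(Y + Z) * (fps_const (c j) * (Y + Z) ^ (n - 2 * j) * (Y * Z) ^ j)
          = fps_const (c j) * (Y + Z) ^ (Suc n - 2 * j) * (Y * Z) ^ j" by (simp add: mult_ac)
    qed
    also have "\<dots> = (\<Sum>j\<le>Suc n div 2. fps_const (if j \<le> n div 2 then c j else 0)
      * (Y + Z) ^ (Suc n - 2 * j) * (Y * Z) ^ j)"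
      by (rule sum.mono_neutral_cong_left) auto
    finally show ?thesis .
  qed
  then show ?thesis unfolding symmetric_form_def
    by (intro exI[of _ "\<lambda>j. if j \<le> n div 2 then c j else 0"] allI)
qed

lemma symmetric_form_mult_power:
  "symmetric_form n F \<Longrightarrow> symmetric_form (k + n) (\<lambda>Y Z. (Y + Z) ^ k * F Y Z)"
proof (induction k)
  case (Suc k)
  then show ?case using symmetric_form_mult_sum[of "k + n" "\<lambda>Y Z. (Y + Z) ^ k * F Y Z"]
    by (simp add: mult.assoc)
qed simp

lemma symmetric_form_mult_prod:
  assumes "symmetric_form n F"
  shows "symmetric_form (Suc (Suc n)) (\<lambda>Y Z. Y * Z * F Y Z)"
proof -
  obtain c where c: "F Y Z = (\<Sum>j\<le>n div 2. fps_const (c j) * (Y + Z) ^ (n - 2 * j) * (Y * Z) ^ j)" for Y Z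
    using assms unfolding symmetric_form_def by blast
  have "Y * Z * F Y Z = (\<Sum>j\<le>Suc (Suc n) div 2. fps_const (case j of 0 \<Rightarrow> 0 | Suc j \<Rightarrow> c j)
      * (Y + Z) ^ (Suc (Suc n) - 2 * j) * (Y * Z) ^ j)" for Y Z
  proof -
    have "Suc (Suc n) div 2 = Suc (n div 2)" by simp
    then show ?thesis
      by (simp only: sum.atMost_Suc_shift c) (simp add: sum_distrib_left mult_ac)
  qed
  then show ?thesis unfolding symmetric_form_def by blast
qed

text \<open>
  Newton's recursion \<open>p\<^sub>n = e\<^sub>1 p\<^sub>n\<^sub>-\<^sub>1 - e\<^sub>2 p\<^sub>n\<^sub>-\<^sub>2\<close>.
\<close>

lemma symmetric_form_power_sum: "symmetric_form n (\<lambda>Y Z. Y ^ n + Z ^ n)"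
proof (induction n rule: less_induct)
  case (less n)
  consider "n = 0" | "n = 1" | m where "n = Suc (Suc m)" by (metis One_nat_def not0_implies_Suc)
  then show ?case
  proof cases
    case 1
    then show ?thesis unfolding symmetric_form_def by (intro exI[of _ "\<lambda>_. 2"]) (simp add: numeral_fps_const)
  next
    case 2
    then show ?thesis unfolding symmetric_form_def by (intro exI[of _ "\<lambda>_. 1"]) simp
  next
    case 3
    have "symmetric_form n (\<lambda>Y Z. (Y + Z) * (Y ^ Suc m + Z ^ Suc m) + fps_const (- 1) * (Y * Z * (Y ^ m + Z ^ m)))"
      unfolding 3 by (intro symmetric_form_add symmetric_form_cmult symmetric_form_mult_sum
          symmetric_form_mult_prod less.IH) (simp_all add: 3)
    moreover have "(\<lambda>Y Z. (Y + Z) * (Y ^ Suc m + Z ^ Suc m) + fps_const (- 1) * (Y * Z * (Y ^ m + Z ^ m)))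
        = (\<lambda>Y Z :: int fps. Y ^ n + Z ^ n)"
      unfolding 3 by (intro ext) (simp add: algebra_simps flip: fps_const_neg)
    ultimately show ?thesis by simp
  qed
qed

lemma symmetric_form_monomials: "symmetric_form (a + b) (\<lambda>Y Z. Y ^ a * Z ^ b + Y ^ b * Z ^ a)"
proof (induction a arbitrary: b)
  case 0
  then show ?case using symmetric_form_power_sum[of b] by (simp add: add.commute)
next
  case (Suc a)
  show ?case
  proof (cases b)
    case 0
    then show ?thesis using symmetric_form_power_sum[of "Suc a"] by simp
  next
    case (Suc c)
    have "(\<lambda>Y Z :: int fps. Y ^ Suc a * Z ^ b + Y ^ b * Z ^ Suc a) = (\<lambda>Y Z. Y * Z * (Y ^ a * Z ^ c + Y ^ c * Z ^ a))"
      unfolding Suc by (intro ext) (simp add: distrib_left mult_ac)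
    moreover have "Suc a + b = Suc (Suc (a + c))" using Suc by simp
    ultimately show ?thesis using symmetric_form_mult_prod[OF Suc.IH[of c]] by (simp only:)
  qed
qed

section \<open>Theta series of self-dual codes\<close>

lemma alt_sum_sym_diff:
  fixes t :: "'n::finite \<Rightarrow> int"
  shows "alt (\<Sum>i\<in>sym_diff a b. t i) = alt (\<Sum>i\<in>a. t i) * alt (\<Sum>i\<in>b. t i)"
proof -
  have "(\<Sum>i\<in>a. t i) = (\<Sum>i\<in>a \<inter> b. t i) + (\<Sum>i\<in>a - b. t i)"
    by (rule sum.Int_Diff) simp
  moreover have "(\<Sum>i\<in>b. t i) = (\<Sum>i\<in>a \<inter> b. t i) + (\<Sum>i\<in>b - a. t i)"
    by (subst Int_commute, rule sum.Int_Diff) simp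
  moreover have "(\<Sum>i\<in>sym_diff a b. t i) = (\<Sum>i\<in>a - b. t i) + (\<Sum>i\<in>b - a. t i)"
    by (rule sum.union_disjoint) auto
  ultimately show ?thesis by (simp add: alt_def)
qed

lemma alt_eq_1_iff: "alt k = 1 \<longleftrightarrow> even k"
  by (simp add: alt_def)

lemma alt_sum: "finite A \<Longrightarrow> alt (\<Sum>i\<in>A. t i) = (\<Prod>i\<in>A. alt (t i))"
  by (induction A rule: finite_induct) (simp_all add: alt_add, simp add: alt_def)

lemma alt_diff: "alt (a - b) = alt a * alt b"
  by (simp add: alt_def)

lemma card_Compl_Un:
  fixes a b :: "'n::finite set"
  assumes "a \<inter> b = {}"
  shows "card (- (a \<union> b)) = CARD('n) - card a - card b"
proof -
  have "card (- (a \<union> b)) = CARD('n) - card (a \<union> b)"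
    unfolding Compl_eq_Diff_UNIV by (rule card_Diff_subset) simp_all
  then show ?thesis using assms by (simp add: card_Un_disjoint)
qed

lemma card_add_le:
  fixes a b :: "'n::finite set"
  shows "a \<inter> b = {} \<Longrightarrow> card a + card b \<le> CARD('n)"
  by (simp add: card_mono flip: card_Un_disjoint)

lemma weighted_theta_antisymmetric:
  assumes "\<And>m. w (- m) = - w m"
  shows "weighted_theta w = 0"
proof -
  have "weighted_theta w = weighted_theta (\<lambda>m. - w m)"
    unfolding weighted_theta_def
    by (rule weighted_series_reindex[where h = uminus]) (use assms in \<open>auto simp: sq_def bij_uminus\<close>)
  also have "\<dots> = - weighted_theta w"
    by (rule fps_ext) (simp add: weighted_theta_def weighted_series_nth sum_negf)
  finally show ?thesis by simp
qed

text \<open>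
  \<open>U\<close> is the preimage in \<open>\<int>^n\<close> of a self-dual code over the integers modulo 4.  In the lattice
  \<open>L = U / 2\<close> the norm of \<open>u / 2\<close> is \<open>(u, u) / 4\<close>, so the second assumption says that \<open>2 s\<close> is a
  characteristic vector of \<open>L\<close>; the shadow is then \<open>s + L\<close>, represented by \<open>coset s\<close>.  The third
  assumption amounts to every vector of even coordinates in \<open>U\<close> being twice a vector of even norm.
\<close>

locale selfdual_code =
  fixes U :: "('n::finite \<Rightarrow> int) set" and s :: "'n \<Rightarrow> int"
  assumes selfdual: "u \<in> U \<longleftrightarrow> (\<forall>v\<in>U. 4 dvd dot u v)"
    and characteristic: "u \<in> U \<Longrightarrow> 8 dvd dot u u - 4 * dot s u"
    and ex_all_odd: "\<exists>u\<in>U. osupp u = UNIV"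
begin

lemma dot_dvd: "u \<in> U \<Longrightarrow> v \<in> U \<Longrightarrow> 4 dvd dot u v"
  using selfdual by blast

lemma add_mem: "u \<in> U \<Longrightarrow> v \<in> U \<Longrightarrow> (\<lambda>i. u i + v i) \<in> U"
  by (subst selfdual) (simp add: dot_add_left dot_dvd)

lemma diff_mem: "u \<in> U \<Longrightarrow> v \<in> U \<Longrightarrow> (\<lambda>i. u i - v i) \<in> U"
  by (subst selfdual) (simp add: dot_diff_left dot_dvd)

lemma diff_mem_iff: "v \<in> U \<Longrightarrow> (\<lambda>i. u i - v i) \<in> U \<longleftrightarrow> u \<in> U"
  using add_mem[of "\<lambda>i. u i - v i" v] diff_mem[of u v] by auto

lemma multiple_mem: "(\<lambda>i. 4 * t i) \<in> U"
  by (subst selfdual) (simp add: dot_scale_left)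

lemma zero_mem: "(\<lambda>i. 0) \<in> U"
  using multiple_mem[of "\<lambda>i. 0"] by simp

definition residues :: "'n set set" where
  "residues = osupp ` U"

text \<open>
  Any lift of a residue word will do: \<open>lift_sign\<close> below depends, on disjoint residue words, on the
  words alone.
\<close>

definition lift :: "'n set \<Rightarrow> 'n \<Rightarrow> int" where
  "lift r = (SOME u. u \<in> U \<and> osupp u = r)"

definition lift_sign :: "'n set \<Rightarrow> 'n set \<Rightarrow> int" where
  "lift_sign r a = alt (\<Sum>i\<in>a. lift r i div 2)"

text \<open>
  With \<open>Y = \<theta>\<^sub>4^4\<close> and \<open>Z = \<theta>\<^sub>2^4\<close> this is \<open>|R|\<close> times the theta series of the code.  The
  divisions by 4 are exact because the residue code is doubly even.
\<close>

definition weight_form :: "int fps \<Rightarrow> int fps \<Rightarrow> int fps" where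
  "weight_form Y Z = (\<Sum>r\<in>residues. \<Sum>a\<in>residues. if r \<inter> a = {} then fps_const (lift_sign r a)
      * (Y + Z) ^ (CARD('n) div 4 - card r div 4 - card a div 4) * Y ^ (card a div 4) * Z ^ (card r div 4) else 0)"

definition coset :: "('n \<Rightarrow> int) \<Rightarrow> ('n \<Rightarrow> int) set" where
  "coset c = {v. (\<lambda>i. v i - 2 * c i) \<in> U}"

lemma lift: "r \<in> residues \<Longrightarrow> lift r \<in> U" "r \<in> residues \<Longrightarrow> osupp (lift r) = r"
proof -
  have "lift r \<in> U \<and> osupp (lift r) = r" if "r \<in> residues"
  proof -
    have "\<exists>u. u \<in> U \<and> osupp u = r" using that unfolding residues_def by blast
    then show ?thesis unfolding lift_def by (rule someI_ex)
  qed
  then show "r \<in> residues \<Longrightarrow> lift r \<in> U" "r \<in> residues \<Longrightarrow> osupp (lift r) = r" by blast+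
qed

lemma odd_lift_iff: "r \<in> residues \<Longrightarrow> odd (lift r i) \<longleftrightarrow> i \<in> r"
  using lift(2)[of r] by (auto simp: osupp_def)

lemma residue_sym_diff:
  assumes "r \<in> residues" "a \<in> residues"
  shows "sym_diff r a \<in> residues"
proof -
  obtain u v where uv: "u \<in> U" "v \<in> U" "r = osupp u" "a = osupp v"
    using assms unfolding residues_def by blast
  then have "sym_diff r a = osupp (\<lambda>i. u i + v i)" by (auto simp: osupp_def)
  then show ?thesis unfolding residues_def using add_mem[OF uv(1,2)] by (rule image_eqI)
qed

lemma residue_UNIV: "UNIV \<in> residues"
  using ex_all_odd by (auto simp: residues_def)

lemma residue_empty: "{} \<in> residues"
  using residue_sym_diff[OF residue_UNIV residue_UNIV] by simp

lemma residue_Compl: "r \<in> residues \<Longrightarrow> - r \<in> residues"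
  using residue_sym_diff[OF residue_UNIV, of r] by (simp add: Compl_eq_Diff_UNIV)

lemma residue_card_pos: "0 < card residues"
  using residue_empty by (auto simp: card_gt_0_iff)

text \<open>
  Orthogonality of characters on the elementary abelian 2-group of residue words: translating by a word
  on which the character is \<open>-1\<close> negates the sum.
\<close>

lemma residue_character_sum:
  assumes "\<And>a b. character (sym_diff a b) = character a * character b" "\<And>a. character a = 1 \<or> character a = - 1"
  shows "(\<Sum>r\<in>residues. character r) = (if \<forall>r\<in>residues. character r = 1 then int (card residues) else 0)"
proof (cases "\<forall>r\<in>residues. character r = 1")
  case False
  then obtain r0 where r0: "r0 \<in> residues" "character r0 = - 1" using assms(2) by blast
  have "bij_betw (sym_diff r0) residues residues"
    by (rule bij_betw_byWitness[where f' = "sym_diff r0"]) (use r0 residue_sym_diff in auto)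
  then have "(\<Sum>r\<in>residues. character r) = (\<Sum>r\<in>residues. character (sym_diff r0 r))"
    by (rule sum.reindex_bij_betw[symmetric])
  also have "\<dots> = - (\<Sum>r\<in>residues. character r)" by (simp add: assms(1) r0 sum_negf)
  finally have "(\<Sum>r\<in>residues. character r) = 0" by simp
  then show ?thesis unfolding if_not_P[OF False] .
qed simp

text \<open>
  Subtracting the lift leaves a vector \<open>2 t\<close>, and \<open>(2 t, v)\<close> is divisible by 4 iff \<open>t\<close> has even
  sum over the odd coordinates of \<open>v\<close>.
\<close>

lemma mem_iff_residue_characters:
  "u \<in> U \<longleftrightarrow> osupp u \<in> residues \<and> (\<forall>a\<in>residues. even (\<Sum>i\<in>a. (u i - lift (osupp u) i) div 2))"
proof (cases "osupp u \<in> residues")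
  case True
  define t where "t = (\<lambda>i. (u i - lift (osupp u) i) div 2)"
  have "even (u i - lift (osupp u) i)" for i
    using odd_lift_iff[OF True] by (auto simp: osupp_def)
  then have "(\<lambda>i. u i - lift (osupp u) i) = (\<lambda>i. 2 * t i)" by (simp add: t_def)
  then have "u \<in> U \<longleftrightarrow> (\<lambda>i. 2 * t i) \<in> U" using diff_mem_iff[OF lift(1)[OF True], of u] by simp
  also have "\<dots> \<longleftrightarrow> (\<forall>v\<in>U. 2 * 2 dvd 2 * dot t v)"
    by (subst selfdual) (simp add: dot_scale_left)
  also have "\<dots> \<longleftrightarrow> (\<forall>v\<in>U. even (dot t v))"
    by (simp only: dvd_mult_cancel_left) simp
  also have "\<dots> \<longleftrightarrow> (\<forall>a\<in>residues. even (\<Sum>i\<in>a. t i))"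
    by (simp add: even_dot_iff residues_def)
  finally show ?thesis using True by (simp add: t_def)
qed (auto simp: residues_def)

lemma coset_indicator:
  "int (card residues) * of_bool (v \<in> coset c)
    = (\<Sum>r\<in>residues. \<Sum>a\<in>residues. of_bool (osupp v = r) * alt (\<Sum>i\<in>a. (v i - lift r i) div 2 - c i))"
proof -
  have os: "osupp (\<lambda>i. v i - 2 * c i) = osupp v" by (simp add: osupp_def)
  have div: "(v i - 2 * c i - x) div 2 = (v i - x) div 2 - c i" for i x
  proof -
    have "v i - 2 * c i - x = (v i - x) + 2 * (- c i)" by simp
    then show ?thesis by (simp only: div_mult_self2[of 2])
  qed
  have sums: "(\<Sum>a\<in>residues. alt (\<Sum>i\<in>a. t i)) = (if \<forall>a\<in>residues. even (\<Sum>i\<in>a. t i) then int (card residues) else 0)" for t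
  proof -
    have "alt k = 1 \<or> alt k = - 1" for k by (simp add: alt_def)
    then have "(\<Sum>a\<in>residues. alt (\<Sum>i\<in>a. t i))
        = (if \<forall>a\<in>residues. alt (\<Sum>i\<in>a. t i) = 1 then int (card residues) else 0)"
      by (intro residue_character_sum alt_sum_sym_diff)
    then show ?thesis by (simp only: alt_eq_1_iff)
  qed
  have "(\<Sum>r\<in>residues. \<Sum>a\<in>residues. of_bool (osupp v = r) * alt (\<Sum>i\<in>a. (v i - lift r i) div 2 - c i))
      = (\<Sum>r\<in>residues. if r = osupp v then (\<Sum>a\<in>residues. alt (\<Sum>i\<in>a. (v i - lift r i) div 2 - c i)) else 0)"
    by (intro sum.cong) auto
  also have "\<dots> = (if osupp v \<in> residues then (\<Sum>a\<in>residues. alt (\<Sum>i\<in>a. (v i - lift (osupp v) i) div 2 - c i)) else 0)"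
    by simp
  finally show ?thesis unfolding sums
    by (auto simp: coset_def mem_iff_residue_characters[of "\<lambda>i. v i - 2 * c i"] os div)
qed

text \<open>
  The four cases of a coordinate.  A coordinate in both words contributes 0, since its signed series is
  antisymmetric under \<open>m \<mapsto> -m\<close>; therefore only disjoint pairs of words survive.
\<close>

lemma theta_factor:
  assumes "r \<in> residues"
  shows "weighted_theta (\<lambda>m. of_bool (odd m \<longleftrightarrow> i \<in> r) * (if i \<in> a then alt ((m - lift r i) div 2 - c i) else 1))
    = (if i \<in> r then if i \<in> a then 0 else theta_odd
       else if i \<in> a then fps_const (alt (lift r i div 2) * alt (c i)) * theta_alt else theta_even)"
proof -
  note odd = odd_lift_iff[OF assms, of i]
  have A: "weighted_theta (\<lambda>m. of_bool (odd m \<longleftrightarrow> True) * alt ((m - lift r i) div 2 - c i)) = 0" if ir: "i \<in> r"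
  proof (rule weighted_theta_antisymmetric)
    fix m
    show "of_bool (odd (- m) \<longleftrightarrow> True) * alt ((- m - lift r i) div 2 - c i)
        = - (of_bool (odd m \<longleftrightarrow> True) * alt ((m - lift r i) div 2 - c i))"
    proof (cases "odd m")
      case True
      obtain p q where "m = 2 * p + 1" "lift r i = 2 * q + 1" using True odd ir by (meson oddE)
      then have "(- m - lift r i) div 2 = - p - q - 1" "(m - lift r i) div 2 = p - q" by simp_all
      then show ?thesis using True by (auto simp: alt_def)
    qed simp
  qed
  have B: "weighted_theta (\<lambda>m. of_bool (odd m \<longleftrightarrow> False) * alt ((m - lift r i) div 2 - c i))
      = fps_const (alt (lift r i div 2) * alt (c i)) * theta_alt" if ir: "i \<notin> r"
  proof -
    have "of_bool (odd m \<longleftrightarrow> False) * alt ((m - lift r i) div 2 - c i)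
        = alt (lift r i div 2) * alt (c i) * (of_bool (even m) * alt (m div 2))" for m
    proof (cases "even m")
      case True
      obtain p q where "m = 2 * p" "lift r i = 2 * q" using True odd ir by (meson evenE)
      moreover have "(2 * p - 2 * q) div 2 = p - q" by simp
      ultimately show ?thesis by (simp add: alt_diff)
    qed simp
    then show ?thesis unfolding theta_alt_def weighted_theta_def weighted_series_cmult[symmetric] by (simp only:)
  qed
  show ?thesis using A B by (auto simp: theta_odd_def theta_even_def)
qed

lemma theta_product:
  assumes "r \<in> residues"
  shows "weighted_series UNIV vnorm (\<lambda>v. of_bool (osupp v = r) * alt (\<Sum>i\<in>a. (v i - lift r i) div 2 - c i))
    = (if r \<inter> a = {} then fps_const (lift_sign r a * alt (\<Sum>i\<in>a. c i))
        * theta_even ^ (CARD('n) - card r - card a) * theta_alt ^ card a * theta_odd ^ card r else 0)"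
proof -
  have "of_bool (osupp v = r) * alt (\<Sum>i\<in>a. (v i - lift r i) div 2 - c i)
      = (\<Prod>i\<in>UNIV. of_bool (odd (v i) \<longleftrightarrow> i \<in> r) * (if i \<in> a then alt ((v i - lift r i) div 2 - c i) else 1))" for v
  proof -
    have "of_bool (osupp v = r) = (\<Prod>i\<in>UNIV. of_bool (odd (v i) \<longleftrightarrow> i \<in> r) :: int)"
    proof (cases "osupp v = r")
      case False
      then obtain i where "\<not> (odd (v i) \<longleftrightarrow> i \<in> r)" by (auto simp: osupp_def)
      then have "(\<Prod>i\<in>UNIV. of_bool (odd (v i) \<longleftrightarrow> i \<in> r) :: int) = 0"
        by (intro prod_zero) auto
      then show ?thesis using False by simp
    qed (auto simp: osupp_def)
    moreover have "alt (\<Sum>i\<in>a. (v i - lift r i) div 2 - c i)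
        = (\<Prod>i\<in>UNIV. if i \<in> a then alt ((v i - lift r i) div 2 - c i) else 1)"
      by (simp add: alt_sum prod.If_cases)
    ultimately show ?thesis by (simp only: prod.distrib)
  qed
  then have *: "weighted_series UNIV vnorm (\<lambda>v. of_bool (osupp v = r) * alt (\<Sum>i\<in>a. (v i - lift r i) div 2 - c i))
      = (\<Prod>i\<in>UNIV. if i \<in> r then if i \<in> a then 0 else theta_odd
          else if i \<in> a then fps_const (alt (lift r i div 2) * alt (c i)) * theta_alt else theta_even)"
    unfolding theta_factor[OF assms, symmetric]
    by (simp only:) (rule weighted_series_vnorm_prod[where w = "\<lambda>i m. of_bool (odd m \<longleftrightarrow> i \<in> r)
      * (if i \<in> a then alt ((m - lift r i) div 2 - c i) else 1)"])
  show ?thesis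
  proof (cases "r \<inter> a = {}")
    case True
    have "(\<Prod>i\<in>UNIV. if i \<in> r then if i \<in> a then 0 else theta_odd
          else if i \<in> a then fps_const (alt (lift r i div 2) * alt (c i)) * theta_alt else theta_even)
        = (\<Prod>i\<in>UNIV. (if i \<in> r then theta_odd else 1)
          * ((if i \<in> a then fps_const (alt (lift r i div 2) * alt (c i)) * theta_alt else 1)
          * (if i \<in> - (r \<union> a) then theta_even else 1)))"
      using True by (intro prod.cong) auto
    also have "\<dots> = theta_odd ^ card r * ((\<Prod>i\<in>a. fps_const (alt (lift r i div 2) * alt (c i)) * theta_alt)
          * theta_even ^ card (- (r \<union> a)))"
    proof -
      have "(\<Prod>i\<in>UNIV. if i \<in> B then f i else 1) = prod f B" for B :: "'n set" and f :: "'n \<Rightarrow> int fps"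
        by (simp add: prod.If_cases)
      then show ?thesis by (simp only: prod.distrib prod_constant)
    qed
    also have "(\<Prod>i\<in>a. fps_const (alt (lift r i div 2) * alt (c i)) * theta_alt)
        = fps_const (lift_sign r a * alt (\<Sum>i\<in>a. c i)) * theta_alt ^ card a"
    proof -
      have "(\<Prod>i\<in>a. fps_const (w i)) = fps_const (\<Prod>i\<in>a. w i)" for w :: "'n \<Rightarrow> int"
        by (induction a rule: infinite_finite_induct) simp_all
      then show ?thesis by (simp add: prod.distrib lift_sign_def alt_sum)
    qed
    also have "card (- (r \<union> a)) = CARD('n) - card r - card a"
      by (rule card_Compl_Un[OF True])
    finally show ?thesis unfolding * using True by (simp add: mult_ac)
  next
    case False
    then obtain i where "i \<in> r" "i \<in> a" by auto
    then have "(\<Prod>i\<in>UNIV. if i \<in> r then if i \<in> a then 0 else theta_odd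
          else if i \<in> a then fps_const (alt (lift r i div 2) * alt (c i)) * theta_alt else theta_even) = 0"
      by (intro prod_zero) auto
    then show ?thesis unfolding * using False by simp
  qed
qed

text \<open>
  Both facts come from the norm of the lift: an odd square is 1 modulo 8, and \<open>(2 d)^2\<close> is
  \<open>4 d\<close> modulo 8.
\<close>

lemma four_dvd_card: "r \<in> residues \<Longrightarrow> 4 dvd card r"
  and lift_sign_Compl: "r \<in> residues \<Longrightarrow> lift_sign r (- r) = alt ((\<Sum>i\<in>r. s i) + int (card r div 4))"
proof -
  assume r: "r \<in> residues"
  let ?g = "lift r"
  have odd: "8 dvd (?g i)\<^sup>2 - 1" if "i \<in> r" for i
    using odd_lift_iff[OF r, of i] that by (intro odd_square_mod_8) blast
  have even: "8 dvd (?g i)\<^sup>2 - 4 * (?g i div 2)" if ir: "i \<notin> r" for i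
  proof -
    obtain d where d: "?g i = 2 * d" using odd_lift_iff[OF r, of i] ir by (meson evenE)
    obtain e where "d * (d - 1) = 2 * e" by (rule evenE[of "d * (d - 1)"]) simp_all
    moreover have "(?g i)\<^sup>2 - 4 * (?g i div 2) = 4 * (d * (d - 1))" unfolding d by (simp add: power2_eq_square algebra_simps)
    ultimately show ?thesis by simp
  qed
  have "dot ?g ?g = (\<Sum>i\<in>r. (?g i)\<^sup>2) + (\<Sum>i\<in>- r. (?g i)\<^sup>2)"
    unfolding dot_def power2_eq_square by (subst sum.union_disjoint[symmetric]) auto
  then have "dot ?g ?g - (int (card r) + 4 * (\<Sum>i\<in>- r. ?g i div 2))
      = (\<Sum>i\<in>r. (?g i)\<^sup>2 - 1) + (\<Sum>i\<in>- r. (?g i)\<^sup>2 - 4 * (?g i div 2))"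
    by (simp add: sum_subtractf sum_distrib_left)
  also have "8 dvd \<dots>" using odd even by (intro dvd_add dvd_sum) auto
  finally have norm: "8 dvd dot ?g ?g - (int (card r) + 4 * (\<Sum>i\<in>- r. ?g i div 2))" .
  have "4 dvd dot ?g ?g" by (rule dot_dvd) (rule lift(1)[OF r])+
  moreover have "4 dvd dot ?g ?g - (int (card r) + 4 * (\<Sum>i\<in>- r. ?g i div 2))"
    using norm by (rule dvd_trans[rotated]) simp
  ultimately have "int 4 dvd int (card r)" by presburger
  then show four: "4 dvd card r" by (simp only: int_dvd_int_iff)
  then obtain w where w: "card r = 4 * w" by auto
  have s: "even (dot s ?g) \<longleftrightarrow> even (\<Sum>i\<in>r. s i)"
    using even_dot_iff[of s ?g] lift(2)[OF r] by simp
  have "8 dvd dot ?g ?g - 4 * dot s ?g" by (rule characteristic) (rule lift(1)[OF r])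
  with norm have "8 dvd 4 * int w + 4 * (\<Sum>i\<in>- r. ?g i div 2) - 4 * dot s ?g"
    unfolding w by presburger
  then have "even (int w + (\<Sum>i\<in>- r. ?g i div 2) - dot s ?g)" by presburger
  then show "lift_sign r (- r) = alt ((\<Sum>i\<in>r. s i) + int (card r div 4))"
    using s unfolding lift_sign_def alt_def w by auto
qed

lemma lift_sign_sym_diff: "lift_sign r (sym_diff a b) = lift_sign r a * lift_sign r b"
  by (simp add: lift_sign_def alt_sum_sym_diff)

text \<open>
  On disjoint supports \<open>(lift r, lift a)\<close> is, modulo 4, the sum of \<open>lift r\<close> over \<open>a\<close> plus the sum of
  \<open>lift a\<close> over \<open>r\<close>; self-duality makes the total vanish modulo 4.
\<close>

lemma lift_sign_commute:
  assumes "r \<in> residues" "a \<in> residues" "r \<inter> a = {}"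
  shows "lift_sign r a = lift_sign a r"
proof -
  let ?g = "lift r" and ?h = "lift a"
  have "4 dvd ?g i * ?h i - ((if i \<in> a then ?g i else 0) + (if i \<in> r then ?h i else 0))" for i
  proof -
    have *: "4 dvd x * y" if "even x" "even y" for x y :: int
      using mult_dvd_mono[OF that] by simp
    consider "i \<in> r" "i \<notin> a" | "i \<in> a" "i \<notin> r" | "i \<notin> a" "i \<notin> r" using assms(3) by blast
    then show ?thesis
    proof cases
      case 1
      then have "4 dvd (?g i - 1) * ?h i"
        using odd_lift_iff[OF assms(1), of i] odd_lift_iff[OF assms(2), of i] by (intro *) auto
      then show ?thesis using 1 by (simp add: algebra_simps)
    next
      case 2
      then have "4 dvd ?g i * (?h i - 1)"
        using odd_lift_iff[OF assms(1), of i] odd_lift_iff[OF assms(2), of i] by (intro *) auto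
      then show ?thesis using 2 by (simp add: algebra_simps)
    next
      case 3
      then show ?thesis
        using odd_lift_iff[OF assms(1), of i] odd_lift_iff[OF assms(2), of i] * by auto
    qed
  qed
  then have "4 dvd (\<Sum>i\<in>UNIV. ?g i * ?h i - ((if i \<in> a then ?g i else 0) + (if i \<in> r then ?h i else 0)))"
    by (intro dvd_sum)
  then have "4 dvd dot ?g ?h - ((\<Sum>i\<in>a. ?g i) + (\<Sum>i\<in>r. ?h i))"
    by (simp add: dot_def sum_subtractf sum.distrib sum.If_cases)
  moreover have "4 dvd dot ?g ?h" using assms lift by (intro dot_dvd) auto
  ultimately have "4 dvd (\<Sum>i\<in>a. ?g i) + (\<Sum>i\<in>r. ?h i)" by presburger
  moreover have "(\<Sum>i\<in>a. ?g i) = 2 * (\<Sum>i\<in>a. ?g i div 2)"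
    unfolding sum_distrib_left using odd_lift_iff[OF assms(1)] assms(3)
    by (intro sum.cong refl) (metis disjoint_iff dvd_mult_div_cancel)
  moreover have "(\<Sum>i\<in>r. ?h i) = 2 * (\<Sum>i\<in>r. ?h i div 2)"
    unfolding sum_distrib_left using odd_lift_iff[OF assms(2)] assms(3)
    by (intro sum.cong refl) (metis disjoint_iff dvd_mult_div_cancel)
  ultimately have "even ((\<Sum>i\<in>a. ?g i div 2) + (\<Sum>i\<in>r. ?h i div 2))" by presburger
  then show ?thesis by (simp add: lift_sign_def alt_def)
qed

lemma card_coset_theta:
  "fps_const (int (card residues)) * weighted_series (coset c) vnorm (\<lambda>_. 1)
    = (\<Sum>r\<in>residues. \<Sum>a\<in>residues. if r \<inter> a = {} then fps_const (lift_sign r a * alt (\<Sum>i\<in>a. c i))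
        * theta_even ^ (CARD('n) - card r - card a) * theta_alt ^ card a * theta_odd ^ card r else 0)"
proof -
  have "weighted_series (coset c) vnorm (\<lambda>_. 1) = weighted_series UNIV vnorm (\<lambda>v. of_bool (v \<in> coset c))"
  proof -
    have "weighted_series UNIV vnorm (\<lambda>v. of_bool (v \<in> coset c)) = weighted_series (coset c) vnorm (\<lambda>v. of_bool (v \<in> coset c))"
      by (intro weighted_series_restrict finite_fibres_vnorm) auto
    also have "\<dots> = weighted_series (coset c) vnorm (\<lambda>_. 1)" by (rule weighted_series_cong) simp
    finally show ?thesis ..
  qed
  then have "fps_const (int (card residues)) * weighted_series (coset c) vnorm (\<lambda>_. 1)
      = weighted_series UNIV vnorm (\<lambda>v. int (card residues) * of_bool (v \<in> coset c))"
    by (simp only: weighted_series_cmult)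
  then show ?thesis
    unfolding coset_indicator weighted_series_sum by (simp add: theta_product cong: sum.cong)
qed

lemma theta_even_power:
  assumes "r \<in> residues" "a \<in> residues" "r \<inter> a = {}"
  shows "theta_even ^ (CARD('n) - card r - card a)
    = (theta_alt ^ 4 + theta_odd ^ 4) ^ (CARD('n) div 4 - card r div 4 - card a div 4)"
proof -
  have "CARD('n) - card r - card a = 4 * (CARD('n) div 4 - card r div 4 - card a div 4)"
    using four_dvd_card[OF assms(1)] four_dvd_card[OF assms(2)] four_dvd_card[OF residue_UNIV]
    by (auto elim!: dvdE simp: diff_mult_distrib2)
  then show ?thesis by (simp only: power_mult Jacobi_quartic)
qed

lemma power_card_residue: "r \<in> residues \<Longrightarrow> (F :: int fps) ^ card r = (F ^ 4) ^ (card r div 4)"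
  using four_dvd_card[of r] by (simp flip: power_mult)

theorem theta_code_eq_weight_form:
  "fps_const (int (card residues)) * weighted_series U vnorm (\<lambda>_. 1) = weight_form (theta_alt ^ 4) (theta_odd ^ 4)"
proof -
  have "coset (\<lambda>_. 0) = U" by (simp add: coset_def)
  then have "fps_const (int (card residues)) * weighted_series U vnorm (\<lambda>_. 1)
      = fps_const (int (card residues)) * weighted_series (coset (\<lambda>_. 0)) vnorm (\<lambda>_. 1)" by (simp only:)
  also have "\<dots> = weight_form (theta_alt ^ 4) (theta_odd ^ 4)"
    unfolding card_coset_theta weight_form_def
  proof (intro sum.cong refl)
    fix r a assume r: "r \<in> residues" and a: "a \<in> residues"
    have "alt (\<Sum>i\<in>a. 0) = 1" by (simp add: alt_def)
    then show "(if r \<inter> a = {} then fps_const (lift_sign r a * alt (\<Sum>i\<in>a. 0))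
          * theta_even ^ (CARD('n) - card r - card a) * theta_alt ^ card a * theta_odd ^ card r else 0)
        = (if r \<inter> a = {} then fps_const (lift_sign r a)
          * (theta_alt ^ 4 + theta_odd ^ 4) ^ (CARD('n) div 4 - card r div 4 - card a div 4)
          * (theta_alt ^ 4) ^ (card a div 4) * (theta_odd ^ 4) ^ (card r div 4) else 0)"
      by (cases "r \<inter> a = {}") (simp_all only: if_True if_False mult_1_right theta_even_power[OF r a]
          power_card_residue[OF a, of theta_alt] power_card_residue[OF r, of theta_odd] not_False_eq_True)
  qed
  finally show ?thesis .
qed

text \<open>
  The shadow only inserts a sign, the parity of the sum of \<open>s\<close> over \<open>a\<close>, into the sum over
  disjoint pairs \<open>(r, a)\<close>.  For fixed \<open>a\<close>, replacing \<open>r\<close> by the complement of \<open>r \<union> a\<close> exchanges the exponents of \<open>\<theta>\<^sub>3\<close> and \<open>\<theta>\<^sub>2\<close> and, by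
  \<open>lift_sign_Compl\<close>, turns this sign into \<open>(-1)^(|a| / 4)\<close>.  The result is the original form with \<open>\<theta>\<^sub>4^4\<close>
  negated and the roles of \<open>\<theta>\<^sub>2^4\<close> and \<open>\<theta>\<^sub>3^4 = \<theta>\<^sub>4^4 + \<theta>\<^sub>2^4\<close> exchanged.
\<close>

theorem theta_shadow_eq_weight_form:
  "fps_const (int (card residues)) * weighted_series (coset s) vnorm (\<lambda>_. 1) = weight_form (- (theta_alt ^ 4)) (theta_even ^ 4)"
proof -
  let ?nu = "CARD('n) div 4" and ?w = "\<lambda>r. card r div 4"
  let ?X = "theta_even ^ 4" and ?Y = "theta_alt ^ 4" and ?Z = "theta_odd ^ 4"
  have Z: "- ?Y + ?X = ?Z" using Jacobi_quartic by simp
  have inner: "(\<Sum>r\<in>residues. if r \<inter> a = {} then fps_const (lift_sign r a * alt (\<Sum>i\<in>a. s i))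
        * theta_even ^ (CARD('n) - card r - card a) * theta_alt ^ card a * theta_odd ^ card r else 0)
      = (\<Sum>r\<in>residues. if r \<inter> a = {} then fps_const (lift_sign r a)
        * (- ?Y + ?X) ^ (?nu - ?w r - ?w a) * (- ?Y) ^ ?w a * ?X ^ ?w r else 0)"
    if a: "a \<in> residues" for a
  proof -
    \<comment> \<open>\<open>?h\<close> is an involution of the residue words disjoint from \<open>a\<close>.\<close>
    let ?D = "{r \<in> residues. r \<inter> a = {}}" and ?h = "\<lambda>r. - (r \<union> a)"
    have h: "?h r \<in> ?D" if "r \<in> ?D" for r
    proof -
      have "?h r = - (sym_diff r a)" using that by auto
      moreover have "- (sym_diff r a) \<in> residues"
        using that a by (intro residue_Compl residue_sym_diff) auto
      moreover have "?h r \<inter> a = {}" by blast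
      ultimately show ?thesis by (simp only: mem_Collect_eq)
    qed
    have bij: "bij_betw ?h ?D ?D"
    proof (rule bij_betw_byWitness[where f' = ?h])
      show "\<forall>r\<in>?D. ?h (?h r) = r" by blast
    qed (use h in blast)+
    have filter: "(\<Sum>r\<in>residues. if r \<inter> a = {} then f r else 0) = sum f ?D" for f :: "_ \<Rightarrow> int fps"
      by (rule sum.inter_filter[symmetric]) simp
    have "fps_const (lift_sign (?h r) a * alt (\<Sum>i\<in>a. s i))
        * theta_even ^ (CARD('n) - card (?h r) - card a) * theta_alt ^ card a * theta_odd ^ card (?h r)
      = fps_const (lift_sign r a) * (- ?Y + ?X) ^ (?nu - ?w r - ?w a) * (- ?Y) ^ ?w a * ?X ^ ?w r" if "r \<in> ?D" for r
    proof -
      have r: "r \<in> residues" "r \<inter> a = {}" using that by auto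
      have hr: "?h r \<in> residues" "?h r \<inter> a = {}" using h[OF that] by auto
      have "?h r = sym_diff (- a) r" using r by auto
      then have "lift_sign (?h r) a = lift_sign a (- a) * lift_sign a r"
        using lift_sign_commute[OF hr(1) a hr(2)] by (simp only: lift_sign_sym_diff)
      then have sign: "lift_sign (?h r) a * alt (\<Sum>i\<in>a. s i) = alt (int (?w a)) * lift_sign r a"
        using lift_sign_commute[OF r(1) a r(2)] lift_sign_Compl[OF a] by (simp add: alt_add mult_ac)
      have card: "card (?h r) = CARD('n) - card r - card a"
        by (rule card_Compl_Un[OF r(2)])
      have le: "card r + card a \<le> CARD('n)"
        using r(2) by (rule card_add_le)
      have w: "?w (?h r) = ?nu - ?w r - ?w a"
        using four_dvd_card[OF r(1)] four_dvd_card[OF a] four_dvd_card[OF residue_UNIV] le unfolding card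
        by (auto elim!: dvdE)
      have "(- ?Y) ^ ?w a = fps_const (alt (int (?w a))) * ?Y ^ ?w a"
        by (subst power_minus) (simp add: alt_def minus_one_power_iff flip: fps_const_neg)
      moreover have "theta_even ^ (CARD('n) - card (?h r) - card a) = ?X ^ ?w r"
      proof -
        have "CARD('n) - card (?h r) - card a = card r" unfolding card using le by simp
        then show ?thesis by (simp only: power_card_residue[OF r(1)])
      qed
      moreover have "theta_odd ^ card (?h r) = ?Z ^ (?nu - ?w r - ?w a)"
        by (simp only: power_card_residue[OF hr(1)] w)
      moreover have "theta_alt ^ card a = ?Y ^ ?w a" by (rule power_card_residue[OF a])
      ultimately show ?thesis unfolding sign Z by (simp add: mult_ac flip: fps_const_mult)
    qed
    then show ?thesis
      unfolding filter by (subst sum.reindex_bij_betw[OF bij, symmetric]) (rule sum.cong[OF refl])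
  qed
  show ?thesis
    unfolding card_coset_theta weight_form_def
    by (subst (1 2) sum.swap) (intro sum.cong refl inner)
qed

text \<open>
  The factor 2 avoids fractions: symmetrising over the pair \<open>(r, a)\<close> counts each term twice.
\<close>

theorem weight_form_symmetric: "symmetric_form (CARD('n) div 4) (\<lambda>Y Z. 2 * weight_form Y Z)"
proof -
  let ?nu = "CARD('n) div 4" and ?w = "\<lambda>r. card r div 4"
  define t where "t r a Y Z = (if r \<inter> a = {} then fps_const (lift_sign r a)
      * (Y + Z) ^ (?nu - ?w r - ?w a) * Y ^ ?w a * Z ^ ?w r else 0)" for r a and Y Z :: "int fps"
  have A: "weight_form Y Z = (\<Sum>r\<in>residues. \<Sum>a\<in>residues. t a r Y Z)" for Y Z
    unfolding weight_form_def t_def by (rule sum.swap)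
  have B: "weight_form Y Z = (\<Sum>r\<in>residues. \<Sum>a\<in>residues. t r a Y Z)" for Y Z
    unfolding weight_form_def t_def ..
  have "(\<lambda>Y Z. 2 * weight_form Y Z) = (\<lambda>Y Z. \<Sum>r\<in>residues. \<Sum>a\<in>residues. t r a Y Z + t a r Y Z)"
    unfolding sum.distrib mult_2 by (intro ext arg_cong2[of _ _ _ _ "(+)"] A B)
  moreover have "symmetric_form ?nu (\<lambda>Y Z. t r a Y Z + t a r Y Z)" if "r \<in> residues" "a \<in> residues" for r a
  proof (cases "r \<inter> a = {}")
    case True
    have le: "card r + card a \<le> CARD('n)"
      using True by (rule card_add_le)
    then have deg: "?nu - ?w r - ?w a + (?w a + ?w r) = ?nu"
      using four_dvd_card[OF that(1)] four_dvd_card[OF that(2)] four_dvd_card[OF residue_UNIV]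
      by (auto elim!: dvdE)
    have "t r a Y Z + t a r Y Z = fps_const (lift_sign r a) * ((Y + Z) ^ (?nu - ?w r - ?w a)
        * (Y ^ ?w a * Z ^ ?w r + Y ^ ?w r * Z ^ ?w a))" for Y Z
      using True lift_sign_commute[OF that True]
      by (simp add: t_def Int_commute[of a r] diff_commute[of ?nu "?w a"] algebra_simps)
    then show ?thesis
      using symmetric_form_cmult[OF symmetric_form_mult_power[OF symmetric_form_monomials, of "?nu - ?w r - ?w a" "?w a" "?w r"], of "lift_sign r a"]
      unfolding deg by simp
  qed (simp add: t_def Int_commute[of a r] symmetric_form_0)
  ultimately show ?thesis by (simp only:) (intro symmetric_form_sum)
qed

end

section \<open>Theta series in dimension 40\<close>

definition initial_coeffs :: "int fps \<Rightarrow> int \<Rightarrow> int \<Rightarrow> int \<Rightarrow> int \<Rightarrow> bool" where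
  "initial_coeffs F a b c d \<longleftrightarrow> fps_nth F 0 = a \<and> fps_nth F 1 = b \<and> fps_nth F 2 = c \<and> fps_nth F 3 = d"

lemma initial_coeffs_mult:
  "initial_coeffs F a b c d \<Longrightarrow> initial_coeffs G a' b' c' d' \<Longrightarrow>
    initial_coeffs (F * G) (a * a') (a * b' + b * a') (a * c' + b * b' + c * a') (a * d' + b * c' + c * b' + d * a')"
  by (simp add: initial_coeffs_def fps_mult_nth numeral_2_eq_2 numeral_3_eq_3)

lemma initial_coeffs_add:
  "initial_coeffs F a b c d \<Longrightarrow> initial_coeffs G a' b' c' d' \<Longrightarrow> initial_coeffs (F + G) (a + a') (b + b') (c + c') (d + d')"
  by (simp add: initial_coeffs_def)

lemma initial_coeffs_cmult: "initial_coeffs F a b c d \<Longrightarrow> initial_coeffs (fps_const k * F) (k * a) (k * b) (k * c) (k * d)"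
  by (simp add: initial_coeffs_def)

lemma initial_coeffs_power_double:
  assumes "initial_coeffs (F ^ n) a b c d"
  shows "initial_coeffs (F ^ (2 * n)) (a * a) (2 * a * b) (2 * a * c + b * b) (2 * a * d + 2 * b * c)"
proof -
  have "F ^ (2 * n) = F ^ n * F ^ n" by (simp only: mult_2 power_add)
  then show ?thesis using initial_coeffs_mult[OF assms assms] by (simp add: algebra_simps)
qed

lemma initial_coeffs_theta3: "initial_coeffs theta3 1 2 0 0"
proof -
  have small: "m \<in> {- 1, 0, 1}" if "m\<^sup>2 \<le> 3" for m :: int
  proof -
    have "\<bar>m\<bar> < 2"
    proof (rule ccontr)
      assume "\<not> \<bar>m\<bar> < 2"
      then have "2 * 2 \<le> \<bar>m\<bar> * \<bar>m\<bar>" by (intro mult_mono) auto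
      then show False using that by (simp add: power2_eq_square)
    qed
    then show ?thesis by auto
  qed
  have "{m :: int. m\<^sup>2 = 0} = {0}" "{m :: int. m\<^sup>2 = 1} = {1, - 1}" by (auto simp: power2_eq_1_iff)
  moreover have "m\<^sup>2 \<noteq> 2" "m\<^sup>2 \<noteq> 3" for m :: int
    using small[of m] by auto
  ultimately show ?thesis by (simp add: initial_coeffs_def theta3_def)
qed

lemma initial_coeffs_Delta8: "initial_coeffs Delta8 0 1 (- 8) 28"
proof -
  let ?Psi = "triangular_series (\<lambda>k. alt (int (triangular k)))"
  have "fps_nth ?Psi n = (\<Sum>k\<le>n. if triangular k = n then alt (int n) else 0)" for n
  proof -
    have "{k. triangular k = n} = {k \<in> {..n}. triangular k = n}" using le_triangular by auto
    then have "fps_nth ?Psi n = (\<Sum>k\<in>{k \<in> {..n}. triangular k = n}. alt (int n))"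
      by (simp add: triangular_series_def weighted_series_nth)
    then show ?thesis by (simp only: sum.inter_filter[OF finite_atMost])
  qed
  moreover have "triangular 0 = 0" "triangular 1 = 1" "triangular 2 = 3" "triangular 3 = 6" by (simp_all add: triangular_def)
  ultimately have "initial_coeffs (?Psi ^ 1) 1 (- 1) 0 (- 1)"
    by (simp add: initial_coeffs_def atMost_nat_numeral alt_def)
  from initial_coeffs_power_double[OF initial_coeffs_power_double[OF initial_coeffs_power_double[OF this]]]
  have "initial_coeffs (?Psi ^ 8) 1 (- 8) 28 (- 64)" by simp
  moreover have "initial_coeffs fps_X 0 1 0 0" by (simp add: initial_coeffs_def)
  ultimately show ?thesis using initial_coeffs_mult[of fps_X 0 1 0 0 "?Psi ^ 8" 1 "- 8" 28 "- 64"]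
    unfolding Delta8_eq by simp
qed

lemma initial_coeffs_theta3_power:
  "initial_coeffs (theta3 ^ 8) 1 16 112 448" "initial_coeffs (theta3 ^ 16) 1 32 480 4480"
  "initial_coeffs (theta3 ^ 24) 1 48 1104 16192" "initial_coeffs (theta3 ^ 32) 1 64 1984 39680"
  "initial_coeffs (theta3 ^ 40) 1 80 3120 79040"
proof -
  have 1: "initial_coeffs (theta3 ^ 1) 1 2 0 0" using initial_coeffs_theta3 by simp
  from initial_coeffs_power_double[OF initial_coeffs_power_double[OF initial_coeffs_power_double[OF this]]]
  show 8: "initial_coeffs (theta3 ^ 8) 1 16 112 448" by simp
  from initial_coeffs_power_double[OF 8] show 16: "initial_coeffs (theta3 ^ 16) 1 32 480 4480" by simp
  from initial_coeffs_mult[OF 8 16] show "initial_coeffs (theta3 ^ 24) 1 48 1104 16192" by (simp flip: power_add)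
  from initial_coeffs_power_double[OF 16] show 32: "initial_coeffs (theta3 ^ 32) 1 64 1984 39680" by simp
  from initial_coeffs_mult[OF 8 32] show "initial_coeffs (theta3 ^ 40) 1 80 3120 79040" by (simp flip: power_add)
qed

lemma initial_coeffs_Delta8_power:
  "initial_coeffs (Delta8 ^ 2) 0 0 1 (- 16)" "initial_coeffs (Delta8 ^ 3) 0 0 0 1" "initial_coeffs (Delta8 ^ 4) 0 0 0 0"
proof -
  have 1: "initial_coeffs (Delta8 ^ 1) 0 1 (- 8) 28" using initial_coeffs_Delta8 by simp
  from initial_coeffs_power_double[OF 1] show 2: "initial_coeffs (Delta8 ^ 2) 0 0 1 (- 16)" by simp
  from initial_coeffs_mult[OF 1 2] show "initial_coeffs (Delta8 ^ 3) 0 0 0 1" 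
    by (simp add: power3_eq_cube power2_eq_square mult.assoc)
  from initial_coeffs_power_double[OF 2] show "initial_coeffs (Delta8 ^ 4) 0 0 0 0" by simp
qed

text \<open>
  The shape that Hecke's theorem gives to the theta series of a unimodular lattice in dimension 40.
\<close>

definition hecke_combination :: "(nat \<Rightarrow> int) \<Rightarrow> int fps" where
  "hecke_combination d = (\<Sum>j\<le>5. fps_const (d j) * theta3 ^ (40 - 8 * j) * Delta8 ^ j)"

lemma hecke_combination_expand:
  "hecke_combination d = fps_const (d 0) * theta3 ^ 40 + fps_const (d 1) * (theta3 ^ 32 * Delta8)
     + fps_const (d 2) * (theta3 ^ 24 * Delta8 ^ 2) + fps_const (d 3) * (theta3 ^ 16 * Delta8 ^ 3)
     + fps_const (d 4) * (theta3 ^ 8 * Delta8 ^ 4) + fps_const (d 5) * Delta8 ^ 5"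
proof -
  have "{..5 :: nat} = {0, 1, 2, 3, 4, 5}" by auto
  then show ?thesis by (simp add: hecke_combination_def add.assoc mult.assoc)
qed

lemma initial_coeffs_hecke_combination:
  "initial_coeffs (hecke_combination d) (d 0) (80 * d 0 + d 1) (3120 * d 0 + 56 * d 1 + d 2)
    (79040 * d 0 + 1500 * d 1 + 32 * d 2 + d 3)"
proof -
  have "initial_coeffs (Delta8 ^ 5) 0 0 0 0"
    using initial_coeffs_mult[OF initial_coeffs_Delta8 initial_coeffs_Delta8_power(3)] by (simp flip: power_Suc)
  note initial_coeffs_add[OF initial_coeffs_add[OF initial_coeffs_add[OF initial_coeffs_add[OF initial_coeffs_add[
    OF initial_coeffs_cmult[OF initial_coeffs_theta3_power(5), of "d 0"]
    initial_coeffs_cmult[OF initial_coeffs_mult[OF initial_coeffs_theta3_power(4) initial_coeffs_Delta8], of "d 1"]]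
    initial_coeffs_cmult[OF initial_coeffs_mult[OF initial_coeffs_theta3_power(3) initial_coeffs_Delta8_power(1)], of "d 2"]]
    initial_coeffs_cmult[OF initial_coeffs_mult[OF initial_coeffs_theta3_power(2) initial_coeffs_Delta8_power(2)], of "d 3"]]
    initial_coeffs_cmult[OF initial_coeffs_mult[OF initial_coeffs_theta3_power(1) initial_coeffs_Delta8_power(3)], of "d 4"]]
    initial_coeffs_cmult[OF this, of "d 5"]]
  then show ?thesis unfolding hecke_combination_expand by (simp add: algebra_simps)
qed

lemma hecke_combination_cong: "(\<And>j. j \<le> 5 \<Longrightarrow> d j = e j) \<Longrightarrow> hecke_combination d = hecke_combination e"
  by (simp add: hecke_combination_def)

lemma hecke_combination_cmult: "fps_const k * hecke_combination d = hecke_combination (\<lambda>j. k * d j)"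
  by (simp add: hecke_combination_def sum_distrib_left mult.assoc flip: fps_const_mult)

lemma theta40_eq_hecke_combination: "theta40 \<alpha> = hecke_combination (\<lambda>j. [1, -80, 1360, -2560, 2 ^ 8 * \<alpha>, 0] ! j)"
proof -
  have "{0..4 :: nat} = {0, 1, 2, 3, 4}" by auto
  then show ?thesis by (simp add: theta40_def theta40_coeff_def hecke_combination_expand add.assoc mult.assoc)
qed

text \<open>
  The first four coefficients determine \<open>d 0, ..., d 3\<close> by a triangular system, whose solution is
  the list of coefficients in \<open>theta40\<close>.
\<close>

lemma hecke_combination_eq_theta40:
  assumes "initial_coeffs (hecke_combination d) k 0 0 0" "d 4 = k * (256 * \<alpha>)" "d 5 = 0"
  shows "hecke_combination d = fps_const k * theta40 \<alpha>"
proof -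
  have "d 0 = k" "d 1 = - 80 * k" "d 2 = 1360 * k" "d 3 = - 2560 * k"
    using assms(1) initial_coeffs_hecke_combination[of d] by (simp_all add: initial_coeffs_def)
  moreover have "j \<in> {0, 1, 2, 3, 4, 5}" if "j \<le> 5" for j :: nat using that by auto
  ultimately show ?thesis
    unfolding theta40_eq_hecke_combination hecke_combination_cmult using assms(2,3) by (intro hecke_combination_cong) fastforce
qed

lemma theta_even_nth_0: "fps_nth theta_even 0 = 1"
  using initial_coeffs_theta3 by (simp add: theta_even_eq_theta3 initial_coeffs_def)

lemma theta_alt_nth_0: "fps_nth theta_alt 0 = 1"
proof -
  have "{a. sq a = 0} = {0}" by (auto simp: sq_def)
  then show ?thesis by (simp add: theta_alt_def weighted_theta_def weighted_series_nth alt_def)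
qed

context selfdual_code
begin

text \<open>
  The constant terms of \<open>\<theta>\<^sub>3\<close> and \<open>\<theta>\<^sub>4\<close> are 1 and \<open>\<theta>\<^sub>2^4\<close> starts with \<open>16 t^4\<close>, so the shadow series
  reads off \<open>c 5\<close> from its constant term and then \<open>c 4\<close> from its coefficient at \<open>t^8\<close>; the minimum of the
  lattice gives the first four coefficients of its own series.
\<close>

theorem theta_determined:
  assumes dim: "CARD('n) = 40"
    and min: "\<And>u. u \<in> U \<Longrightarrow> u \<noteq> (\<lambda>_. 0) \<Longrightarrow> 16 \<le> vnorm u"
    and zero: "(\<lambda>_. 0) \<notin> coset s"
    and shadow8: "card {v \<in> coset s. vnorm v = 8} = m"
  shows "weighted_series U vnorm (\<lambda>_. 1) = theta40 (int m) oo fps_X ^ 4"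
proof -
  let ?X = "theta_even ^ 4" and ?Y = "theta_alt ^ 4" and ?Z = "theta_odd ^ 4"
  define N where "N = 2 * int (card residues)"
  have N: "N \<noteq> 0" using residue_card_pos unfolding N_def by linarith
  obtain c where c: "2 * weight_form Y Z = (\<Sum>j\<le>5. fps_const (c j) * (Y + Z) ^ (10 - 2 * j) * (Y * Z) ^ j)" for Y Z
    using weight_form_symmetric unfolding symmetric_form_def dim by auto
  have code: "fps_const N * weighted_series U vnorm (\<lambda>_. 1) = 2 * weight_form ?Y ?Z"
    and shadow: "fps_const N * weighted_series (coset s) vnorm (\<lambda>_. 1) = 2 * weight_form (- ?Y) ?X"
    unfolding theta_code_eq_weight_form[symmetric] theta_shadow_eq_weight_form[symmetric] N_def
    by (simp_all add: mult.assoc numeral_fps_const flip: fps_const_mult)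

  obtain G where G: "theta_odd = fps_X * G" "fps_nth G 0 = 2" using theta_odd_leading by blast
  have vnorm0: "vnorm v = 0 \<longleftrightarrow> v = (\<lambda>_. 0)" for v :: "'n \<Rightarrow> int"
    by (auto simp: vnorm_def sq_def fun_eq_iff)
  have Z: "- ?Y + ?X = fps_X ^ 4 * G ^ 4"
    using Jacobi_quartic by (simp add: G(1) power_mult_distrib)
  \<comment> \<open>The \<open>j\<close>-th term of the shadow series is \<open>c j * t^(40 - 8 j) * H j\<close>.\<close>
  define H where "H j = G ^ (4 * (10 - 2 * j)) * (- (?Y * ?X)) ^ j" for j
  have H0: "fps_nth (H j) 0 = 2 ^ (4 * (10 - 2 * j)) * (- 1) ^ j" for j
    by (simp add: H_def fps_nth_power_0 G(2) theta_even_nth_0 theta_alt_nth_0)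
  have shadow_nth: "N * fps_nth (weighted_series (coset s) vnorm (\<lambda>_. 1)) n
      = (\<Sum>j\<le>5. c j * (if n < 40 - 8 * j then 0 else fps_nth (H j) (n - (40 - 8 * j))))" for n
  proof -
    have "fps_const N * weighted_series (coset s) vnorm (\<lambda>_. 1) = (\<Sum>j\<le>5. fps_const (c j) * (fps_X ^ (40 - 8 * j) * H j))"
      unfolding shadow c Z
    proof (intro sum.cong refl)
      fix j assume "j \<in> {..5 :: nat}"
      then have "4 * (10 - 2 * j) = 40 - 8 * j" by auto
      then show "fps_const (c j) * (fps_X ^ 4 * G ^ 4) ^ (10 - 2 * j) * (- ?Y * ?X) ^ j
          = fps_const (c j) * (fps_X ^ (40 - 8 * j) * H j)"
        by (simp add: H_def power_mult_distrib mult.assoc flip: power_mult)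
    qed
    then have "fps_nth (fps_const N * weighted_series (coset s) vnorm (\<lambda>_. 1)) n
        = fps_nth (\<Sum>j\<le>5. fps_const (c j) * (fps_X ^ (40 - 8 * j) * H j)) n" by simp
    then show ?thesis by (simp add: fps_sum_nth fps_X_power_mult_nth)
  qed
  have five: "{..5 :: nat} = {0, 1, 2, 3, 4, 5}" by auto
  have "{a \<in> coset s. vnorm a = 0} = {}" using zero by (auto simp: vnorm0)
  then have "card {a \<in> coset s. vnorm a = 0} = 0" by (simp only: card.empty)
  then have c5: "c 5 = 0"
    using shadow_nth[of 0] by (simp add: weighted_series_nth five H0)
  have "{a. a \<in> coset s \<and> vnorm a = 8} = {v \<in> coset s. vnorm v = 8}" by simp
  then have c4: "N * int m = 256 * c 4"
    using shadow_nth[of 8] shadow8 by (simp add: weighted_series_nth five c5 H0)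

  define d where "d j = c j * 16 ^ j" for j
  have hecke_combination: "fps_const N * weighted_series U vnorm (\<lambda>_. 1) = hecke_combination d oo fps_X ^ 4"
  proof -
    have base: "?X ^ (10 - 2 * j) = (theta3 ^ (40 - 8 * j)) oo fps_X ^ 4" if "j \<le> 5" for j
    proof -
      have "4 * (10 - 2 * j) = 40 - 8 * j" by auto
      then show ?thesis by (simp add: theta_even_eq_theta3 compose_X_power_power flip: power_mult)
    qed
    have "fps_const N * weighted_series U vnorm (\<lambda>_. 1)
        = (\<Sum>j\<le>5. fps_const (c j) * ?X ^ (10 - 2 * j) * (16 * (Delta8 oo fps_X ^ 4)) ^ j)"
      unfolding code c Jacobi_quartic theta_product_eq_Delta8 ..
    also have "\<dots> = (\<Sum>j\<le>5. (fps_const (d j) * theta3 ^ (40 - 8 * j) * Delta8 ^ j) oo fps_X ^ 4)"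
    proof (intro sum.cong refl)
      fix j assume "j \<in> {..5 :: nat}"
      then have j: "j \<le> 5" by simp
      show "fps_const (c j) * ?X ^ (10 - 2 * j) * (16 * (Delta8 oo fps_X ^ 4)) ^ j
          = (fps_const (d j) * theta3 ^ (40 - 8 * j) * Delta8 ^ j) oo fps_X ^ 4"
        unfolding base[OF j]
        by (simp add: d_def compose_X_power_mult compose_X_power_power[of 4 Delta8] power_mult_distrib
            numeral_fps_const fps_const_power mult_ac flip: fps_const_mult)
    qed
    finally show ?thesis by (simp only: hecke_combination_def fps_compose_sum_distrib)
  qed
  have nth: "fps_nth (hecke_combination d) n = N * int (card {u \<in> U. vnorm u = 4 * n})" for n
  proof -
    have "fps_nth (hecke_combination d oo fps_X ^ 4) (4 * n) = N * int (card {u \<in> U. vnorm u = 4 * n})"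
      unfolding hecke_combination[symmetric] by (simp add: weighted_series_nth)
    then show ?thesis by (simp add: fps_nth_compose_X_power)
  qed
  have origin: "{u \<in> U. vnorm u = 4 * 0} = {\<lambda>_. 0}" using zero_mem by (auto simp: vnorm0)
  have none: "card {u \<in> U. vnorm u = 4 * n} = 0" if "0 < n" "n < 4" for n
  proof -
    have False if u: "u \<in> U" "vnorm u = 4 * n" for u
      using min[OF u(1)] u(2) vnorm0[of u] \<open>0 < n\<close> \<open>n < 4\<close> by (cases "u = (\<lambda>_. 0)") auto
    then have "{u \<in> U. vnorm u = 4 * n} = {}" by blast
    then show ?thesis by (simp only: card.empty)
  qed
  have "initial_coeffs (hecke_combination d) N 0 0 0"
    unfolding initial_coeffs_def nth using none[of 1] none[of 2] none[of 3] origin by simp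
  moreover have "d 4 = N * (256 * int m)" using c4 by (simp add: d_def)
  moreover have "d 5 = 0" by (simp add: d_def c5)
  ultimately have "hecke_combination d = fps_const N * theta40 (int m)" by (rule hecke_combination_eq_theta40)
  then have "fps_const N * weighted_series U vnorm (\<lambda>_. 1) = fps_const N * (theta40 (int m) oo fps_X ^ 4)"
    unfolding hecke_combination by (simp add: compose_X_power_mult)
  then show ?thesis using N by (simp add: fps_const_eq_0_iff)
qed

end

section \<open>Lattices from codes modulo 4\<close>

lemma mem_int_span_iff: "x \<in> int_span B \<longleftrightarrow> (\<exists>c. x = (\<Sum>b\<in>B. of_int (c b) *\<^sub>R b))"
  by (auto simp: int_span_def)

lemma int_span_base:
  assumes "finite B" "b \<in> B"
  shows "b \<in> int_span B"
proof -
  have "(\<Sum>a\<in>B. of_int (if a = b then 1 else 0) *\<^sub>R a) = (\<Sum>a\<in>B. if a = b then a else 0)"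
    by (intro sum.cong) auto
  then show ?thesis unfolding mem_int_span_iff using assms
    by (intro exI[of _ "\<lambda>a. if a = b then 1 else 0"]) simp
qed

lemma int_span_subset_span: "int_span B \<subseteq> span B"
proof
  fix x assume "x \<in> int_span B"
  then obtain c where "x = (\<Sum>b\<in>B. of_int (c b) *\<^sub>R b)" unfolding mem_int_span_iff by blast
  then show "x \<in> span B" by (simp add: span_sum span_scale span_base)
qed

lemma int_span_insert:
  assumes "finite B" "b \<notin> B"
  shows "x \<in> int_span (insert b B) \<longleftrightarrow> (\<exists>q :: int. x - of_int q *\<^sub>R b \<in> int_span B)"
proof
  assume "x \<in> int_span (insert b B)"
  then obtain c where "x = (\<Sum>a\<in>insert b B. of_int (c a) *\<^sub>R a)" unfolding mem_int_span_iff by blast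
  then have "x - of_int (c b) *\<^sub>R b = (\<Sum>a\<in>B. of_int (c a) *\<^sub>R a)" using assms by simp
  then show "\<exists>q :: int. x - of_int q *\<^sub>R b \<in> int_span B" unfolding mem_int_span_iff by blast
next
  assume "\<exists>q :: int. x - of_int q *\<^sub>R b \<in> int_span B"
  then obtain q c where x: "x - of_int q *\<^sub>R b = (\<Sum>a\<in>B. of_int (c a) *\<^sub>R a)"
    unfolding mem_int_span_iff by blast
  have "(\<Sum>a\<in>B. of_int ((c(b := q)) a) *\<^sub>R a) = (\<Sum>a\<in>B. of_int (c a) *\<^sub>R a)"
    using assms by (intro sum.cong) auto
  then have "x = (\<Sum>a\<in>insert b B. of_int ((c(b := q)) a) *\<^sub>R a)"
    using assms x[symmetric] by simp
  then show "x \<in> int_span (insert b B)" unfolding mem_int_span_iff by blast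
qed

text \<open>
  Hermite normal form.  A basis is built coordinate by coordinate: to the vectors supported on \<open>I\<close>
  one adds a vector supported on \<open>insert k I\<close> whose \<open>k\<close>-th coordinate is positive and minimal; it
  divides all the others.
\<close>

lemma discrete_subgroup_euclidean_lattice:
  fixes G :: "(real ^ 'n) set"
  assumes zero: "0 \<in> G" and diff: "\<And>x y. x \<in> G \<Longrightarrow> y \<in> G \<Longrightarrow> x - y \<in> G"
    and denom: "0 < d" "\<And>x i. x \<in> G \<Longrightarrow> \<exists>k :: int. x $ i = of_int k / d"
    and axes: "0 < c" "\<And>i. axis i c \<in> G"
  shows "euclidean_lattice G"
proof -
  have uminus: "- x \<in> G" if "x \<in> G" for x using diff[OF zero that] by simp
  have add: "x + y \<in> G" if "x \<in> G" "y \<in> G" for x y using diff[OF that(1) uminus[OF that(2)]] by simp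
  have nat_scale: "of_nat n *\<^sub>R x \<in> G" if "x \<in> G" for n x
    by (induction n) (simp_all add: zero add that scaleR_left_distrib)
  have scale: "of_int q *\<^sub>R x \<in> G" if "x \<in> G" for q :: int and x
  proof (cases q rule: int_cases2)
    case (nonneg n)
    then show ?thesis using nat_scale[OF that, of n] by simp
  next
    case (nonpos n)
    then show ?thesis using uminus[OF nat_scale[OF that, of n]] by simp
  qed
  have "\<exists>B. finite B \<and> independent B \<and> int_span B = {x \<in> G. \<forall>i. i \<notin> I \<longrightarrow> x $ i = 0}" if "finite I" for I
    using that
  proof (induction I rule: finite_induct)
    case empty
    have "(\<forall>i. x $ i = 0) \<longleftrightarrow> x = 0" for x :: "real ^ 'n" by (simp add: vec_eq_iff)
    then have "int_span {} = {x \<in> G. \<forall>i. i \<notin> {} \<longrightarrow> x $ i = 0}"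
      using zero by (auto simp: mem_int_span_iff)
    then show ?case by (intro exI[of _ "{}"]) (simp add: independent_empty)
  next
    case (insert k I)
    then obtain B where B: "finite B" "independent B" "int_span B = {x \<in> G. \<forall>i. i \<notin> I \<longrightarrow> x $ i = 0}"
      by blast
    define G' where "G' = {x \<in> G. \<forall>i. i \<notin> insert k I \<longrightarrow> x $ i = 0}"
    \<comment> \<open>Numerators, over the common denominator \<open>d\<close>, of the positive \<open>k\<close>-th coordinates.\<close>
    define P where "P m \<longleftrightarrow> 0 < m \<and> (\<exists>x\<in>G'. x $ k = of_nat m / d)" for m :: nat
    have ax: "axis k c \<in> G'" using axes by (auto simp: G'_def axis_def)
    obtain p where p: "axis k c $ k = of_int p / d" using denom(2)[OF axes(2)[of k], of k] by blast
    then have "0 < p" using axes(1) denom(1) by (auto simp: axis_def zero_less_divide_iff)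
    then have "P (nat p)" unfolding P_def using p \<open>0 < p\<close> by (intro conjI bexI[OF _ ax]) simp_all
    then have least: "P (LEAST m. P m)" by (rule LeastI)
    define m where "m = (LEAST m. P m)"
    obtain b where b: "b \<in> G'" "b $ k = of_nat m / d" and m: "0 < m"
      using least unfolding P_def m_def by blast
    have bk: "b $ k \<noteq> 0" using b m denom(1) by simp
    have in_span_zero: "x $ k = 0" if "x \<in> span B" for x
    proof -
      have "subspace {x :: real ^ 'n. x $ k = 0}" by (auto simp: subspace_def)
      moreover have "B \<subseteq> {x. x $ k = 0}" using int_span_base[OF B(1)] B(3) insert.hyps(2) by blast
      ultimately show ?thesis using span_minimal that by blast
    qed
    have b_notin: "b \<notin> span B" using in_span_zero bk by blast
    then have b_notin': "b \<notin> B" using span_base by blast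
    have "int_span (insert b B) = G'"
    proof (rule set_eqI)
      fix x
      have "(\<exists>q :: int. x - of_int q *\<^sub>R b \<in> int_span B) \<longleftrightarrow> x \<in> G'"
      proof
        assume "\<exists>q :: int. x - of_int q *\<^sub>R b \<in> int_span B"
        then obtain q :: int where q: "x - of_int q *\<^sub>R b \<in> G" "\<And>i. i \<notin> I \<Longrightarrow> (x - of_int q *\<^sub>R b) $ i = 0"
          unfolding B(3) by blast
        have "b \<in> G" using b by (simp add: G'_def)
        then have "x \<in> G" using add[OF q(1) scale[of b q]] by simp
        moreover have "x $ i = 0" if "i \<notin> insert k I" for i
          using q(2)[of i] that b(1) by (simp add: G'_def)
        ultimately show "x \<in> G'" by (simp add: G'_def)
      next
        assume x: "x \<in> G'"
        then obtain a where a: "x $ k = of_int a / d" using denom(2)[of x k] by (auto simp: G'_def)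
        define y where "y = x - of_int (a div int m) *\<^sub>R b"
        have yG: "y \<in> G'"
          using x b(1) diff scale by (auto simp: G'_def y_def)
        have "of_int a = of_int (a div int m) * of_nat m + (of_int (a mod int m) :: real)"
          by (metis div_mult_mod_eq of_int_add of_int_mult of_int_of_nat_eq)
        then have yk: "y $ k = of_nat (nat (a mod int m)) / d"
          using a b(2) m by (simp add: y_def diff_divide_distrib[symmetric])
        have "nat (a mod int m) < m" using m by (simp add: nat_less_iff)
        then have "\<not> P (nat (a mod int m))" unfolding m_def by (rule not_less_Least)
        then have "nat (a mod int m) = 0" unfolding P_def using yG yk by (metis neq0_conv)
        then have "y $ k = 0" using yk by simp
        then have "y \<in> int_span B" using yG by (auto simp: B(3) G'_def)
        then show "\<exists>q :: int. x - of_int q *\<^sub>R b \<in> int_span B" unfolding y_def by blast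
      qed
      then show "x \<in> int_span (insert b B) \<longleftrightarrow> x \<in> G'" using int_span_insert[OF B(1) b_notin'] by blast
    qed
    moreover have "independent (insert b B)" using B(2) b_notin by (simp add: independent_insert)
    ultimately show ?case using B(1) by (intro exI[of _ "insert b B"]) (simp add: G'_def)
  qed
  from this[of UNIV] obtain B where B: "finite B" "independent B" "int_span B = G" by auto
  have "axis i 1 \<in> span B" for i
  proof -
    have "(1 / c) *\<^sub>R axis i c \<in> span B"
      using axes(2)[of i] B(3) int_span_subset_span[of B] by (intro span_scale) blast
    moreover have "(1 / c) *\<^sub>R axis i c = (axis i 1 :: real ^ 'n)"
      using axes(1) by (simp add: vec_eq_iff axis_def)
    ultimately show ?thesis by simp
  qed
  then have "Basis \<subseteq> span B" by (auto simp: Basis_vec_def)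
  then have "span B = UNIV" by (metis span_Basis span_mono span_span top.extremum_unique)
  then show ?thesis unfolding euclidean_lattice_def using B by blast
qed

definition half_vec :: "('n::finite \<Rightarrow> int) \<Rightarrow> real ^ 'n" where
  "half_vec u = (\<chi> i. of_int (u i) / 2)"

lemma inner_half_vec: "half_vec u \<bullet> half_vec v = of_int (dot u v) / 4"
  by (simp add: half_vec_def inner_vec_def dot_def sum_divide_distrib)

lemma norm_half_vec: "half_vec u \<bullet> half_vec u = of_nat (vnorm u) / 4"
  unfolding inner_half_vec by (simp flip: int_vnorm)

lemma half_vec_inject: "half_vec u = half_vec v \<longleftrightarrow> u = v"
  by (auto simp: half_vec_def vec_eq_iff fun_eq_iff)

lemma half_vec_diff: "half_vec u - half_vec v = half_vec (\<lambda>i. u i - v i)"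
  by (simp add: half_vec_def vec_eq_iff diff_divide_distrib)

lemma quarter_Ints_iff: "of_int k / 4 \<in> (\<int> :: real set) \<longleftrightarrow> 4 dvd k"
proof
  assume "of_int k / 4 \<in> (\<int> :: real set)"
  then obtain j where "of_int k / 4 = (of_int j :: real)" by (auto elim: Ints_cases)
  then have "(of_int k :: real) = of_int (4 * j)" by simp
  then have "k = 4 * j" by (simp only: of_int_eq_iff)
  then show "4 dvd k" by simp
qed auto

lemma half_vec_obtain:
  assumes "\<And>i. axis i 2 \<bullet> y \<in> \<int>"
  obtains v where "y = half_vec v"
proof -
  have "\<exists>k :: int. y $ i = of_int k / 2" for i
  proof -
    have "2 * y $ i \<in> \<int>" using assms[of i] by (simp add: inner_axis' mult.commute)
    then obtain k where "2 * y $ i = of_int k" by (auto elim: Ints_cases)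
    then show ?thesis by (intro exI[of _ k]) simp
  qed
  then obtain v where "\<And>i. y $ i = of_int (v i) / 2" by metis
  then have "y = half_vec v" by (simp add: half_vec_def vec_eq_iff)
  then show ?thesis by (rule that)
qed

lemma axis_eq_half_vec: "axis i 2 = half_vec (\<lambda>j. if j = i then 4 else 0)"
  by (simp add: half_vec_def axis_def vec_eq_iff)

context selfdual_code
begin

definition code_lattice :: "(real ^ 'n) set" where
  "code_lattice = half_vec ` U"

lemma half_vec_mem_code_lattice: "half_vec u \<in> code_lattice \<longleftrightarrow> u \<in> U"
  by (auto simp: code_lattice_def half_vec_inject)

lemma axis_mem_code_lattice: "axis i 2 \<in> code_lattice"
proof -
  have "(\<lambda>j. 4 * (if j = i then 1 else 0)) \<in> U" by (rule multiple_mem)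
  also have "(\<lambda>j. 4 * (if j = i then 1 else 0)) = (\<lambda>j. if j = i then 4 else 0 :: int)" by auto
  finally show ?thesis unfolding axis_eq_half_vec half_vec_mem_code_lattice .
qed

lemma even_norm_half_vec_iff: "even_norm (half_vec u) \<longleftrightarrow> 8 dvd dot u u"
proof -
  have "even_norm (half_vec u) \<longleftrightarrow> (\<exists>m. (of_int (dot u u) :: real) = of_int (8 * m))"
    unfolding even_norm_def inner_half_vec by (intro ex_cong1) auto
  then show ?thesis by (simp only: of_int_eq_iff dvd_def)
qed

lemma even_norm_iff_char:
  assumes "u \<in> U"
  shows "even_norm (half_vec u) \<longleftrightarrow> even (dot s u)"
  unfolding even_norm_half_vec_iff using characteristic[OF assms] by presburger

theorem code_lattice_unimodular: "unimodular_lattice code_lattice"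
proof -
  have "euclidean_lattice code_lattice"
  proof (rule discrete_subgroup_euclidean_lattice[where d = 2 and c = 2])
    show "0 \<in> code_lattice" using zero_mem half_vec_mem_code_lattice[of "\<lambda>_. 0"] by (simp add: half_vec_def zero_vec_def)
    show "x - y \<in> code_lattice" if "x \<in> code_lattice" "y \<in> code_lattice" for x y
      using that diff_mem by (auto simp: code_lattice_def half_vec_diff)
    show "\<exists>k :: int. x $ i = of_int k / 2" if "x \<in> code_lattice" for x :: "real ^ 'n" and i
      using that by (auto simp: code_lattice_def half_vec_def)
  qed (simp_all add: axis_mem_code_lattice)
  moreover have "dual_lattice code_lattice = code_lattice"
  proof (intro set_eqI iffI)
    fix y assume y: "y \<in> dual_lattice code_lattice"
    then have "axis i 2 \<bullet> y \<in> \<int>" for i using axis_mem_code_lattice unfolding dual_lattice_def by blast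
    then obtain v where v: "y = half_vec v" by (rule half_vec_obtain)
    have "4 dvd dot v u" if "u \<in> U" for u
    proof -
      have "half_vec u \<bullet> half_vec v \<in> \<int>" using y that by (simp add: dual_lattice_def v half_vec_mem_code_lattice)
      then show ?thesis by (simp add: inner_half_vec quarter_Ints_iff dot_commute)
    qed
    then show "y \<in> code_lattice" unfolding v half_vec_mem_code_lattice using selfdual by blast
  next
    fix y assume "y \<in> code_lattice"
    then show "y \<in> dual_lattice code_lattice"
      using dot_dvd by (auto simp: dual_lattice_def code_lattice_def inner_half_vec quarter_Ints_iff)
  qed
  ultimately show ?thesis by (simp add: unimodular_lattice_def)
qed

text \<open>
  A vector that has integral inner products with the even sublattice, of index 2, either has integral
  inner products with all of \<open>L\<close>, and then lies in \<open>L\<close>, or has with each vector of \<open>L\<close> an inner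
  product congruent modulo 1 to half its norm.  The latter vectors form \<open>s + L\<close>.
\<close>

theorem shadow_code_lattice:
  assumes odd: "\<exists>u\<in>U. odd (dot s u)"
  shows "shadow code_lattice = half_vec ` coset s"
proof -
  obtain w where w: "w \<in> U" "odd (dot s w)" using odd by blast
  have dual: "half_vec v \<in> dual_lattice (even_sublattice code_lattice) \<longleftrightarrow> (\<forall>u\<in>U. even (dot s u) \<longrightarrow> 4 dvd dot v u)" for v
    by (auto simp: dual_lattice_def even_sublattice_def code_lattice_def even_norm_iff_char inner_half_vec
        quarter_Ints_iff dot_commute)
  have coset_iff: "v \<in> coset s \<longleftrightarrow> (\<forall>u\<in>U. 4 dvd dot v u - 2 * dot s u)" for v
    unfolding coset_def mem_Collect_eq by (subst selfdual) (simp add: dot_diff_left dot_scale_left)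
  have "half_vec v \<in> shadow code_lattice \<longleftrightarrow> v \<in> coset s" for v
  proof
    assume "half_vec v \<in> shadow code_lattice"
    then have *: "\<forall>u\<in>U. even (dot s u) \<longrightarrow> 4 dvd dot v u" and "v \<notin> U"
      by (simp_all add: shadow_def dual half_vec_mem_code_lattice)
    have even: "4 dvd dot v u" if "u \<in> U" "even (dot s u)" for u
      using * that by blast
    have shift: "even (dot s (\<lambda>i. u i - w i))" "4 dvd dot v u - dot v w" if "u \<in> U" "odd (dot s u)" for u
    proof -
      show e: "even (dot s (\<lambda>i. u i - w i))"
        using that w by (simp add: dot_commute[of s] dot_diff_left)
      show "4 dvd dot v u - dot v w"
        using even[OF diff_mem[OF that(1) w(1)] e] by (simp add: dot_commute[of v] dot_diff_left)
    qed
    have "\<not> 4 dvd dot v w"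
    proof
      assume "4 dvd dot v w"
      then have "4 dvd dot v u" if "u \<in> U" for u
        using even[OF that] shift(2)[OF that] by presburger
      then show False using \<open>v \<notin> U\<close> selfdual by blast
    qed
    moreover have "even (dot v w)"
    proof -
      have "even (dot s (\<lambda>i. w i + w i))" unfolding dot_commute[of s] dot_add_left by simp
      then have "4 dvd dot v (\<lambda>i. w i + w i)" by (rule even[OF add_mem[OF w(1) w(1)]])
      then show ?thesis unfolding dot_commute[of v] dot_add_left by presburger
    qed
    ultimately have "4 dvd dot v u - 2 * dot s u" if "u \<in> U" for u
      using even[OF that] shift(2)[OF that] by presburger
    then show "v \<in> coset s" by (simp add: coset_iff)
  next
    assume "v \<in> coset s"
    then have v: "4 dvd dot v u - 2 * dot s u" if "u \<in> U" for u using that by (simp add: coset_iff)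
    have "4 dvd dot v u" if "u \<in> U" "even (dot s u)" for u
      using v[OF that(1)] that(2) by presburger
    moreover have "\<not> 4 dvd dot v w" using v[OF w(1)] w(2) by presburger
    then have "v \<notin> U" using dot_dvd w(1) by blast
    ultimately show "half_vec v \<in> shadow code_lattice" by (simp add: shadow_def dual half_vec_mem_code_lattice)
  qed
  moreover have "\<exists>v. y = half_vec v" if "y \<in> shadow code_lattice" for y
  proof -
    have "axis i 2 \<in> even_sublattice code_lattice" for i
      using axis_mem_code_lattice[of i] unfolding even_sublattice_def even_norm_def
      by (auto intro!: exI[of _ 2] simp: inner_axis')
    then have "axis i 2 \<bullet> y \<in> \<int>" for i using that by (auto simp: shadow_def dual_lattice_def)
    then show ?thesis by (metis half_vec_obtain)
  qed
  ultimately show ?thesis by blast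
qed

lemma card_norm_eq: "card {x \<in> half_vec ` A. x \<bullet> x = real n} = card {v \<in> A. vnorm v = 4 * n}"
proof -
  have "of_nat (vnorm v) / 4 = real n \<longleftrightarrow> vnorm v = 4 * n" for v :: "'n \<Rightarrow> int"
    by (simp add: field_simps flip: of_nat_eq_iff[where 'a = real])
  then have "{x \<in> half_vec ` A. x \<bullet> x = real n} = half_vec ` {v \<in> A. vnorm v = 4 * n}"
    by (auto simp: norm_half_vec)
  then show ?thesis by (simp add: card_image inj_on_def half_vec_inject)
qed

theorem extremal_code_lattice:
  assumes dim: "CARD('n) = 40"
    and min: "\<And>u. u \<in> U \<Longrightarrow> u \<noteq> (\<lambda>_. 0) \<Longrightarrow> 16 \<le> vnorm u"
    and odd: "\<exists>u\<in>U. odd (dot s u)"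
    and shadow8: "card {v \<in> coset s. vnorm v = 8} = m"
  shows "odd_unimodular code_lattice" "min_norm code_lattice = 4" "theta_series code_lattice = theta40 (int m)"
    "card {x \<in> shadow code_lattice. x \<bullet> x = 2} = m"
proof -
  obtain w where w: "w \<in> U" "odd (dot s w)" using odd by blast
  then have "\<not> even_norm (half_vec w)" by (simp add: even_norm_iff_char)
  then show "odd_unimodular code_lattice"
    using w(1) code_lattice_unimodular half_vec_mem_code_lattice by (auto simp: odd_unimodular_def even_unimodular_def)
  have zero: "(\<lambda>_. 0) \<notin> coset s"
  proof
    assume "(\<lambda>_. 0) \<in> coset s"
    then have "4 dvd dot (\<lambda>i. 0 - 2 * s i) w" using w(1) dot_dvd unfolding coset_def by blast
    moreover have "dot (\<lambda>i. 0 - 2 * s i) w = - (2 * dot s w)"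
      by (simp add: dot_def sum_distrib_left sum_negf mult.assoc)
    ultimately have "4 dvd 2 * dot s w" by simp
    then obtain k where "2 * dot s w = 4 * k" by (elim dvdE)
    then have "dot s w = 2 * k" by simp
    then show False using w(2) by simp
  qed
  have theta: "weighted_series U vnorm (\<lambda>_. 1) = theta40 (int m) oo fps_X ^ 4"
    by (rule theta_determined[OF dim min zero shadow8])
  show "theta_series code_lattice = theta40 (int m)"
  proof (rule fps_ext)
    fix n
    have "fps_nth (weighted_series U vnorm (\<lambda>_. 1)) (4 * n) = fps_nth (theta40 (int m)) n"
      unfolding theta by (simp add: fps_nth_compose_X_power)
    then show "fps_nth (theta_series code_lattice) n = fps_nth (theta40 (int m)) n"
      by (simp add: theta_series_def code_lattice_def card_norm_eq weighted_series_nth)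
  qed
  show "card {x \<in> shadow code_lattice. x \<bullet> x = 2} = m"
    using card_norm_eq[of "coset s" 2] shadow8 by (simp add: shadow_code_lattice[OF odd])
  show "min_norm code_lattice = 4"
    unfolding min_norm_def
  proof (rule cInf_eq_minimum)
    fix i :: 'n
    have "axis i 2 \<noteq> (0 :: real ^ 'n)" by (simp add: axis_eq_0_iff)
    moreover have "axis i (2 :: real) \<bullet> axis i 2 = 4" by (simp add: inner_axis')
    ultimately show "4 \<in> {x \<bullet> x |x. x \<in> code_lattice \<and> x \<noteq> 0}"
      using axis_mem_code_lattice[of i] by (metis (mono_tags, lifting) mem_Collect_eq)
  next
    fix r assume "r \<in> {x \<bullet> x |x. x \<in> code_lattice \<and> x \<noteq> 0}"
    then obtain u where u: "u \<in> U" "half_vec u \<noteq> 0" "r = half_vec u \<bullet> half_vec u"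
      by (auto simp: code_lattice_def)
    then have "u \<noteq> (\<lambda>_. 0)" by (auto simp: half_vec_def zero_vec_def)
    then have "16 \<le> vnorm u" using min u(1) by blast
    then show "4 \<le> r" by (simp add: u(3) norm_half_vec)
  qed
qed

end

section \<open>Codes modulo 4 from point sets\<close>

lemma norm_all_odd: "osupp w = UNIV \<Longrightarrow> 8 dvd dot w w - int CARD('n)" for w :: "'n::finite \<Rightarrow> int"
proof -
  assume "osupp w = UNIV"
  then have "8 dvd (\<Sum>i\<in>UNIV. (w i)\<^sup>2 - 1)" by (intro dvd_sum odd_square_mod_8) (auto simp: osupp_def)
  then show ?thesis by (simp add: dot_def sum_subtractf power2_eq_square)
qed

text \<open>
  The mixed terms occur twice and are divisible by 4, so the norm is additive modulo 8.
\<close>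

lemma norm_sum_mod_8:
  assumes "finite J" "\<And>j l. j \<in> J \<Longrightarrow> l \<in> J \<Longrightarrow> 4 dvd dot (g j) (g l)"
  shows "8 dvd dot (\<lambda>i. \<Sum>j\<in>J. g j i) (\<lambda>i. \<Sum>j\<in>J. g j i) - (\<Sum>j\<in>J. dot (g j) (g j))"
  using assms
proof (induction J rule: finite_induct)
  case (insert a J)
  let ?w = "\<lambda>i. \<Sum>j\<in>J. g j i"
  have "dot ?w (g a) = (\<Sum>j\<in>J. dot (g j) (g a))" by (rule dot_sum_left)
  then have "4 dvd dot ?w (g a)" using insert.prems by (auto intro!: dvd_sum)
  then have "8 dvd 2 * dot ?w (g a)" by presburger
  moreover have "dot (\<lambda>i. g a i + ?w i) (\<lambda>i. g a i + ?w i) = dot (g a) (g a) + 2 * dot ?w (g a) + dot ?w ?w"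
    unfolding dot_add_left dot_commute[of _ "\<lambda>i. g a i + ?w i"] by (simp add: dot_add_left dot_commute)
  moreover have "8 dvd dot ?w ?w - (\<Sum>j\<in>J. dot (g j) (g j))" using insert by blast
  ultimately show ?case using insert.hyps by simp
qed (simp add: dot_def)

lemma vnorm_2_iff:
  fixes w :: "'n::finite \<Rightarrow> int"
  shows "vnorm w = 2 \<longleftrightarrow> (\<exists>a b x y. a \<noteq> b \<and> x \<in> {1, - 1} \<and> y \<in> {1, - 1}
    \<and> w = (\<lambda>i. if i = a then x else if i = b then y else 0))"
proof
  assume *: "vnorm w = 2"
  have le: "sq (w i) \<le> 2" for i
    using member_le_sum[of i UNIV "\<lambda>i. sq (w i)"] * by (simp add: vnorm_def)
  have unit: "w i \<in> {- 1, 0, 1}" for i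
  proof -
    have "\<bar>w i\<bar> < 2"
    proof (rule ccontr)
      assume "\<not> \<bar>w i\<bar> < 2"
      then have "2 * 2 \<le> \<bar>w i\<bar> * \<bar>w i\<bar>" by (intro mult_mono) auto
      then show False using le[of i] by (simp add: sq_def power2_eq_square)
    qed
    then show ?thesis by auto
  qed
  have "sq (w i) = (if w i \<noteq> 0 then 1 else 0)" for i
    using unit[of i] by (auto simp: sq_def)
  then have "card {i. w i \<noteq> 0} = 2" using * by (simp add: vnorm_def sum.If_cases)
  then obtain a b where ab: "{i. w i \<noteq> 0} = {a, b}" "a \<noteq> b" by (auto simp: card_2_iff)
  have "w i = 0" if "i \<noteq> a" "i \<noteq> b" for i using ab(1) that by blast
  moreover have "w a \<noteq> 0" "w b \<noteq> 0" using ab(1) by blast+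
  ultimately show "\<exists>a b x y. a \<noteq> b \<and> x \<in> {1, - 1} \<and> y \<in> {1, - 1}
    \<and> w = (\<lambda>i. if i = a then x else if i = b then y else 0)"
    using ab(2) unit[of a] unit[of b]
    by (intro exI[of _ a] exI[of _ b] exI[of _ "w a"] exI[of _ "w b"]) auto
next
  assume "\<exists>a b x y. a \<noteq> b \<and> x \<in> {1, - 1} \<and> y \<in> {1, - 1}
    \<and> w = (\<lambda>i. if i = a then x else if i = b then y else 0)"
  then obtain a b x y where w: "a \<noteq> b" "x \<in> {1, - 1}" "y \<in> {1, - 1}"
    "w = (\<lambda>i. if i = a then x else if i = b then y else 0)" by blast
  then have "sq (w i) = (if i \<in> {a, b} then 1 else 0)" for i by (auto simp: sq_def)
  moreover have "{i. i = a \<or> i = b} = {a, b}" by auto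
  ultimately show "vnorm w = 2" using w(1) by (simp add: vnorm_def sum.If_cases)
qed

lemma card_osupp_le_vnorm: "card (osupp u) \<le> vnorm u" for u :: "'n::finite \<Rightarrow> int"
proof -
  have "of_bool (i \<in> osupp u) \<le> sq (u i)" for i
  proof (cases "i \<in> osupp u")
    case True
    then have "u i \<noteq> 0" by (auto simp: osupp_def)
    then have "0 < (u i)\<^sup>2" by simp
    then show ?thesis by (simp add: sq_def of_bool_def Suc_le_eq)
  qed simp
  then have "(\<Sum>i\<in>UNIV. of_bool (i \<in> osupp u)) \<le> vnorm u" unfolding vnorm_def by (intro sum_mono)
  then show ?thesis by simp
qed

lemma vnorm_double: "vnorm (\<lambda>i. 2 * w i) = 4 * vnorm w"
  by (simp add: vnorm_def sq_def power_mult_distrib nat_mult_distrib sum_distrib_left)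

text \<open>
  The coordinates are labelled by vectors of \<open>GF(2)^m\<close>, given as finite sets, of odd weight; these form
  the affine hyperplane on which the all-one functional is 1.  A subset \<open>J\<close> of \<open>{..<m}\<close> acts as a
  linear functional, and its values on the points form the word \<open>{i. odd (card (J \<inter> p i))}\<close>.  Since the unit
  vectors are among the points, the corresponding coordinates (the pivots) put the code of these words
  in systematic form.
\<close>

locale point_set =
  fixes p :: "'n::finite \<Rightarrow> nat set" and m :: nat and pivot :: "nat \<Rightarrow> 'n"
  assumes dim: "8 dvd CARD('n)" and m_pos: "0 < m"
    and points_subset: "p i \<subseteq> {..<m}"
    and points_odd: "odd (card (p i))"
    and points_inj: "inj p"
    and pivot: "j < m \<Longrightarrow> p (pivot j) = {j}"
    and weights: "J \<subseteq> {..<m} \<Longrightarrow> J \<noteq> {} \<Longrightarrow>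
      4 dvd card {i. odd (card (J \<inter> p i))} \<and> 16 \<le> card {i. odd (card (J \<inter> p i))}"
begin

lemma pivot_inj: "j < m \<Longrightarrow> l < m \<Longrightarrow> pivot j = pivot l \<longleftrightarrow> j = l"
  using pivot by (metis singleton_inject)

lemma finite_points: "finite (p i)"
  using points_subset finite_subset by blast

lemma odd_sum_generators:
  assumes "\<And>j i. j < m \<Longrightarrow> odd (g j i) \<longleftrightarrow> j \<in> p i" "J \<subseteq> {..<m}"
  shows "odd (\<Sum>j\<in>J. g j i :: int) \<longleftrightarrow> odd (card (J \<inter> p i))"
proof -
  have "finite J" using assms(2) finite_subset by blast
  moreover have "{j \<in> J. odd (g j i)} = J \<inter> p i" using assms by blast
  ultimately show ?thesis by (simp add: even_sum_iff)
qed

text \<open>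
  Lift the rows of the generator matrix by adding \<open>2 M j l\<close> at the pivots.  This changes
  \<open>(g j, g l)\<close> by \<open>2 (M j l + M l j)\<close> modulo 4 and \<open>(g j, g j)\<close> by 4 times the row sum of \<open>M\<close> modulo 8, if the
  diagonal of \<open>M\<close> is zero.  The symmetrisation of \<open>M\<close> is thus prescribed; its last column is still free
  (the last row compensates) to adjust the row sums, except that of the last row.  That one takes
  care of itself: the sum of all rows has odd coordinates only, so its norm is divisible by 8.
\<close>

lemma ex_selforthogonal_lift:
  assumes "\<sigma> \<subseteq> {..<m}" "even (card \<sigma>)"
  obtains g :: "nat \<Rightarrow> 'n \<Rightarrow> int" where "\<And>j i. j < m \<Longrightarrow> odd (g j i) \<longleftrightarrow> j \<in> p i"
    "\<And>j l. j < m \<Longrightarrow> l < m \<Longrightarrow> 4 dvd dot (g j) (g l)"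
    "\<And>j. j < m \<Longrightarrow> 8 dvd dot (g j) (g j) - 4 * of_bool (j \<in> \<sigma>)"
proof -
  define row where "row j = {i. j \<in> p i}" for j
  define \<rho> :: "nat \<Rightarrow> 'n \<Rightarrow> int" where "\<rho> j i = of_bool (i \<in> row j)" for j i
  define b where "b j l = card (row j \<inter> row l)" for j l
  have dot_\<rho>: "dot (\<rho> j) (\<rho> l) = int (b j l)" for j l
  proof -
    have "dot (\<rho> j) (\<rho> l) = (\<Sum>i\<in>UNIV. of_bool (i \<in> row j \<inter> row l))"
      unfolding dot_def \<rho>_def by (intro sum.cong) auto
    then show ?thesis by (simp add: b_def Int_def)
  qed
  have word1: "{i. odd (card ({j} \<inter> p i))} = row j" for j by (auto simp: row_def Int_insert_left)
  have four_row: "4 dvd card (row j)" if "j < m" for j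
    using weights[of "{j}"] that word1[of j] by simp
  have b_even: "even (b j l)" if "j < m" "l < m" "j \<noteq> l" for j l
  proof -
    have "{i. odd (card ({j, l} \<inter> p i))} = sym_diff (row j) (row l)"
      using that(3) by (auto simp: row_def Int_insert_left)
    then have "4 dvd card (sym_diff (row j) (row l))" using weights[of "{j, l}"] that by simp
    moreover have "card (sym_diff (row j) (row l)) + 2 * b j l = card (row j) + card (row l)"
    proof -
      have "card (row j) = card (row j - row l) + b j l" "card (row l) = card (row l - row j) + b j l"
        unfolding b_def by (simp_all add: card_Diff_subset_Int card_mono Int_commute)
      moreover have "card (sym_diff (row j) (row l)) = card (row j - row l) + card (row l - row j)"
        by (rule card_Un_disjoint) auto
      ultimately show ?thesis by simp
    qed
    ultimately show ?thesis using four_row[OF that(1)] four_row[OF that(2)] by presburger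
  qed
  define t where "t = m - 1"
  have t: "t < m" "\<And>j. j < m \<longleftrightarrow> j < t \<or> j = t" using m_pos by (auto simp: t_def)
  \<comment> \<open>All but the last row and column: the prescribed symmetrisation is put above the diagonal.\<close>
  define M0 where "M0 j l = (if j < l then int (b j l) div 2 else 0)" for j l
  \<comment> \<open>The last column, chosen to give row \<open>j\<close> of the lift the norm required by \<open>\<sigma>\<close>.\<close>
  define K where "K j = int (card (row j)) div 4 + of_bool (j \<in> \<sigma>) + (\<Sum>l<t. M0 j l)" for j
  define M where "M j l = (if j < t \<and> l < t then M0 j l else if j < t then K j
      else if l < t then int (b j l) div 2 - K l else 0)" for j l
  define e :: "nat \<Rightarrow> 'n \<Rightarrow> int" where "e j i = (\<Sum>l<m. if i = pivot l then M j l else 0)" for j i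
  define g where "g j i = \<rho> j i + 2 * e j i" for j i
  have dot_e: "dot (e j) v = (\<Sum>l<m. M j l * v (pivot l))" for j v
    unfolding e_def dot_sum_left dot_indicator ..
  have \<rho>_pivot: "\<rho> j (pivot l) = of_bool (j = l)" if "l < m" for j l
    using pivot[OF that] by (simp add: \<rho>_def row_def)
  have e_pivot: "e j (pivot l) = M j l" if "l < m" for j l
  proof -
    have "e j (pivot l) = (\<Sum>n<m. if n = l then M j n else 0)"
      unfolding e_def using pivot_inj that by (intro sum.cong) auto
    then show ?thesis using that by simp
  qed
  have dot_e_\<rho>: "dot (e j) (\<rho> l) = M j l" if "l < m" for j l
  proof -
    have "dot (e j) (\<rho> l) = (\<Sum>n<m. if n = l then M j n else 0)"
      unfolding dot_e using \<rho>_pivot by (intro sum.cong) auto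
    then show ?thesis using that by simp
  qed
  have dot_e_e: "dot (e j) (e l) = (\<Sum>n<m. M j n * M l n)" for j l
    unfolding dot_e using e_pivot by (intro sum.cong) auto
  have dot_g: "dot (g j) (g l) = int (b j l) + 2 * (M j l + M l j) + 4 * dot (e j) (e l)" if "j < m" "l < m" for j l
  proof -
    have "dot (g j) (g l) = dot (\<rho> j) (\<rho> l) + 2 * dot (e j) (\<rho> l) + 2 * dot (e l) (\<rho> j) + 4 * dot (e j) (e l)"
      unfolding g_def dot_add_left dot_scale_left dot_commute[of _ "\<lambda>i. \<rho> l i + 2 * e l i"]
      by (simp add: dot_commute)
    then show ?thesis using dot_e_\<rho> that by (simp add: dot_\<rho>)
  qed
  have odd_g: "odd (g j i) \<longleftrightarrow> j \<in> p i" for j i by (simp add: g_def \<rho>_def row_def)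
  have M_sum: "M j l + M l j = int (b j l) div 2" if "j < m" "l < m" "j \<noteq> l" for j l
    using that unfolding t(2) by (auto simp: M_def M0_def b_def Int_commute)
  have M_diag: "M j j = 0" if "j < m" for j using that unfolding t(2) by (auto simp: M_def M0_def)
  have b_diag: "b j j = card (row j)" for j by (simp add: b_def)
  have orth: "4 dvd dot (g j) (g l)" if "j < m" "l < m" for j l
  proof (cases "j = l")
    case True
    have "4 dvd int (card (row j))" using four_row[OF that(1)] by presburger
    then show ?thesis unfolding dot_g[OF that] using M_diag[OF that(1)] True by (simp add: b_diag)
  next
    case False
    then have "int (b j l) + 2 * (M j l + M l j) = 4 * (int (b j l) div 2)"
      using b_even[OF that False] M_sum[OF that False] by auto
    then show ?thesis unfolding dot_g[OF that] by simp
  qed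
  have norm_t: "8 dvd dot (g j) (g j) - 4 * of_bool (j \<in> \<sigma>)" if "j < t" for j
  proof -
    have j: "j < m" using that t by blast
    have "even ((\<Sum>l<m. M j l * M j l) - (\<Sum>l<m. M j l))"
      unfolding sum_subtractf[symmetric] by (rule dvd_sum) auto
    moreover have "(\<Sum>l<m. M j l) = (\<Sum>l<t. M0 j l) + K j"
    proof -
      have "m = Suc t" using m_pos by (simp add: t_def)
      then show ?thesis using that by (simp add: M_def)
    qed
    moreover have "even ((\<Sum>l<t. M0 j l) + K j - (int (card (row j)) div 4 + of_bool (j \<in> \<sigma>)))"
      by (simp add: K_def)
    ultimately have "even (dot (e j) (e j) - (int (card (row j)) div 4 + of_bool (j \<in> \<sigma>)))"
      unfolding dot_e_e by presburger
    moreover obtain q where "card (row j) = 4 * q" using four_row[OF j] by blast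
    ultimately show ?thesis
      unfolding dot_g[OF j j] M_diag[OF j] b_diag by (cases "j \<in> \<sigma>") (simp_all, presburger+)
  qed
  have norm: "8 dvd dot (g j) (g j) - 4 * of_bool (j \<in> \<sigma>)" if "j < m" for j
  proof (cases "j < t")
    case False
    then have j: "j = t" using that t by blast
    let ?w = "\<lambda>i. \<Sum>j<m. g j i"
    have "odd (?w i)" for i
    proof -
      have "{..<m} \<inter> p i = p i" using points_subset by blast
      then show ?thesis using odd_sum_generators[OF odd_g, of "{..<m}" i] points_odd by simp
    qed
    then have "osupp ?w = UNIV" by (simp add: osupp_def)
    then have "8 dvd dot ?w ?w - int CARD('n)" by (rule norm_all_odd)
    moreover have "8 dvd int CARD('n)" using dim by presburger
    moreover have "8 dvd dot ?w ?w - (\<Sum>j<m. dot (g j) (g j))"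
      by (rule norm_sum_mod_8) (use orth in auto)
    ultimately have "8 dvd (\<Sum>j<m. dot (g j) (g j))" by presburger
    moreover have "8 dvd (\<Sum>j<t. dot (g j) (g j) - 4 * of_bool (j \<in> \<sigma>))"
      by (rule dvd_sum) (use norm_t in auto)
    moreover have "m = Suc t" using m_pos by (simp add: t_def)
    ultimately have *: "8 dvd dot (g t) (g t) + 4 * (\<Sum>j<t. of_bool (j \<in> \<sigma>))"
      by (simp add: sum_subtractf sum_distrib_left) presburger
    have "(\<Sum>j<t. of_bool (j \<in> \<sigma>)) + of_bool (t \<in> \<sigma>) = (\<Sum>j<m. of_bool (j \<in> \<sigma>) :: int)"
      using \<open>m = Suc t\<close> by simp
    also have "\<dots> = int (card \<sigma>)"
      using assms(1) by (simp add: Int_absorb1 Int_absorb2)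
    finally have "even ((\<Sum>j<t. of_bool (j \<in> \<sigma>)) + of_bool (t \<in> \<sigma>) :: int)" using assms(2) by simp
    then show ?thesis unfolding j using * by presburger
  qed (rule norm_t)
  show ?thesis by (rule that[OF odd_g orth norm])
qed


definition code :: "(nat \<Rightarrow> 'n \<Rightarrow> int) \<Rightarrow> ('n \<Rightarrow> int) set" where
  "code g = {u. (\<exists>c. \<forall>i. even (u i - (\<Sum>j<m. c j * g j i))) \<and> (\<forall>j<m. 4 dvd dot u (g j))}"

definition shadow_vector :: "nat set \<Rightarrow> 'n \<Rightarrow> int" where
  "shadow_vector \<sigma> i = (\<Sum>j\<in>\<sigma>. if i = pivot j then 1 else 0)"

lemma dot_shadow_vector: "dot (shadow_vector \<sigma>) u = (\<Sum>j\<in>\<sigma>. u (pivot j))"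
  unfolding shadow_vector_def dot_sum_left dot_indicator by simp

definition parity_support :: "('n \<Rightarrow> int) \<Rightarrow> nat set" where
  "parity_support u = {j. j < m \<and> odd (u (pivot j))}"

end

text \<open>
  The generators \<open>g\<close> are those provided by \<open>ex_selforthogonal_lift\<close>.
\<close>

locale lifted_point_set = point_set p m pivot
  for p :: "'n::finite \<Rightarrow> nat set" and m pivot +
  fixes g :: "nat \<Rightarrow> 'n \<Rightarrow> int" and \<sigma> :: "nat set"
  assumes odd_g: "\<And>j i. j < m \<Longrightarrow> odd (g j i) \<longleftrightarrow> j \<in> p i"
    and orth: "\<And>j l. j < m \<Longrightarrow> l < m \<Longrightarrow> 4 dvd dot (g j) (g l)"
    and norm_g: "\<And>j. j < m \<Longrightarrow> 8 dvd dot (g j) (g j) - 4 * of_bool (j \<in> \<sigma>)"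
    and sigma: "\<sigma> \<subseteq> {..<m}" "\<sigma> \<noteq> {}"
begin

lemma pair_even_iff:
  assumes "a \<noteq> b" "x \<in> {1, - 1}" "y \<in> {1, - 1}" "t = (\<lambda>i. if i = a then x else if i = b then y else 0)"
    and "j < m"
  shows "even (dot t (g j)) \<longleftrightarrow> (j \<in> p a \<longleftrightarrow> j \<in> p b)"
proof -
  have t: "t = (\<lambda>i. (if i = a then x else 0) + (if i = b then y else 0))" using assms(1,4) by auto
  have "dot t (g j) = x * g j a + y * g j b" unfolding t dot_add_left dot_indicator ..
  moreover have "odd x" "odd y" using assms(2,3) by auto
  ultimately have "even (dot t (g j)) \<longleftrightarrow> (even (g j a) \<longleftrightarrow> even (g j b))" by simp
  then show ?thesis using odd_g[OF assms(5), of a] odd_g[OF assms(5), of b] by blast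
qed

lemma double_mem_code_iff: "(\<lambda>i. 2 * t i) \<in> code g \<longleftrightarrow> (\<forall>j<m. even (dot t (g j)))"
proof -
  have "4 dvd 2 * k \<longleftrightarrow> even k" for k :: int by presburger
  then show ?thesis
    unfolding code_def by (auto simp: dot_scale_left intro!: exI[of _ "\<lambda>_. 0"])
qed

lemma generator_mem_code: "J \<subseteq> {..<m} \<Longrightarrow> (\<lambda>i. \<Sum>j\<in>J. g j i) \<in> code g"
proof -
  assume J: "J \<subseteq> {..<m}"
  have "(\<Sum>j<m. of_bool (j \<in> J) * g j i) = (\<Sum>j\<in>J. g j i)" for i
    using J by (intro sum.mono_neutral_cong_right) auto
  moreover have "4 dvd dot (\<lambda>i. \<Sum>j\<in>J. g j i) (g l)" if "l < m" for l
    unfolding dot_sum_left using J orth that by (intro dvd_sum) auto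
  ultimately show ?thesis unfolding code_def
    by (auto intro!: exI[of _ "\<lambda>j. of_bool (j \<in> J)"])
qed

lemma code_mod_2:
  assumes "u \<in> code g"
  shows "odd (u i) \<longleftrightarrow> odd (card (parity_support u \<inter> p i))"
    and "even (u i - (\<Sum>j\<in>parity_support u. g j i))"
proof -
  obtain c where c: "\<And>i. even (u i - (\<Sum>j<m. c j * g j i))" using assms unfolding code_def by blast
  have parity: "odd (\<Sum>j<m. c j * g j i) \<longleftrightarrow> odd (card {j. j < m \<and> odd (c j) \<and> j \<in> p i})" for i
  proof -
    have "{j \<in> {..<m}. odd (c j * g j i)} = {j. j < m \<and> odd (c j) \<and> j \<in> p i}" using odd_g by auto
    then show ?thesis by (simp add: even_sum_iff)
  qed
  have "odd (u (pivot l)) \<longleftrightarrow> odd (c l)" if "l < m" for l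
  proof -
    have "{j. j < m \<and> odd (c j) \<and> j \<in> p (pivot l)} = (if odd (c l) then {l} else {})"
      using pivot[OF that] that by auto
    then have "odd (\<Sum>j<m. c j * g j (pivot l)) \<longleftrightarrow> odd (c l)" unfolding parity by simp
    then show ?thesis using c[of "pivot l"] by presburger
  qed
  then have "{j. j < m \<and> odd (c j) \<and> j \<in> p i} = parity_support u \<inter> p i"
    by (auto simp: parity_support_def)
  then show *: "odd (u i) \<longleftrightarrow> odd (card (parity_support u \<inter> p i))"
    using c[of i] parity[of i] by presburger
  have "parity_support u \<subseteq> {..<m}" by (auto simp: parity_support_def)
  then show "even (u i - (\<Sum>j\<in>parity_support u. g j i))"
    using * odd_sum_generators[OF odd_g, of "parity_support u" i] by simp
qed

lemma code_decompose:
  assumes "u \<in> code g"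
  obtains t where "u = (\<lambda>i. (\<Sum>j\<in>parity_support u. g j i) + 2 * t i)" "\<And>j. j < m \<Longrightarrow> even (dot t (g j))"
proof -
  let ?w = "\<lambda>i. \<Sum>j\<in>parity_support u. g j i"
  define t where "t i = (u i - ?w i) div 2" for i
  have u: "u = (\<lambda>i. ?w i + 2 * t i)" using code_mod_2(2)[OF assms] by (simp add: t_def fun_eq_iff)
  have "even (dot t (g j))" if "j < m" for j
  proof -
    have "4 dvd dot u (g j)" using assms that by (simp add: code_def)
    moreover have "dot u (g j) = dot ?w (g j) + 2 * dot t (g j)"
      by (subst u) (simp only: dot_add_left dot_scale_left)
    moreover have "?w \<in> code g" by (rule generator_mem_code) (auto simp: parity_support_def)
    then have "4 dvd dot ?w (g j)" using that by (simp add: code_def)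
    ultimately show ?thesis by presburger
  qed
  with u show ?thesis by (rule that)
qed

text \<open>
  Testing a vector of the dual against \<open>2 (e\<^sub>i - \<Sum>j\<in>p i. e\<^sub>(pivot j))\<close> shows that, modulo 2, its coordinate
  \<open>i\<close> is determined by the pivots as in a word of the code.
\<close>

lemma code_selfdual: "u \<in> code g \<longleftrightarrow> (\<forall>v\<in>code g. 4 dvd dot u v)"
proof
  assume u: "u \<in> code g"
  show "\<forall>v\<in>code g. 4 dvd dot u v"
  proof
    fix v assume v: "v \<in> code g"
    obtain t where t: "v = (\<lambda>i. (\<Sum>j\<in>parity_support v. g j i) + 2 * t i)" "\<And>j. j < m \<Longrightarrow> even (dot t (g j))"
      using code_decompose[OF v] by blast
    obtain r where r: "u = (\<lambda>i. (\<Sum>j\<in>parity_support u. g j i) + 2 * r i)"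
      using u by (rule code_decompose)
    have "dot v u = (\<Sum>j\<in>parity_support v. dot (g j) u) + 2 * dot t u"
      by (subst t(1)) (simp only: dot_add_left dot_scale_left dot_sum_left)
    moreover have "4 dvd (\<Sum>j\<in>parity_support v. dot (g j) u)"
      using u by (intro dvd_sum) (auto simp: parity_support_def code_def dot_commute)
    moreover have "even (dot t u)"
    proof -
      have "dot u t = (\<Sum>j\<in>parity_support u. dot (g j) t) + 2 * dot r t"
        by (subst r) (simp only: dot_add_left dot_scale_left dot_sum_left)
      moreover have "even (\<Sum>j\<in>parity_support u. dot (g j) t)"
        using t(2) by (intro dvd_sum) (auto simp: parity_support_def dot_commute)
      ultimately show ?thesis by (simp add: dot_commute)
    qed
    ultimately have "4 dvd dot v u" by presburger
    then show "4 dvd dot u v" by (simp add: dot_commute)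
  qed
next
  assume *: "\<forall>v\<in>code g. 4 dvd dot u v"
  have "4 dvd dot u (g j)" if "j < m" for j
  proof -
    have "(\<lambda>i. \<Sum>j\<in>{j}. g j i) \<in> code g" by (rule generator_mem_code) (use that in auto)
    then show ?thesis using * by simp
  qed
  moreover have "even (u i - (\<Sum>j<m. u (pivot j) * g j i))" for i
  proof -
    \<comment> \<open>Even against all generators, since the points sum to zero: \<open>p i\<close> is the sum of its unit vectors.\<close>
    define t :: "'n \<Rightarrow> int" where "t k = (if k = i then 1 else 0) - (\<Sum>j\<in>p i. if k = pivot j then 1 else 0)" for k
    have dot_t: "dot t v = v i - (\<Sum>j\<in>p i. v (pivot j))" for v
      unfolding t_def dot_diff_left dot_sum_left dot_indicator by simp
    have "even (dot t (g l))" if l: "l < m" for l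
    proof -
      have "{j \<in> p i. odd (g l (pivot j))} = p i \<inter> {l}"
        using points_subset[of i] odd_g[OF l] pivot by auto
      then have "odd (\<Sum>j\<in>p i. g l (pivot j)) \<longleftrightarrow> l \<in> p i"
        using finite_points[of i] by (simp add: even_sum_iff Int_insert_right)
      then show ?thesis using odd_g[OF l, of i] unfolding dot_t even_diff even_add by blast
    qed
    then have "4 dvd dot u (\<lambda>k. 2 * t k)" using * double_mem_code_iff by blast
    then have "4 dvd 2 * dot t u" unfolding dot_commute[of u] dot_scale_left .
    then have "even (dot t u)" by presburger
    then have "even (u i - (\<Sum>j\<in>p i. u (pivot j)))" by (simp only: dot_t)
    moreover have "even ((\<Sum>j\<in>p i. u (pivot j)) - (\<Sum>j<m. u (pivot j) * g j i))"
    proof -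
      have "(\<Sum>j\<in>p i. u (pivot j)) = (\<Sum>j<m. if j \<in> p i then u (pivot j) else 0)"
        using points_subset[of i] by (intro sum.mono_neutral_cong_left) auto
      then have "(\<Sum>j\<in>p i. u (pivot j)) - (\<Sum>j<m. u (pivot j) * g j i)
          = (\<Sum>j<m. (if j \<in> p i then u (pivot j) else 0) - u (pivot j) * g j i)"
        by (simp add: sum_subtractf)
      also have "even \<dots>" using odd_g by (intro dvd_sum) auto
      finally show ?thesis .
    qed
    ultimately show ?thesis by presburger
  qed
  ultimately show "u \<in> code g"
    unfolding code_def mem_Collect_eq by (intro conjI exI[of _ "\<lambda>j. u (pivot j)"]) auto
qed

lemma code_all_odd: "osupp (\<lambda>i. \<Sum>j<m. g j i) = UNIV"
proof -
  have "{..<m} \<inter> p i = p i" for i using points_subset by blast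
  then show ?thesis using odd_sum_generators[OF odd_g, of "{..<m}"] points_odd by (auto simp: osupp_def)
qed

lemma code_characteristic:
  assumes "u \<in> code g"
  shows "8 dvd dot u u - 4 * dot (shadow_vector \<sigma>) u"
proof -
  let ?J = "parity_support u"
  let ?w = "\<lambda>i. \<Sum>j\<in>?J. g j i"
  have J: "?J \<subseteq> {..<m}" "finite ?J" by (auto simp: parity_support_def)
  obtain t where t: "u = (\<lambda>i. ?w i + 2 * t i)" "\<And>j. j < m \<Longrightarrow> even (dot t (g j))"
    using code_decompose[OF assms] by blast
  have norm_u: "dot u u = dot ?w ?w + 4 * dot ?w t + 4 * dot t t"
  proof -
    have "dot u u = dot (\<lambda>i. ?w i + 2 * t i) (\<lambda>i. ?w i + 2 * t i)" using t(1) by simp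
    also have "\<dots> = dot ?w ?w + 4 * dot ?w t + 4 * dot t t"
      unfolding dot_add_left dot_scale_left dot_commute[of _ "\<lambda>i. ?w i + 2 * t i"]
      by (simp add: dot_commute)
    finally show ?thesis .
  qed
  have "even (dot ?w t)"
    unfolding dot_sum_left using t(2) J by (intro dvd_sum) (auto simp: dot_commute)
  moreover have "even (dot t t)"
  proof -
    have "dot t (\<lambda>i. \<Sum>j<m. g j i) = (\<Sum>j<m. dot t (g j))"
      by (subst dot_commute) (simp only: dot_sum_left dot_commute)
    also have "even \<dots>" using t(2) by (intro dvd_sum) auto
    finally have "even (\<Sum>i\<in>UNIV. t i)" unfolding even_dot_iff code_all_odd .
    moreover have "even (dot t t - (\<Sum>i\<in>UNIV. t i))"
      unfolding dot_def sum_subtractf[symmetric] by (intro dvd_sum) auto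
    ultimately show ?thesis by presburger
  qed
  moreover have "8 dvd dot ?w ?w - (\<Sum>j\<in>?J. dot (g j) (g j))"
    using J orth by (intro norm_sum_mod_8) auto
  moreover have "8 dvd (\<Sum>j\<in>?J. dot (g j) (g j) - 4 * of_bool (j \<in> \<sigma>))"
    using J norm_g by (intro dvd_sum) blast
  then have "8 dvd (\<Sum>j\<in>?J. dot (g j) (g j)) - 4 * int (card (?J \<inter> \<sigma>))"
    using J(2) by (simp add: sum_subtractf Int_def flip: sum_distrib_left)
  moreover have "even (dot (shadow_vector \<sigma>) u - int (card (?J \<inter> \<sigma>)))"
  proof -
    have "finite \<sigma>" using sigma(1) finite_subset by blast
    moreover have "{j \<in> \<sigma>. odd (u (pivot j))} = ?J \<inter> \<sigma>" using sigma(1) by (auto simp: parity_support_def)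
    ultimately show ?thesis by (simp add: dot_shadow_vector even_sum_iff)
  qed
  ultimately show ?thesis unfolding norm_u by presburger
qed

sublocale code: selfdual_code "code g" "shadow_vector \<sigma>"
proof
  show "\<exists>u\<in>code g. osupp u = UNIV"
    using code_all_odd generator_mem_code[of "{..<m}"] by blast
qed (rule code_selfdual, rule code_characteristic)

lemma osupp_code_large:
  assumes "u \<in> code g" "parity_support u \<noteq> {}"
  shows "16 \<le> card (osupp u)"
proof -
  have "osupp u = {i. odd (card (parity_support u \<inter> p i))}"
    using code_mod_2(1)[OF assms(1)] by (auto simp: osupp_def)
  then show ?thesis using weights[of "parity_support u"] assms(2) by (auto simp: parity_support_def)
qed

lemma code_even:
  assumes "u \<in> code g" "parity_support u = {}"
  obtains t where "u = (\<lambda>i. 2 * t i)" "\<And>j. j < m \<Longrightarrow> even (dot t (g j))"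
  using code_decompose[OF assms(1)] assms(2) by auto

text \<open>
  A vector with odd coordinates has at least 16 of them.  Otherwise it is \<open>2 t\<close> with
  \<open>t\<close> of even norm, and norm 2 would mean that two points agree.
\<close>

lemma code_min_norm:
  assumes "u \<in> code g" "u \<noteq> (\<lambda>_. 0)"
  shows "16 \<le> vnorm u"
proof (cases "parity_support u = {}")
  case False
  then show ?thesis using osupp_code_large[OF assms(1)] card_osupp_le_vnorm[of u] by simp
next
  case True
  obtain t where t: "u = (\<lambda>i. 2 * t i)" "\<And>j. j < m \<Longrightarrow> even (dot t (g j))"
    using code_even[OF assms(1) True] by blast
  have "t \<noteq> (\<lambda>_. 0)" using assms(2) t(1) by auto
  then obtain i where "t i \<noteq> 0" by auto
  then have "0 < sq (t i)" by (simp add: sq_def)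
  then have pos: "0 < vnorm t" unfolding vnorm_def by (intro sum_pos2[of _ i]) simp_all
  have "even (vnorm t)"
  proof -
    have "dot t (\<lambda>i. \<Sum>j<m. g j i) = (\<Sum>j<m. dot t (g j))"
      by (subst dot_commute) (simp only: dot_sum_left dot_commute)
    also have "even \<dots>" using t(2) by (intro dvd_sum) auto
    finally have "even (\<Sum>i\<in>UNIV. t i)" unfolding even_dot_iff code_all_odd .
    moreover have "even (dot t t - (\<Sum>i\<in>UNIV. t i))"
      unfolding dot_def sum_subtractf[symmetric] by (intro dvd_sum) auto
    ultimately have "even (int (vnorm t))" unfolding int_vnorm by presburger
    then show ?thesis by simp
  qed
  moreover have "vnorm t \<noteq> 2"
  proof
    assume "vnorm t = 2"
    then obtain a b x y where ab: "a \<noteq> b" "x \<in> {1, - 1}" "y \<in> {1, - 1}"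
      "t = (\<lambda>i. if i = a then x else if i = b then y else 0)" unfolding vnorm_2_iff by blast
    have "j \<in> p a \<longleftrightarrow> j \<in> p b" if "j < m" for j
      using t(2)[OF that] pair_even_iff[OF ab that] by blast
    then have "p a = p b" using points_subset by blast
    then show False using ab(1) points_inj by (simp add: inj_eq)
  qed
  ultimately have "4 \<le> vnorm t" using pos by (elim evenE) simp
  then show ?thesis unfolding t(1) vnorm_double by simp
qed


lemma dot_shadow_generator: "l < m \<Longrightarrow> odd (dot (shadow_vector \<sigma>) (g l)) \<longleftrightarrow> l \<in> \<sigma>"
proof -
  assume l: "l < m"
  have "finite \<sigma>" using sigma(1) finite_subset by blast
  moreover have "{j \<in> \<sigma>. odd (g l (pivot j))} = \<sigma> \<inter> {l}"
    using sigma(1) odd_g[OF l] pivot by auto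
  ultimately show ?thesis by (simp add: dot_shadow_vector even_sum_iff Int_insert_right)
qed

text \<open>
  The vectors of norm 2 in the shadow.  The code describes the lattice scaled by 2, where they have
  norm 8 and are twice these vectors.
\<close>

definition half_shadow :: "('n \<Rightarrow> int) set" where
  "half_shadow = {w. vnorm w = 2 \<and> (\<forall>j<m. even (dot w (g j)) \<longleftrightarrow> j \<notin> \<sigma>)}"

lemma shadow_norm_8: "{v \<in> code.coset (shadow_vector \<sigma>). vnorm v = 8} = (\<lambda>w i. 2 * w i) ` half_shadow"
proof (intro set_eqI iffI)
  let ?s = "shadow_vector \<sigma>"
  fix v assume "v \<in> {v \<in> code.coset ?s. vnorm v = 8}"
  then have v: "(\<lambda>i. v i - 2 * ?s i) \<in> code g" "vnorm v = 8" by (simp_all add: code.coset_def)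
  have "osupp (\<lambda>i. v i - 2 * ?s i) = osupp v" by (simp add: osupp_def)
  then have "parity_support (\<lambda>i. v i - 2 * ?s i) = {}"
    using osupp_code_large[OF v(1)] card_osupp_le_vnorm[of v] v(2) by fastforce
  then obtain t where t: "(\<lambda>i. v i - 2 * ?s i) = (\<lambda>i. 2 * t i)" "\<And>j. j < m \<Longrightarrow> even (dot t (g j))"
    using code_even[OF v(1)] by blast
  define w where "w i = t i + ?s i" for i
  have vw: "v = (\<lambda>i. 2 * w i)"
  proof
    fix i
    have "v i - 2 * ?s i = 2 * t i" using t(1) by (rule fun_cong)
    then show "v i = 2 * w i" by (simp add: w_def)
  qed
  have "even (dot w (g j)) \<longleftrightarrow> j \<notin> \<sigma>" if "j < m" for j
    using t(2)[OF that] dot_shadow_generator[OF that] unfolding w_def dot_add_left by auto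
  moreover have "vnorm w = 2" using v(2) unfolding vw vnorm_double by simp
  ultimately show "v \<in> (\<lambda>w i. 2 * w i) ` half_shadow" unfolding vw half_shadow_def by blast
next
  let ?s = "shadow_vector \<sigma>"
  fix v assume "v \<in> (\<lambda>w i. 2 * w i) ` half_shadow"
  then obtain w where w: "v = (\<lambda>i. 2 * w i)" "vnorm w = 2" "\<And>j. j < m \<Longrightarrow> even (dot w (g j)) \<longleftrightarrow> j \<notin> \<sigma>"
    unfolding half_shadow_def by blast
  have "even (dot (\<lambda>i. w i - ?s i) (g j))" if "j < m" for j
    using w(3)[OF that] dot_shadow_generator[OF that] unfolding dot_diff_left by auto
  then have "(\<lambda>i. 2 * (w i - ?s i)) \<in> code g" by (simp only: double_mem_code_iff) simp
  then show "v \<in> {v \<in> code.coset ?s. vnorm v = 8}"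
    unfolding code.coset_def mem_Collect_eq w(1) vnorm_double w(2) by (simp add: algebra_simps)
qed

text \<open>
  Double counting of the pairs \<open>(w, a)\<close> with \<open>w a \<noteq> 0\<close>: there are two for each vector, and four choices of
  signs for each ordered pair of points differing by \<open>\<sigma>\<close>.
\<close>

lemma card_half_shadow: "card half_shadow = 2 * card {a. sym_diff (p a) \<sigma> \<in> range p}"
proof -
  let ?O = "{(a, b). sym_diff (p a) (p b) = \<sigma>}" and ?S = "{1, - 1 :: int}"
  let ?T = "SIGMA w:half_shadow. {a. w a \<noteq> 0}"
  let ?pair = "\<lambda>a b x y i. if i = a then x else if i = b then y else 0 :: int"
  let ?F = "\<lambda>((a, b), x, y). (?pair a b x y, a)"
  have cond: "(\<forall>j<m. even (dot (?pair a b x y) (g j)) \<longleftrightarrow> j \<notin> \<sigma>) \<longleftrightarrow> sym_diff (p a) (p b) = \<sigma>"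
    if "a \<noteq> b" "x \<in> ?S" "y \<in> ?S" for a b x y
  proof -
    have "(\<forall>j<m. even (dot (?pair a b x y) (g j)) \<longleftrightarrow> j \<notin> \<sigma>)
        \<longleftrightarrow> (\<forall>j<m. (j \<in> p a \<longleftrightarrow> j \<in> p b) \<longleftrightarrow> j \<notin> \<sigma>)"
      using pair_even_iff[OF that refl] by blast
    also have "\<dots> \<longleftrightarrow> sym_diff (p a) (p b) = \<sigma>"
      using points_subset[of a] points_subset[of b] sigma(1) by blast
    finally show ?thesis .
  qed
  have neq: "a \<noteq> b" if "sym_diff (p a) (p b) = \<sigma>" for a b using that sigma(2) by auto
  have inj: "inj_on ?F (?O \<times> ?S \<times> ?S)"
  proof (rule inj_onI)
    fix P Q assume P: "P \<in> ?O \<times> ?S \<times> ?S" and Q: "Q \<in> ?O \<times> ?S \<times> ?S" and eq: "?F P = ?F Q"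
    obtain a b x y where P': "P = ((a, b), x, y)" by (metis surj_pair)
    obtain a' b' x' y' where Q': "Q = ((a', b'), x', y')" by (metis surj_pair)
    have ne: "a \<noteq> b" "a' \<noteq> b'" "y \<noteq> 0" "x \<noteq> 0" using P Q neq unfolding P' Q' by auto
    have pe: "(?pair a b x y, a) = (?pair a' b' x' y', a')" using eq unfolding P' Q' by (simp only: prod.case)
    then have f: "?pair a b x y = ?pair a' b' x' y'" by (rule Pair_inject)
    from pe have "a = a'" by (rule Pair_inject)
    moreover have "x = x'" using fun_cong[OF f, of a] \<open>a = a'\<close> by simp
    moreover have "b = b'" using fun_cong[OF f, of b] ne \<open>a = a'\<close> by (simp split: if_splits)
    moreover have "y = y'" using fun_cong[OF f, of b] ne \<open>a = a'\<close> \<open>b = b'\<close> by simp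
    ultimately show "P = Q" unfolding P' Q' by simp
  qed
  have image: "?F ` (?O \<times> ?S \<times> ?S) = ?T"
  proof (intro set_eqI iffI)
    fix q assume "q \<in> ?F ` (?O \<times> ?S \<times> ?S)"
    then obtain a b x y where q: "sym_diff (p a) (p b) = \<sigma>" "x \<in> ?S" "y \<in> ?S" "q = (?pair a b x y, a)"
      by auto
    have "vnorm (?pair a b x y) = 2" unfolding vnorm_2_iff using q neq[OF q(1)] by blast
    then have "?pair a b x y \<in> half_shadow"
      unfolding half_shadow_def using cond[OF neq[OF q(1)] q(2,3)] q(1) by blast
    then show "q \<in> ?T" using q(2,4) by auto
  next
    fix q assume "q \<in> ?T"
    then obtain w a where q: "q = (w, a)" "w \<in> half_shadow" "w a \<noteq> 0" by blast
    then obtain c d x y where w: "c \<noteq> d" "x \<in> ?S" "y \<in> ?S" "w = ?pair c d x y"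
      unfolding half_shadow_def vnorm_2_iff by blast
    have "\<exists>b x y. a \<noteq> b \<and> x \<in> ?S \<and> y \<in> ?S \<and> w = ?pair a b x y"
    proof (cases "a = c")
      case True
      then show ?thesis using w by blast
    next
      case False
      then have "a = d" using q(3) w(4) by (simp split: if_splits)
      moreover have "w = ?pair d c y x" using w(1,4) by (auto simp: fun_eq_iff)
      ultimately show ?thesis using w(1,2,3)
        by (intro exI[of _ c] exI[of _ y] exI[of _ x]) (simp only:, blast)
    qed
    then obtain b x y where b: "a \<noteq> b" "x \<in> ?S" "y \<in> ?S" "w = ?pair a b x y" by blast
    then have "sym_diff (p a) (p b) = \<sigma>" using cond[OF b(1,2,3)] q(2) unfolding half_shadow_def by blast
    then show "q \<in> ?F ` (?O \<times> ?S \<times> ?S)"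
      using b q(1) by (intro image_eqI[of _ _ "((a, b), x, y)"]) auto
  qed
  have fin: "finite half_shadow"
    unfolding half_shadow_def
    by (rule finite_subset[OF _ finite_fibresD[OF finite_fibres_vnorm, of 2]]) auto
  have "card {a. w a \<noteq> 0} = 2" if "w \<in> half_shadow" for w
  proof -
    have "vnorm w = 2" using that by (simp add: half_shadow_def)
    then obtain c d x y where w: "c \<noteq> d" "x \<in> ?S" "y \<in> ?S" "w = ?pair c d x y"
      unfolding vnorm_2_iff by blast
    then have "{a. w a \<noteq> 0} = {c, d}" by auto
    then show ?thesis using w(1) by simp
  qed
  then have "card ?T = 2 * card half_shadow" using fin by (simp add: card_SigmaI)
  moreover have "card ?T = card ?O * 4"
    unfolding image[symmetric] using card_image[OF inj] by (simp add: card_cartesian_product)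
  moreover have "card ?O = card {a. sym_diff (p a) \<sigma> \<in> range p}"
  proof -
    have swap: "sym_diff (p a) (p b) = \<sigma> \<longleftrightarrow> sym_diff (p a) \<sigma> = p b" for a b by blast
    have O: "?O = {(a, b). sym_diff (p a) \<sigma> = p b}" unfolding swap ..
    have "inj_on fst ?O"
    proof (rule inj_onI)
      fix P Q assume "P \<in> ?O" "Q \<in> ?O" and eq: "fst P = fst Q"
      then have "sym_diff (p (fst P)) \<sigma> = p (snd P)" and "sym_diff (p (fst Q)) \<sigma> = p (snd Q)"
        unfolding O by (simp_all only: mem_Collect_eq case_prod_beta)
      then have "p (snd P) = p (snd Q)" unfolding eq by (simp only:)
      then have "snd P = snd Q" by (rule injD[OF points_inj])
      then show "P = Q" using eq by (rule prod_eqI[rotated])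
    qed
    moreover have "fst ` ?O = {a. sym_diff (p a) \<sigma> \<in> range p}"
    proof (intro set_eqI iffI)
      fix a assume "a \<in> {a. sym_diff (p a) \<sigma> \<in> range p}"
      then obtain b where "sym_diff (p a) \<sigma> = p b" by blast
      then show "a \<in> fst ` ?O" unfolding O by (intro image_eqI[of _ _ "(a, b)"]) simp_all
    next
      fix a assume "a \<in> fst ` ?O"
      then obtain b where "(a, b) \<in> ?O" by fastforce
      then have "sym_diff (p a) \<sigma> = p b" unfolding O by (simp only: mem_Collect_eq case_prod_beta fst_conv snd_conv)
      then show "a \<in> {a. sym_diff (p a) \<sigma> \<in> range p}" by (intro CollectI) (simp only: rangeI)
    qed
    ultimately show ?thesis using card_image[of fst ?O] by (simp only:)
  qed
  ultimately show ?thesis by linarith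
qed

lemma card_shadow_norm_8:
  "card {v \<in> code.coset (shadow_vector \<sigma>). vnorm v = 8} = 2 * card {a. sym_diff (p a) \<sigma> \<in> range p}"
proof -
  have "inj_on (\<lambda>w i. 2 * w i) half_shadow" by (auto simp: inj_on_def fun_eq_iff)
  then show ?thesis unfolding shadow_norm_8 by (simp only: card_image card_half_shadow)
qed

lemma ex_odd_norm: "\<exists>u\<in>code g. odd (dot (shadow_vector \<sigma>) u)"
proof -
  obtain j where j: "j \<in> \<sigma>" "j < m" using sigma by blast
  have "(\<lambda>i. \<Sum>j\<in>{j}. g j i) \<in> code g" by (rule generator_mem_code) (use j in auto)
  moreover have "odd (dot (shadow_vector \<sigma>) (g j))" using dot_shadow_generator[OF j(2)] j(1) by simp
  ultimately show ?thesis by auto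
qed

end

theorem (in point_set) ex_extremal_lattice:
  assumes "CARD('n) = 40" "\<sigma> \<subseteq> {..<m}" "\<sigma> \<noteq> {}" "even (card \<sigma>)"
    and count: "card {a. sym_diff (p a) \<sigma> \<in> range p} = 2 * k"
  shows "\<exists>L :: (real ^ 'n) set. odd_unimodular L \<and> unimodular_lattice L \<and> min_norm L = 4
    \<and> theta_series L = theta40 (4 * int k) \<and> card {x \<in> shadow L. x \<bullet> x = 2} = 4 * k"
proof -
  obtain g :: "nat \<Rightarrow> 'n \<Rightarrow> int" where g: "\<And>j i. j < m \<Longrightarrow> odd (g j i) \<longleftrightarrow> j \<in> p i"
    "\<And>j l. j < m \<Longrightarrow> l < m \<Longrightarrow> 4 dvd dot (g j) (g l)"
    "\<And>j. j < m \<Longrightarrow> 8 dvd dot (g j) (g j) - 4 * of_bool (j \<in> \<sigma>)"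
    using ex_selforthogonal_lift[OF assms(2,4)] by blast
  interpret lifted_point_set p m pivot g \<sigma>
    by unfold_locales (use g assms in auto)
  have "card {v \<in> code.coset (shadow_vector \<sigma>). vnorm v = 8} = 4 * k"
    unfolding card_shadow_norm_8 count by simp
  note L = code.extremal_code_lattice[OF assms(1) code_min_norm ex_odd_norm this]
  show ?thesis
    using L code.code_lattice_unimodular by (intro exI[of _ code.code_lattice]) simp
qed

section \<open>The four point sets\<close>

fun span_words :: "nat \<Rightarrow> bool list list \<Rightarrow> bool list list" where
  "span_words n [] = [replicate n False]"
| "span_words n (r # rs) = (let W = span_words n rs in W @ map (map2 (\<noteq>) r) W)"

definition coordinate_row :: "nat list list \<Rightarrow> nat \<Rightarrow> bool list" where
  "coordinate_row ps j = map (\<lambda>c. j \<in> set c) ps"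

text \<open>
  An executable form of \<open>point_set\<close>: points are increasing lists of coordinates, and all words of the
  code are enumerated.  Weight 0 is allowed for the zero functional; any other functional is 1
  at a unit vector.
\<close>

definition admissible :: "nat \<Rightarrow> nat list list \<Rightarrow> bool" where
  "admissible m ps \<longleftrightarrow> 0 < m \<and> length ps = 40 \<and> distinct ps
     \<and> list_all (\<lambda>c. sorted c \<and> distinct c \<and> odd (length c) \<and> list_all (\<lambda>j. j < m) c) ps
     \<and> list_all (\<lambda>j. [j] \<in> set ps) [0..<m]
     \<and> list_all (\<lambda>w. length (filter id w) \<in> {0, 16, 20, 24, 40}) (span_words 40 (map (coordinate_row ps) [0..<m]))"

text \<open>
  Each unordered pair of points differing by \<open>\<sigma>\<close> is counted from both ends, hence \<open>2 * k\<close>.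
\<close>

definition translates :: "nat \<Rightarrow> nat list list \<Rightarrow> nat list \<Rightarrow> nat \<Rightarrow> bool" where
  "translates m ps \<sigma> k \<longleftrightarrow> list_all (\<lambda>j. j < m) \<sigma> \<and> distinct \<sigma> \<and> \<sigma> \<noteq> [] \<and> even (length \<sigma>)
     \<and> length (filter (\<lambda>c. filter (\<lambda>j. (j \<in> set c) \<noteq> (j \<in> set \<sigma>)) [0..<m] \<in> set ps) ps) = 2 * k"

lemma word_mem_span_words:
  assumes "distinct js" "J \<subseteq> set js"
  shows "map (\<lambda>c. odd (card (J \<inter> set c))) ps \<in> set (span_words (length ps) (map (coordinate_row ps) js))"
  using assms
proof (induction js arbitrary: J)
  case Nil
  then show ?case by (simp add: map_replicate_const)
next
  case (Cons j js)
  let ?word = "\<lambda>J. map (\<lambda>c. odd (card (J \<inter> set c))) ps"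
  let ?W = "set (span_words (length ps) (map (coordinate_row ps) js))"
  show ?case
  proof (cases "j \<in> J")
    case True
    have IH: "?word (J - {j}) \<in> ?W" using Cons by (intro Cons.IH) auto
    have "odd (card (J \<inter> set c)) \<longleftrightarrow> (j \<in> set c) \<noteq> odd (card ((J - {j}) \<inter> set c))" for c
    proof (cases "j \<in> set c")
      case jc: True
      then have "J \<inter> set c = insert j ((J - {j}) \<inter> set c)" using True by auto
      then have "card (J \<inter> set c) = Suc (card ((J - {j}) \<inter> set c))" by simp
      then show ?thesis using jc by simp
    next
      case False
      then have "J \<inter> set c = (J - {j}) \<inter> set c" by auto
      then show ?thesis using False by simp
    qed
    then have "?word J = map2 (\<noteq>) (coordinate_row ps j) (?word (J - {j}))"
      by (simp add: coordinate_row_def map2_map_map)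
    then show ?thesis using IH by (auto simp: Let_def)
  next
    case False
    then have "?word J \<in> ?W" using Cons.prems by (intro Cons.IH) auto
    then show ?thesis by (simp add: Let_def)
  qed
qed

theorem ex_extremal_lattice_of_list:
  assumes adm: "admissible m ps" and trans: "translates m ps \<sigma> k"
  shows "\<exists>L :: (real ^ 40) set. odd_unimodular L \<and> extremal40 L
    \<and> theta_series L = theta40 (4 * int k) \<and> card {x \<in> shadow L. x \<bullet> x = 2} = 4 * k"
proof -
  have \<sigma>: "list_all (\<lambda>j. j < m) \<sigma>" "distinct \<sigma>" "\<sigma> \<noteq> []" "even (length \<sigma>)"
    and count: "length (filter (\<lambda>c. filter (\<lambda>j. (j \<in> set c) \<noteq> (j \<in> set \<sigma>)) [0..<m] \<in> set ps) ps) = 2 * k"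
    using trans unfolding translates_def by blast+
  have m_pos: "0 < m" and len: "length ps = 40" and dist: "distinct ps"
    and point: "\<And>c. c \<in> set ps \<Longrightarrow> sorted c \<and> distinct c \<and> odd (length c) \<and> set c \<subseteq> {..<m}"
    and single: "\<And>j. j < m \<Longrightarrow> [j] \<in> set ps"
    and wt: "\<And>w. w \<in> set (span_words 40 (map (coordinate_row ps) [0..<m])) \<Longrightarrow>
      length (filter id w) \<in> {0, 16, 20, 24, 40}"
    using adm by (auto simp: admissible_def list_all_iff)
  obtain h :: "40 \<Rightarrow> nat" where "bij_betw h UNIV {0..<CARD(40)}"
    using ex_bij_betw_finite_nat[of "UNIV :: 40 set"] by auto
  then have h: "bij_betw h UNIV {..<40}" by (simp add: lessThan_atLeast0)
  then have h_inj: "inj h" and h_range: "range h = {..<40}" by (simp_all add: bij_betw_def)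
  have h_lt: "h i < 40" for i using h_range by blast
  have h_surj: "\<exists>i. h i = n" if "n < 40" for n
    using h_range that by (metis imageE lessThan_iff)
  define p where "p i = set (ps ! h i)" for i
  have mem: "ps ! h i \<in> set ps" for i using h_lt len by simp
  have ex_index: "\<exists>i. ps ! h i = c" if "c \<in> set ps" for c
    using that h_surj len by (metis in_set_conv_nth)
  define pivot where "pivot j = (SOME i. ps ! h i = [j])" for j
  have card_list: "card {i. P (ps ! h i)} = length (filter P ps)" for P
  proof -
    have "{n. n < length ps \<and> P (ps ! n)} = h ` {i. P (ps ! h i)}"
      using h_lt h_surj len by fastforce
    then show ?thesis
      using h_inj by (simp add: length_filter_conv_card card_image inj_on_def)
  qed
  have set_eqD: "c = d" if "c \<in> set ps" "sorted d" "distinct d" "set c = set d" for c d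
    using point[OF that(1)] that by (simp add: sorted_distinct_set_unique)
  interpret point_set p m pivot
  proof
    show "8 dvd CARD(40)" "0 < m" using m_pos by simp_all
    show "p i \<subseteq> {..<m}" "odd (card (p i))" for i
      using point[OF mem[of i]] by (simp_all add: p_def distinct_card)
    show "inj p"
    proof (rule injI)
      fix a b assume "p a = p b"
      then have "ps ! h a = ps ! h b" using set_eqD[OF mem] point[OF mem] by (simp add: p_def)
      then have "h a = h b" using dist len h_lt by (simp add: nth_eq_iff_index_eq)
      then show "a = b" using h_inj by (simp add: inj_eq)
    qed
    show pivot: "p (pivot j) = {j}" if "j < m" for j
    proof -
      have "ps ! h (pivot j) = [j]" unfolding pivot_def by (rule someI_ex) (rule ex_index[OF single[OF that]])
      then show ?thesis by (simp add: p_def)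
    qed
    show "4 dvd card {i. odd (card (J \<inter> p i))} \<and> 16 \<le> card {i. odd (card (J \<inter> p i))}"
      if J: "J \<subseteq> {..<m}" "J \<noteq> {}" for J
    proof -
      let ?word = "map (\<lambda>c. odd (card (J \<inter> set c))) ps"
      have "?word \<in> set (span_words 40 (map (coordinate_row ps) [0..<m]))"
        using word_mem_span_words[of "[0..<m]" J ps] J(1) len by (simp add: lessThan_atLeast0)
      then have *: "length (filter id ?word) \<in> {0, 16, 20, 24, 40}" by (rule wt)
      have "card {i. odd (card (J \<inter> p i))} = length (filter id ?word)"
        using card_list[of "\<lambda>c. odd (card (J \<inter> set c))"] by (simp add: p_def filter_map comp_def)
      moreover obtain j where j: "j \<in> J" "j < m" using J by blast
      then have "odd (card (J \<inter> p (pivot j)))" using pivot[OF j(2)] by simp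
      then have "card {i. odd (card (J \<inter> p i))} \<noteq> 0" by auto
      ultimately show ?thesis using * by auto
    qed
  qed
  have "card {a. sym_diff (p a) (set \<sigma>) \<in> range p} = 2 * k"
  proof -
    have "sym_diff (set c) (set \<sigma>) \<in> range p \<longleftrightarrow> filter (\<lambda>j. (j \<in> set c) \<noteq> (j \<in> set \<sigma>)) [0..<m] \<in> set ps"
      if c: "c \<in> set ps" for c
    proof -
      let ?f = "filter (\<lambda>j. (j \<in> set c) \<noteq> (j \<in> set \<sigma>)) [0..<m]"
      have f: "set ?f = sym_diff (set c) (set \<sigma>)"
        using point[OF c] \<sigma>(1) by (auto simp: list_all_iff)
      have sd: "sorted ?f" "distinct ?f" by (simp_all add: sorted_wrt_filter)
      show ?thesis
      proof
        assume "sym_diff (set c) (set \<sigma>) \<in> range p"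
        then obtain i where "set (ps ! h i) = set ?f" unfolding f p_def by blast
        then show "?f \<in> set ps" using set_eqD[OF mem sd] mem[of i] by simp
      next
        assume "?f \<in> set ps"
        then obtain i where "ps ! h i = ?f" using ex_index by blast
        then have "p i = sym_diff (set c) (set \<sigma>)" unfolding p_def using f by simp
        then show "sym_diff (set c) (set \<sigma>) \<in> range p" by (metis rangeI)
      qed
    qed
    then have "{a. sym_diff (p a) (set \<sigma>) \<in> range p}
        = {a. filter (\<lambda>j. (j \<in> set (ps ! h a)) \<noteq> (j \<in> set \<sigma>)) [0..<m] \<in> set ps}"
      using mem unfolding p_def by blast
    then show ?thesis
      using count card_list[of "\<lambda>c. filter (\<lambda>j. (j \<in> set c) \<noteq> (j \<in> set \<sigma>)) [0..<m] \<in> set ps"]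
      by (simp only:)
  qed
  moreover have "set \<sigma> \<subseteq> {..<m}" "set \<sigma> \<noteq> {}" "even (card (set \<sigma>))"
    using \<sigma> by (auto simp: list_all_iff distinct_card)
  moreover have "CARD(40) = 40" by simp
  ultimately show ?thesis
    using ex_extremal_lattice[of "set \<sigma>" k] unfolding extremal40_def by blast
qed

text \<open>
  The first three sets were found by a computer search through subsets on which the functionals take the
  value 1 with the admissible frequencies.  The numbers of pairs differing by \<open>\<sigma>\<close> spread around a mean
  that shrinks as \<open>m\<close> grows, so the small \<open>k\<close> come from \<open>m = 9\<close> and the largest from \<open>m = 7\<close>.
  The last set is an affine image of \<open>D \<times> GF(2)\<close>, where \<open>D\<close> consists of the 20 vectors of weight 3 in
  \<open>GF(2)^6\<close>; the translation along the second factor pairs up all 40 points.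
\<close>

definition points9 :: "nat list list" where
  "points9 =
    [[0], [1], [2], [3], [4], [5], [6], [7], [8], [0,3,8], [0,4,5], [0,5,6], [0,6,7], [1,2,3],
     [1,3,4], [1,4,7], [1,5,6], [2,4,8], [3,4,7], [4,7,8], [6,7,8], [0,1,2,4,6], [0,1,2,5,8],
     [0,1,2,7,8], [0,1,3,4,8], [0,1,4,6,8], [0,2,3,5,6], [0,2,3,6,8], [0,2,5,6,7], [0,4,5,7,8],
     [1,2,3,5,8], [1,2,3,6,8], [1,2,4,6,7], [1,3,4,5,7], [1,3,5,6,7], [2,3,4,5,8], [2,4,5,6,7],
     [3,5,6,7,8], [0,1,2,3,4,5,7], [0,2,3,5,6,7,8]]"

definition points8 :: "nat list list" where
  "points8 =
    [[0], [1], [2], [3], [4], [5], [6], [7], [0,1,3], [0,1,6], [0,1,7], [0,4,6], [0,4,7],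
     [0,6,7], [1,2,3], [1,2,6], [1,2,7], [1,4,5], [1,6,7], [2,3,5], [2,4,6], [2,5,6], [2,5,7],
     [3,4,5], [3,5,6], [3,5,7], [4,5,6], [4,6,7], [0,1,2,3,6], [0,1,2,3,7], [0,1,3,4,6],
     [0,1,3,4,7], [0,1,3,5,7], [0,2,3,4,5], [0,2,3,4,7], [0,2,4,5,6], [0,2,4,5,7], [1,2,3,5,7],
     [1,4,5,6,7], [2,3,4,5,6]]"

definition points7 :: "nat list list" where
  "points7 =
    [[0], [1], [2], [3], [4], [5], [6], [0,1,3], [0,1,5], [0,1,6], [0,2,3], [0,2,4], [0,2,6],
     [0,3,4], [0,3,5], [0,3,6], [0,4,5], [0,5,6], [1,2,3], [1,2,4], [1,2,6], [1,3,4], [1,3,5],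
     [1,3,6], [1,4,5], [1,5,6], [2,3,4], [2,3,5], [2,3,6], [2,4,5], [2,5,6], [3,4,5], [3,4,6],
     [3,5,6], [4,5,6], [0,1,2,3,4], [0,1,2,4,5], [0,1,3,5,6], [0,2,3,4,6], [1,2,3,4,6]]"

definition points7_paired :: "nat list list" where
  "points7_paired =
    [[0], [1], [2], [3], [4], [5], [6], [0,1,2], [0,1,3], [0,1,6], [0,2,3], [0,2,4], [0,2,5],
     [0,2,6], [0,3,4], [0,3,5], [0,3,6], [0,4,5], [0,4,6], [1,2,3], [1,2,6], [1,3,6], [1,4,5],
     [1,5,6], [2,3,4], [2,3,5], [2,3,6], [2,4,5], [2,4,6], [3,4,5], [3,4,6], [0,1,2,3,6],
     [0,1,2,4,5], [0,1,2,5,6], [0,1,3,4,5], [0,1,3,5,6], [0,2,3,4,5], [0,2,3,4,6], [1,2,3,4,5],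
     [1,2,3,5,6]]"

lemma admissible_points9: "admissible 9 points9"
  by code_simp

lemma admissible_points8: "admissible 8 points8"
  by code_simp

lemma admissible_points7: "admissible 7 points7"
  by code_simp

lemma admissible_points7_paired: "admissible 7 points7_paired"
  by code_simp

lemma translates_points9:
  "translates 9 points9 [0, 1, 3, 4, 5, 6, 7, 8] 0"
  "translates 9 points9 [0, 3, 4, 5] 1"
  "translates 9 points9 [1, 2] 2"
  "translates 9 points9 [0, 1] 3"
  "translates 9 points9 [1, 3] 4"
  "translates 9 points9 [1, 4] 5"
  "translates 9 points9 [1, 2, 4, 7] 6"
  "translates 9 points9 [0, 4, 5, 6, 7, 8] 7"
  by code_simp+

lemma translates_points8:
  "translates 8 points8 [0, 2] 8"
  "translates 8 points8 [2, 3] 9"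
  "translates 8 points8 [0, 1, 4, 5] 11"
  "translates 8 points8 [6, 7] 13"
  by code_simp+

lemma translates_points7:
  "translates 7 points7 [4, 5] 10"
  "translates 7 points7 [2, 3] 12"
  "translates 7 points7 [0, 2] 14"
  "translates 7 points7 [0, 1] 16"
  by code_simp+

lemma translates_points7_paired:
  "translates 7 points7_paired [0, 2] 20"
  by code_simp+

theorem proposition5p3:
  fixes k :: nat
  assumes "k \<in> {0..14} \<union> {16, 20}"
  shows "\<exists>L :: (real ^ 40) set.
           odd_unimodular L \<and> extremal40 L \<and>
           theta_series L = theta40 (4 * int k) \<and>
           card {x \<in> shadow L. x \<bullet> x = 2} = 4 * k"
proof -
  note lattices = translates_points9[THEN ex_extremal_lattice_of_list[OF admissible_points9]]
    translates_points8[THEN ex_extremal_lattice_of_list[OF admissible_points8]]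
    translates_points7[THEN ex_extremal_lattice_of_list[OF admissible_points7]]
    translates_points7_paired[THEN ex_extremal_lattice_of_list[OF admissible_points7_paired]]
  have "k \<le> 14 \<or> k = 16 \<or> k = 20" using assms by auto
  then have "k = 0 \<or> k = 1 \<or> k = 2 \<or> k = 3 \<or> k = 4 \<or> k = 5 \<or> k = 6 \<or> k = 7 \<or> k = 8 \<or> k = 9
    \<or> k = 10 \<or> k = 11 \<or> k = 12 \<or> k = 13 \<or> k = 14 \<or> k = 16 \<or> k = 20" by arith
  then show ?thesis by (elim disjE; hypsubst) (rule lattices)+
qed

end
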